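(* Let $p\in\mathbb{N}$, $\mathbf{a},\mathbf{b}\in\mathbb{C}^p$ with $-\mathbf{a}\notin\mathbb{N}_0$, $\psi=\sum_{k=1}^p(b_k-a_k)$, and let $n\in\mathbb{N}_0$ satisfy $n>-\min(\Re(\psi),\Re(a_1),\dots,\Re(a_p))$. Then for all $k\in\mathbb{N}_0$ $$m_k:=\int_0^1\widehat{G}_n(t)t^k\,dt=\frac{\Gamma(\mathbf{a})}{\Gamma(\mathbf{b})(n+k)(n-1)!}\,{}_{p+2}F_{p+1}\!\left(\begin{matrix}-n-k,-n+1,\mathbf{a}\\-n-k+1,\mathbf{b}\end{matrix}\,\Big|\,1\right)+\frac{(-1)^n\Gamma(\mathbf{a}+n+k)\,k!}{\Gamma(\mathbf{b}+n+k)(n+k)!},$$ $$\hat{m}_k:=\int_0^1\widehat{G}_n(t)(1-t)^k\,dt=\frac{\Gamma(\mathbf{a})\,k!}{\Gamma(\mathbf{b})(n+k)!}\,{}_{p+1}F_p\!\left(\begin{matrix}-n-k,\mathbf{a}\\\mathbf{b}\end{matrix}\,\Big|\,1\right),$$ where $1/(-1)!=0$ (so for $n=0$ the first term in the formula for $m_k$ is absent). Moreover, with $\Delta m_k=m_{k+1}-m_k$, $\Delta^rm_k=\Delta(\Delta^{r-1}m_k)$ (and similarly for $\hat m_k$), for all $k,r\in\mathbb{N}_0$, $$(-1)^r\Delta^rm_k=(-1)^k\Delta^k\hat{m}_r=\int_0^1\widehat{G}_n(t)(1-t)^rt^k\,dt=\frac{\Gamma(\mathbf{a})}{\Gamma(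\mathbf{b})}\sum_{j=0}^{k}\binom{k}{j}\frac{(-1)^j(r+j)!}{(n+r+j)!}\,{}_{p+1}F_p\!\left(\begin{matrix}-n-r-j,\mathbf{a}\\\mathbf{b}\end{matrix}\,\Big|\,1\right).$$
   Context: $\mathbb{N}_0=\mathbb{N}\cup\{0\}$. For a vector $\mathbf{a}=(a_1,\dots,a_p)$: $\Gamma(\mathbf{a})=\prod_i\Gamma(a_i)$, $(\mathbf{a})_j=\prod_i(a_i)_j$, $\mathbf{a}+\mu=(a_1+\mu,\dots,a_p+\mu)$; conditions such as $-\mathbf{a}\notin\mathbb{N}_0$ are element-wise. For $0<t<1$ and $-\mathbf{a}\notin\mathbb{N}_0$, $$\widehat{G}_n(t)=G^{p,1}_{p+1,p+1}\!\left(t\,\Big|\begin{array}{l}n,\mathbf{b}+n-1\\ \mathbf{a}+n-1,0\end{array}\right)=\frac{1}{2\pi i}\int_{\mathcal{L}}\frac{\Gamma(\mathbf{a}+n-1+s)\,\Gamma(1-n-s)}{\Gamma(\mathbf{b}+n-1+s)\,\Gamma(1-s)}\,t^{-s}\,ds,$$ where $\mathcal{L}$ is a left loop (starting and ending at $-\infty$, traversed counterclockwise) that leaves all the points $1-a_j-n-l$, $l\in\mathbb{N}_0$, on its left and all the points $1-n+k$, $k\in\mathbb{N}_0$, on its right. Terminating hypergeometric series divided by $\Gamma(\mathbf{b})$ are understood termwise, i.e. $(\mathbf{b})_j\Gamma(\mathbf{b})$ is replaced by $\Gamma(\mathbf{b}+j)$; the series ${}_{p+2}F_{p+1}$ with upper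 parameter $-n+1$ ($n\ge1$) and lower parameter $-n-k+1$ is understood as the sum of its terms with index $0\le j\le n-1$. *)

theory Defs
  imports "HOL-Complex_Analysis.Complex_Analysis"
begin

definition Gamma_prod :: "complex list \<Rightarrow> complex" where
  "Gamma_prod cs = (\<Prod>c\<leftarrow>cs. Gamma c)"

definition pochhammer_prod :: "complex list \<Rightarrow> nat \<Rightarrow> complex" where
  "pochhammer_prod cs j = (\<Prod>c\<leftarrow>cs. pochhammer c j)"

definition shift :: "complex list \<Rightarrow> complex \<Rightarrow> complex list" where
  "shift cs \<mu> = map (\<lambda>c. c + \<mu>) cs"

(* The terms of index at most N of the hypergeometric series F(us; vs, bs | z),
   divided termwise by Gamma(bs): each product (b)_j Gamma(b) is replaced by Gamma(b + j).
   The library's Gamma is 0 at its poles, so division by Gamma is multiplication by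
   the entire function 1/Gamma, also at these points. *)
definition hyp_div_Gamma ::
    "nat \<Rightarrow> complex list \<Rightarrow> complex list \<Rightarrow> complex list \<Rightarrow> complex \<Rightarrow> complex" where
  "hyp_div_Gamma N us vs bs z =
     (\<Sum>j\<le>N. pochhammer_prod us j / (pochhammer_prod vs j * Gamma_prod (shift bs (of_nat j)))
             * z ^ j / fact j)"

lemma hyp_div_Gamma_eq_fps_hypergeo:
  assumes "\<And>b. b \<in> set bs \<Longrightarrow> b \<notin> \<int>\<^sub>\<le>\<^sub>0"
  shows "hyp_div_Gamma N us vs bs z =
           (\<Sum>j\<le>N. fps_nth (fps_hypergeo us (vs @ bs) z) j) / Gamma_prod bs"
proof -
  have foldl_eq: "foldl (\<lambda>r a. r * pochhammer a j) c as = c * pochhammer_prod as j"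
    for c :: complex and as j
    by (induction as arbitrary: c) (simp_all add: pochhammer_prod_def mult.assoc)
  have shift_eq: "Gamma_prod (shift bs (of_nat j)) = pochhammer_prod bs j * Gamma_prod bs" for j
    using assms
  proof (induction bs)
    case Nil
    then show ?case by (simp add: Gamma_prod_def shift_def pochhammer_prod_def)
  next
    case (Cons b bs)
    have "Gamma (b + of_nat j) = pochhammer b j * Gamma b"
      using pochhammer_Gamma[of b j] Cons.prems[of b] by (simp add: Gamma_eq_zero_iff)
    with Cons show ?case by (simp add: Gamma_prod_def shift_def pochhammer_prod_def)
  qed
  show ?thesis
    by (simp add: hyp_div_Gamma_def fps_hypergeo_def foldl_eq shift_eq sum_divide_distrib)
       (simp add: pochhammer_prod_def mult_ac)
qed

(* A left loop is given by its middle part g. It comes in from -\<infinity> along the horizontal ray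
   ending at pathstart g, follows g, and goes back to -\<infinity> along the horizontal ray issuing
   from pathfinish g. *)
definition loop_image :: "(real \<Rightarrow> complex) \<Rightarrow> complex set" where
  "loop_image g =
     {s. Im s = Im (pathstart g) \<and> Re s \<le> Re (pathstart g)} \<union> path_image g \<union>
     {s. Im s = Im (pathfinish g) \<and> Re s \<le> Re (pathfinish g)}"

(* The loop cut off at Re s = -X and closed by a vertical segment. *)
definition loop_closure :: "(real \<Rightarrow> complex) \<Rightarrow> real \<Rightarrow> real \<Rightarrow> complex" where
  "loop_closure g X =
     linepath (Complex (-X) (Im (pathstart g))) (pathstart g) +++ g +++
     linepath (pathfinish g) (Complex (-X) (Im (pathfinish g))) +++
     linepath (Complex (-X) (Im (pathfinish g))) (Complex (-X) (Im (pathstart g)))"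

(* Entering along the lower ray and leaving along the upper one makes the simple loop
   counterclockwise. *)
definition left_loop :: "(real \<Rightarrow> complex) \<Rightarrow> bool" where
  "left_loop g \<longleftrightarrow>
     valid_path g \<and> Im (pathstart g) < Im (pathfinish g) \<and>
     (\<forall>\<^sub>F X in at_top. simple_path (loop_closure g X))"

definition on_left :: "(real \<Rightarrow> complex) \<Rightarrow> complex \<Rightarrow> bool" where
  "on_left g z \<longleftrightarrow>
     z \<notin> loop_image g \<and> (\<forall>\<^sub>F X in at_top. winding_number (loop_closure g X) z = 1)"

definition on_right :: "(real \<Rightarrow> complex) \<Rightarrow> complex \<Rightarrow> bool" where
  "on_right g z \<longleftrightarrow>
     z \<notin> loop_image g \<and> (\<forall>\<^sub>F X in at_top. winding_number (loop_closure g X) z = 0)"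

definition loop_integral :: "(real \<Rightarrow> complex) \<Rightarrow> (complex \<Rightarrow> complex) \<Rightarrow> complex" where
  "loop_integral g f =
     (LBINT x:{..Re (pathstart g)}. f (Complex x (Im (pathstart g))))
     + contour_integral g f
     - (LBINT x:{..Re (pathfinish g)}. f (Complex x (Im (pathfinish g))))"

definition separating_left_loop :: "complex list \<Rightarrow> nat \<Rightarrow> (real \<Rightarrow> complex) \<Rightarrow> bool" where
  "separating_left_loop a n g \<longleftrightarrow>
     left_loop g \<and>
     (\<forall>c\<in>set a. \<forall>l::nat. on_left g (1 - c - of_nat n - of_nat l)) \<and>
     (\<forall>k::nat. on_right g (1 - of_nat n + of_nat k))"

(* The definitions describe the intended contours: if Re c > 0 for all c in a, a half-strip
   bounded on the right by a vertical segment already separates the two families of points. *)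
lemma separating_left_loop_exists:
  assumes "\<forall>c\<in>set a. Re c > 0"
  shows "\<exists>g. separating_left_loop a n g"
proof -
  define d where "d = Min (insert 1 (Re ` set a))"
  define h where "h = Max (insert 0 ((\<lambda>c. \<bar>Im c\<bar>) ` set a)) + 1"
  define R where "R = 1 - real n - d / 2"
  have d: "d > 0" "\<And>c. c \<in> set a \<Longrightarrow> d \<le> Re c"
    using assms by (auto simp: d_def)
  have h': "\<bar>Im c\<bar> < h" if "c \<in> set a" for c
  proof -
    have "\<bar>Im c\<bar> \<le> Max (insert 0 ((\<lambda>c. \<bar>Im c\<bar>) ` set a))"
      using that by (intro Max_ge) auto
    then show ?thesis by (simp add: h_def)
  qed
  have "Max (insert 0 ((\<lambda>c. \<bar>Im c\<bar>) ` set a)) \<ge> 0"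
    by (intro Max_ge) auto
  then have h: "h > 0" unfolding h_def by linarith
  define g where "g = linepath (Complex R (-h)) (Complex R h)"
  have closure_eq: "loop_closure g X = rectpath (Complex (-X) (-h)) (Complex R h)" for X
    by (simp add: loop_closure_def rectpath_def g_def Let_def)
  have image_le: "z \<notin> loop_image g" if "Re z \<noteq> R" "Re z > R \<or> \<bar>Im z\<bar> < h" for z
  proof -
    have "z \<notin> path_image g"
      using that(1) by (auto simp: g_def closed_segment_same_Re)
    then show ?thesis using that by (auto simp: loop_image_def g_def)
  qed
  have "left_loop g"
    unfolding left_loop_def
  proof (intro conjI)
    show "\<forall>\<^sub>F X in at_top. simple_path (loop_closure g X)"
      using eventually_gt_at_top[of "- R"] unfolding closure_eq
      by eventually_elim (use h in \<open>auto intro!: simple_path_rectpath\<close>)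
  qed (use h in \<open>auto simp: g_def\<close>)
  moreover have "on_left g (1 - c - of_nat n - of_nat l)" if c: "c \<in> set a" for c and l :: nat
  proof -
    let ?z = "1 - c - of_nat n - of_nat l"
    have *: "Re ?z < R" "\<bar>Im ?z\<bar> < h" using d(1) d(2)[OF c] h'[OF c] by (auto simp: R_def)
    have "\<forall>\<^sub>F X in at_top. winding_number (loop_closure g X) ?z = 1"
      using eventually_gt_at_top[of "- Re ?z"] unfolding closure_eq
    proof eventually_elim
      case (elim X)
      then show ?case
        by (intro winding_number_rectpath) (use * in \<open>auto simp: in_box_complex_iff\<close>)
    qed
    with image_le[of ?z] * show ?thesis by (auto simp: on_left_def)
  qed
  moreover have "on_right g (1 - of_nat n + of_nat k)" for k :: nat
  proof -
    let ?z = "1 - of_nat n + of_nat k :: complex"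
    have *: "Re ?z > R" using d(1) by (simp add: R_def)
    have "\<forall>\<^sub>F X in at_top. winding_number (loop_closure g X) ?z = 0"
      using eventually_gt_at_top[of "- R"] unfolding closure_eq
      by eventually_elim
        (use h * in \<open>auto intro!: winding_number_rectpath_outside simp: in_cbox_complex_iff\<close>)
    with image_le[of ?z] * show ?thesis by (auto simp: on_right_def)
  qed
  ultimately show ?thesis unfolding separating_left_loop_def by blast
qed

definition G_hat ::
    "(real \<Rightarrow> complex) \<Rightarrow> complex list \<Rightarrow> complex list \<Rightarrow> nat \<Rightarrow> real \<Rightarrow> complex" where
  "G_hat g a b n t =
     1 / (2 * of_real pi * \<i>) *
     loop_integral g (\<lambda>s.
       Gamma_prod (shift a (of_nat n - 1 + s)) * Gamma (1 - of_nat n - s) /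
       (Gamma_prod (shift b (of_nat n - 1 + s)) * Gamma (1 - s)) * of_real t powr (- s))"

definition moment :: "(real \<Rightarrow> complex) \<Rightarrow> nat \<Rightarrow> complex" where
  "moment f k = (LBINT t:{0<..<1}. f t * of_real t ^ k)"

definition moment1 :: "(real \<Rightarrow> complex) \<Rightarrow> nat \<Rightarrow> complex" where
  "moment1 f k = (LBINT t:{0<..<1}. f t * of_real (1 - t) ^ k)"

definition fdiff :: "(nat \<Rightarrow> complex) \<Rightarrow> nat \<Rightarrow> complex" where
  "fdiff m k = m (Suc k) - m k"

end

theory Submission
  imports Defs
begin

text \<open>Write \<open>\<phi>(u) = \<Gamma>(a + u)/\<Gamma>(b + u)\<close>. After replacing \<open>\<Gamma>(1 - n - s)/\<Gamma>(1 - s)\<close> by the reciprocal of a Pochhammer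
  symbol, the integrand of \<open>G_hat\<close> is \<open>F(s) t\<^sup>-\<^sup>s\<close> with \<open>F(s) = \<phi>(n - 1 + s)/(1 - n - s)\<^sub>n\<close>. Its poles are among the
  left ones, where \<open>\<Gamma>(a + n - 1 + s)\<close> is infinite, and the finitely many right ones \<open>s = 0, -1, \<dots>, 1 - n\<close>.

  One would like to integrate \<open>t\<^sup>k\<^sup>-\<^sup>s\<close> over \<open>(0, 1)\<close> under the loop integral, but the given loop may leave the
  half plane \<open>Re s < k + 1\<close> where this is possible. The assumption on the real parts of the \<open>a\<^sub>j\<close> ensures that all
  poles, left and right, lie in a half-strip to the left of \<open>Re s = 1\<close>. Replacing the loop by the boundary of
  this half-strip changes the integral by the residues at the right poles
  (\<open>loop_integral_eq_half_strip\<close>), which form a polynomial in \<open>t\<close> of degree less than \<open>n\<close>. Now Fubini's theorem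
  applies (\<open>half_strip_loop_moment\<close>) and turns the \<open>k\<close>-th moment of the half-strip integral into the integral of
  \<open>F(s)/(k + 1 - s)\<close>. Deforming the half-strip outwards to infinity meets only the pole \<open>k + 1\<close>, so the integral is
  \<open>2 \<pi> \<i> F(k + 1)\<close> (\<open>half_strip_moment_integral\<close>). The value \<open>F(k + 1)\<close> is the second term in the formula for \<open>m\<^sub>k\<close>; the moment of the polynomial
  is the first.

  All of this rests on one estimate: \<open>|\<phi>(u)|\<close> is at most of order \<open>|u|\<close> to the power \<open>- Re \<psi>\<close> away from the poles,
  in every direction (\<open>Gamma_quotient_bound\<close>). Together with the Pochhammer symbol this gives \<open>F\<close> the decay exponent
  \<open>\<delta> = Re \<psi> + n > 0\<close>. The estimate comes from Gauss's product for the Gamma function, and near the negative axis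
  from the reflection formula.

  The remaining formulas are algebra. The moments of \<open>t\<^sup>k (1 - t)\<^sup>r\<close> satisfy a difference recurrence that is symmetric
  in \<open>k\<close> and \<open>r\<close> (\<open>alternating_binomial_of_difference_recurrence\<close>); with partial fractions it transforms the formula
  for \<open>m\<^sub>k\<close> into the one for the moments of \<open>(1 - t)\<^sup>k\<close>.\<close>

section \<open>Growth of quotients of Gamma functions\<close>

lemma arctan_increment_ge: "arctan (x + 1) - arctan x \<ge> 1 / (3 * (1 + x\<^sup>2))"
proof -
  obtain \<xi> where \<xi>: "x < \<xi>" "\<xi> < x + 1" "arctan (x + 1) - arctan x = (x + 1 - x) * inverse (1 + \<xi>\<^sup>2)"
    using MVT2[of x "x + 1" arctan "\<lambda>x. inverse (1 + x\<^sup>2)"] DERIV_arctan by auto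
  have "\<bar>\<xi>\<bar> \<le> \<bar>x\<bar> + 1" using \<xi> by linarith
  then have "\<xi>\<^sup>2 \<le> (\<bar>x\<bar> + 1)\<^sup>2" by (metis abs_ge_zero power2_abs power_mono)
  also have "\<dots> \<le> 2 * x\<^sup>2 + 2"
    using zero_le_power2[of "\<bar>x\<bar> - 1"] by (simp add: power2_eq_square algebra_simps)
  finally have "1 + \<xi>\<^sup>2 \<le> 3 * (1 + x\<^sup>2)" using zero_le_power2[of x] by argo
  then have "1 / (3 * (1 + x\<^sup>2)) \<le> 1 / (1 + \<xi>\<^sup>2)"
    by (intro divide_left_mono) (auto intro!: mult_pos_pos add_pos_nonneg)
  then show ?thesis using \<xi>(3) by (simp add: inverse_eq_divide)
qed

text \<open>The sum is bounded uniformly in \<open>u\<close>, however far to the left \<open>u\<close> lies: the terms are dominated by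
  the increments of \<open>6 arctan\<close> along the points \<open>Re u + k\<close>, so that the sum telescopes.\<close>
lemma sum_inverse_norm_square_shift_le:
  fixes u :: complex
  assumes "\<And>k::nat. norm (u + of_nat k) \<ge> 1"
  shows "(\<Sum>k<N. 1 / (norm (u + of_nat k))\<^sup>2) \<le> 6 * pi"
proof -
  have "(\<Sum>k<N. 1 / (norm (u + of_nat k))\<^sup>2)
      \<le> (\<Sum>k<N. 6 * (arctan (Re u + real (Suc k)) - arctan (Re u + real k)))"
  proof (rule sum_mono)
    fix k
    let ?v = "u + of_nat k" and ?x = "Re u + real k"
    have *: "(norm ?v)\<^sup>2 \<ge> 1" "(norm ?v)\<^sup>2 \<ge> ?x\<^sup>2"
      
      using power_mono[OF assms[of k], of 2] by (simp_all add: cmod_power2)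
    have "1 / (norm ?v)\<^sup>2 \<le> 2 / (1 + ?x\<^sup>2)"
    proof -
      have "1 / (norm ?v)\<^sup>2 \<le> 1 / ((1 + ?x\<^sup>2) / 2)"
        using * zero_le_power2[of ?x] by (intro divide_left_mono mult_pos_pos) argo+
      then show ?thesis by simp
    qed
    also have "2 / (1 + ?x\<^sup>2) = 6 * (1 / (3 * (1 + ?x\<^sup>2)))"
    proof -
      have "2 / X = 6 * (1 / (3 * X))" for X :: real by simp
      then show ?thesis .
    qed
    also have "\<dots> \<le> 6 * (arctan (?x + 1) - arctan ?x)"
      by (intro mult_left_mono arctan_increment_ge) auto
    finally show "1 / (norm ?v)\<^sup>2 \<le> 6 * (arctan (Re u + real (Suc k)) - arctan ?x)"
      by (simp add: add_ac)
  qed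
  also have "\<dots> = 6 * (arctan (Re u + real N) - arctan (Re u))"
    unfolding sum_distrib_left[symmetric] sum_lessThan_telescope[of "\<lambda>k. arctan (Re u + real k)"]
    by simp
  also have "\<dots> \<le> 6 * pi" 
    using arctan_ubound[of "Re u + real N"] arctan_lbound[of "Re u"] by simp
  finally show ?thesis .
qed

text \<open>Adding a positive real number turns a point off the cut towards the positive axis, without
  crossing it; so the principal logarithms subtract with no multiple of \<open>2\<pi>\<i>\<close>.\<close>
lemma Ln_add_one_diff:
  assumes "Im v \<noteq> 0 \<or> Re v > 0" "norm v > 1"
  shows "Ln (v + 1) - Ln v = Ln (1 + 1 / v)"
proof -
  have v0: "v \<noteq> 0" using assms by auto
  have re: "Re (1 + 1 / v) > 0"
  proof -
    have "norm (1 / v) < 1" using assms by (simp add: norm_divide divide_simps)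
    then have "\<bar>Re (1 / v)\<bar> < 1" using abs_Re_le_cmod[of "1/v"] by linarith
    then show ?thesis by simp
  qed
  then have w0: "1 + 1 / v \<noteq> 0" by (metis less_irrefl zero_complex.sel(1))
  have w: "\<bar>Im (Ln (1 + 1 / v))\<bar> < pi / 2"
    using re w0 Re_Ln_pos_lt by blast
  have sgn: "Im (1 + 1 / v) * Im v \<le> 0"
  proof -
    have "Im (1 + 1 / v) * Im v = - ((Im v)\<^sup>2 / (norm v)\<^sup>2)"
      by (simp only: plus_complex.sel Im_divide cmod_power2) (simp add: power2_eq_square)
    then show ?thesis by simp
  qed
  have "-pi < Im (Ln v) + Im (Ln (1 + 1 / v)) \<and> Im (Ln v) + Im (Ln (1 + 1 / v)) \<le> pi"
  proof (cases "Re v > 0")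
    case True
    then have "\<bar>Im (Ln v)\<bar> < pi / 2" using v0 Re_Ln_pos_lt by blast
    with w show ?thesis by linarith
  next
    case False
    then have "Im v \<noteq> 0" using assms by auto
    then consider "Im v > 0" | "Im v < 0" by linarith
    then show ?thesis
    proof cases
      case 1
      then have "Im (1 + 1 / v) \<le> 0" using sgn by (simp add: mult_le_0_iff)
      moreover have "Im (Ln (1 + 1 / v)) \<le> 0"
        using Im_Ln_pos_lt[OF w0] calculation w pi_gt_zero by argo
      moreover have "0 < Im (Ln v)" "Im (Ln v) < pi" using 1 v0 Im_Ln_pos_lt by blast+
      ultimately show ?thesis using w by linarith
    next
      case 2
      then have "Im (1 + 1 / v) \<ge> 0" using sgn by (simp add: mult_le_0_iff)
      then have "Im (Ln (1 + 1 / v)) \<ge> 0"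
        using Im_Ln_pos_le[OF w0] by blast
      moreover have "Im (Ln v) < 0" "Im (Ln v) > -pi"
        using 2 v0 Im_Ln_pos_le[OF v0] mpi_less_Im_Ln[OF v0] Im_Ln_le_pi[OF v0] by (auto simp: not_le[symmetric])
      ultimately show ?thesis using w by linarith
    qed
  qed
  then have "Ln (v * (1 + 1 / v)) = Ln v + Ln (1 + 1 / v)"
    by (intro Ln_times_simple) (use v0 w0 in auto)
  moreover have "v * (1 + 1 / v) = v + 1" using v0 by (simp add: algebra_simps)
  ultimately show ?thesis by simp
qed

text \<open>The linear terms \<open>b/v - a/v - (b - a)/v\<close> of the three logarithms cancel, so the error is
  quadratic in \<open>1/v\<close> and therefore summable along \<open>v = u + k\<close>.\<close>
lemma norm_Ln_quotient_approx:
  fixes a b v :: complex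
  assumes "norm v \<ge> 2 * (1 + norm a + norm b)"
  shows "norm (Ln (1 + b / v) - Ln (1 + a / v) - (b - a) * Ln (1 + 1 / v))
          \<le> 2 * ((norm b)\<^sup>2 + (norm a)\<^sup>2 + norm (b - a)) / (norm v)\<^sup>2"
proof -
  have v0: "norm v > 0" using assms by (smt (verit) norm_ge_zero)
  have approx: "norm (Ln (1 + c / v) - c / v) \<le> 2 * ((norm c)\<^sup>2 / (norm v)\<^sup>2)" 
    if "2 * norm c \<le> norm v" for c
  proof -
    have c: "norm (c / v) \<le> 1 / 2" using that v0 by (simp add: norm_divide divide_simps)
    then have "norm (Ln (1 + c / v) - c / v) \<le> (norm (c / v))\<^sup>2 / (1 - norm (c / v))"
      by (intro Ln_approx_linear) auto
    also have "\<dots> \<le> (norm (c / v))\<^sup>2 / (1 / 2)"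
      using c by (intro divide_left_mono mult_pos_pos) auto
    finally show ?thesis by (simp add: norm_divide power_divide mult.commute)
  qed
  have small: "2 * norm b \<le> norm v" "2 * norm a \<le> norm v" "2 * norm (1::complex) \<le> norm v"
    using assms norm_ge_zero[of a] norm_ge_zero[of b] unfolding norm_one by argo+
  define ea where "ea = Ln (1 + a / v) - a / v"
  define eb where "eb = Ln (1 + b / v) - b / v"
  define e1 where "e1 = Ln (1 + 1 / v) - 1 / v"
  have "Ln (1 + b / v) - Ln (1 + a / v) - (b - a) * Ln (1 + 1 / v) = eb - ea - (b - a) * e1"
    by (simp add: ea_def eb_def e1_def algebra_simps add_divide_distrib diff_divide_distrib)
  also have "norm \<dots> \<le> norm eb + norm ea + norm (b - a) * norm e1"
    by (smt (verit) norm_mult norm_triangle_ineq4)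
  also have "\<dots> \<le> 2 * ((norm b)\<^sup>2 / (norm v)\<^sup>2) + 2 * ((norm a)\<^sup>2 / (norm v)\<^sup>2)
       + norm (b - a) * (2 * ((norm (1::complex))\<^sup>2 / (norm v)\<^sup>2))"
    unfolding ea_def eb_def e1_def
    by (intro add_mono mult_left_mono approx small norm_ge_zero)
  finally show ?thesis by (simp add: add_divide_distrib algebra_simps)
qed

text \<open>Each factor \<open>(u + b + k)/(u + a + k)\<close> is close to \<open>((u + k + 1)/(u + k))\<close> to the power \<open>b - a\<close>.
  The product of these powers telescopes, and the logarithms of the errors, of order
  \<open>1 / |u + k|\<^sup>2\<close>, have a bounded sum. The hypothesis keeps the points \<open>u + k\<close> away from \<open>0\<close>; it allows \<open>u\<close> far
  in the left half plane as long as it is not close to the negative axis.\<close>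
lemma pochhammer_quotient_bound:
  fixes a b :: complex
  assumes u: "\<And>k::nat. norm (u + of_nat k) \<ge> 2 * (1 + norm a + norm b)"
  shows "norm (pochhammer (u + b) N / pochhammer (u + a) N)
          \<le> exp (12 * pi * ((norm b)\<^sup>2 + (norm a)\<^sup>2 + norm (b - a)))
             * norm (exp ((b - a) * (Ln (u + of_nat N) - Ln u)))"
proof -
  define C where "C = 2 * ((norm b)\<^sup>2 + (norm a)\<^sup>2 + norm (b - a))"
  have C: "C \<ge> 0" by (simp add: C_def)
  have big: "norm (u + of_nat k) \<ge> 2" "norm (u + of_nat k) > norm a" "norm (u + of_nat k) > norm b" for k :: nat
    using u[of k] norm_ge_zero[of a] norm_ge_zero[of b] by argo+
  \<comment> \<open>a real \<open>u \<le> 0\<close> would come within distance 1 of \<open>0\<close> when shifted by naturals\<close>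
  have slit: "Im u \<noteq> 0 \<or> Re u > 0"
  proof (rule ccontr)
    assume H: "\<not> ?thesis"
    define k where "k = nat (ceiling (- Re u))"
    have "\<bar>Re u + real k\<bar> \<le> 1"
    proof -
      have "real k = of_int (ceiling (- Re u))" using H by (simp add: k_def ceiling_mono)
      then show ?thesis by linarith
    qed
    moreover have "norm (u + of_nat k) = \<bar>Re u + real k\<bar>" using H by (simp add: cmod_def)
    ultimately show False using big(1)[of k] by linarith
  qed
  define e where "e v = Ln (1 + b / v) - Ln (1 + a / v) - (b - a) * Ln (1 + 1 / v)" for v
  have factor: "(u + b + of_nat k) / (u + a + of_nat k)
       = exp (e (u + of_nat k)) * exp ((b - a) * (Ln (u + of_nat (Suc k)) - Ln (u + of_nat k)))" for k :: nat
  proof -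
    let ?v = "u + of_nat k"
    have v0: "?v \<noteq> 0" using big(1)[of k] by auto
    have nz: "1 + c / ?v \<noteq> 0" if "norm c < norm ?v" for c
    proof
      assume "1 + c / ?v = 0"
      then have "c = - ?v" using v0 by (simp add: field_simps add_eq_0_iff)
      then show False using that by (metis norm_minus_cancel less_irrefl)
    qed
    have L: "Ln (1 + 1 / ?v) = Ln (u + of_nat (Suc k)) - Ln ?v"
      using Ln_add_one_diff[of ?v] slit big(1)[of k] by (auto simp: add_ac)
    have "exp (e ?v) * exp ((b - a) * Ln (1 + 1 / ?v)) = exp (Ln (1 + b / ?v)) / exp (Ln (1 + a / ?v))"
      by (simp add: e_def exp_diff)
    also have "\<dots> = (1 + b / ?v) / (1 + a / ?v)"
      using nz big by simp
    also have "\<dots> = (?v + b) / (?v + a)" using v0 by (simp add: divide_simps)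
    finally show ?thesis using L by (simp add: add_ac)
  qed
  have "pochhammer (u + b) N / pochhammer (u + a) N
      = exp (\<Sum>k<N. e (u + of_nat k)) * exp ((b - a) * (Ln (u + of_nat N) - Ln u))"
  proof -
    have "pochhammer (u + b) N / pochhammer (u + a) N
       = (\<Prod>k<N. (u + b + of_nat k) / (u + a + of_nat k))"
      by (simp add: pochhammer_prod prod_dividef atLeast0LessThan)
    also have "\<dots> = exp (\<Sum>k<N. e (u + of_nat k)) *
        exp (\<Sum>k<N. (b - a) * (Ln (u + of_nat (Suc k)) - Ln (u + of_nat k)))"
      by (simp only: factor prod.distrib exp_sum[OF finite_lessThan])
    also have "(\<Sum>k<N. (b - a) * (Ln (u + of_nat (Suc k)) - Ln (u + of_nat k)))
         = (b - a) * (Ln (u + of_nat N) - Ln u)"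
      unfolding sum_distrib_left[symmetric] sum_lessThan_telescope[of "\<lambda>k. Ln (u + of_nat k)"] by simp
    finally show ?thesis .
  qed
  moreover have "norm (exp (\<Sum>k<N. e (u + of_nat k))) \<le> exp (C * (6 * pi))"
  proof -
    have "norm (\<Sum>k<N. e (u + of_nat k)) \<le> (\<Sum>k<N. C * (1 / (norm (u + of_nat k))\<^sup>2))"
      using norm_Ln_quotient_approx[OF u] by (intro sum_norm_le) (simp add: e_def C_def)
    also have "\<dots> \<le> C * (6 * pi)"
      unfolding sum_distrib_left[symmetric] using C big(1)
      by (intro mult_left_mono sum_inverse_norm_square_shift_le) (auto intro: order_trans[of 1 2])
    finally show ?thesis
      unfolding norm_exp_eq_Re exp_le_cancel_iff by (rule order_trans[OF complex_Re_le_cmod])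
  qed
  ultimately show ?thesis 
    by (simp add: norm_mult C_def algebra_simps mult_right_mono)
qed

text \<open>Pass to the limit in Gauss's product formula for both Gamma functions. Stirling's formula would
  give more, namely the size of each Gamma function; for a quotient the elementary bound on the
  products is enough. The argument of \<open>u\<close> contributes the factor
  \<open>exp (\<pi> |a - b|)\<close>.\<close>
lemma norm_Gamma_quotient_le:
  fixes a b :: complex
  assumes u: "\<And>k::nat. norm (u + of_nat k) \<ge> 2 * (1 + norm a + norm b)"
  shows "norm (Gamma (u + a) / Gamma (u + b))
     \<le> exp (12 * pi * ((norm b)\<^sup>2 + (norm a)\<^sup>2 + norm (b - a)) + pi * norm (a - b))
         * norm u powr Re (a - b)"
proof -
  define K where "K = exp (12 * pi * ((norm b)\<^sup>2 + (norm a)\<^sup>2 + norm (b - a)))"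
  have big: "norm (u + of_nat k) \<ge> 2" "norm (u + of_nat k) > norm a" "norm (u + of_nat k) > norm b" for k :: nat
    using u[of k] norm_ge_zero[of a] norm_ge_zero[of b] by argo+
  have u0: "u \<noteq> 0" using big(1)[of 0] by auto
  have notin: "u + c \<notin> \<int>\<^sub>\<le>\<^sub>0" if "\<And>k::nat. norm (u + of_nat k) > norm c" for c
  proof
    assume "u + c \<in> \<int>\<^sub>\<le>\<^sub>0"
    then obtain k :: nat where "u + c = - of_nat k" by (auto elim!: nonpos_Ints_cases')
    then have "u + of_nat k = - c" by (simp add: eq_neg_iff_add_eq_0 algebra_simps)
    with that[of k] show False by simp
  qed
  have "Gamma (u + b) \<noteq> 0" using notin[OF big(3)] by (simp add: Gamma_eq_zero_iff)
  then have "(\<lambda>N. Gamma_series (u + a) N / Gamma_series (u + b) N) \<longlonglongrightarrow> Gamma (u + a) / Gamma (u + b)"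
    by (intro tendsto_intros)
  then have lim: "(\<lambda>N. norm (Gamma_series (u + a) N / Gamma_series (u + b) N))
       \<longlonglongrightarrow> norm (Gamma (u + a) / Gamma (u + b))"
    by (rule tendsto_norm)
  define h where "h N = exp ((a - b) * (Ln (of_nat N) - Ln (u + of_nat (Suc N)) + Ln u))" for N
  have bound: "\<forall>\<^sub>F N in sequentially. norm (Gamma_series (u + a) N / Gamma_series (u + b) N) \<le> K * norm (h N)"
    using eventually_gt_at_top[of 0]
  proof eventually_elim
    case (elim N)
    have "Gamma_series (u + a) N / Gamma_series (u + b) N
        = (exp ((u + a) * Ln (of_nat N)) / exp ((u + b) * Ln (of_nat N)))
           * (pochhammer (u + b) (Suc N) / pochhammer (u + a) (Suc N))"
      using elim by (simp add: Gamma_series_def Ln_of_nat)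
    also have "exp ((u + a) * Ln (of_nat N)) / exp ((u + b) * Ln (of_nat N)) = exp ((a - b) * Ln (of_nat N))"
      by (simp add: exp_diff[symmetric] algebra_simps)
    finally have "norm (Gamma_series (u + a) N / Gamma_series (u + b) N)
       \<le> norm (exp ((a - b) * Ln (of_nat N))) * (K * norm (exp ((b - a) * (Ln (u + of_nat (Suc N)) - Ln u))))"
      unfolding K_def norm_mult
      using mult_left_mono[OF pochhammer_quotient_bound[OF u, where N = "Suc N"], of "norm (exp ((a - b) * Ln (of_nat N)))"] by (simp only: norm_mult norm_ge_zero)
    also have "\<dots> = K * norm (h N)"
      by (simp add: h_def norm_mult[symmetric] exp_add[symmetric] algebra_simps)
    finally show ?case .
  qed
  have "(\<lambda>N. (1 + (u + 1) / of_nat N)) \<longlonglongrightarrow> 1 + 0"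
    by (intro tendsto_intros lim_const_over_n)
  then have "(\<lambda>N. Ln (1 + (u + 1) / of_nat N)) \<longlonglongrightarrow> Ln 1"
    by (intro tendsto_Ln) auto
  then have "(\<lambda>N. - Ln (1 + (u + 1) / of_nat N) + Ln u) \<longlonglongrightarrow> - 0 + Ln u"
    by (intro tendsto_intros) simp
  moreover have "\<forall>\<^sub>F N in sequentially. - Ln (1 + (u + 1) / of_nat N) + Ln u
        = Ln (of_nat N) - Ln (u + of_nat (Suc N)) + Ln u"
    using eventually_gt_at_top[of 0]
  proof eventually_elim
    case (elim N)
    have "u + of_nat (Suc N) \<noteq> 0" using big(1)[of "Suc N"] by auto
    then have "Ln ((u + of_nat (Suc N)) / of_real (real N)) = Ln (u + of_nat (Suc N)) - ln (real N)"
      using elim by (intro Ln_divide_of_real) auto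
    moreover have "(u + of_nat (Suc N)) / of_real (real N) = 1 + (u + 1) / of_nat N"
      using elim by (simp add: field_simps)
    ultimately show ?case using elim by (simp add: Ln_of_nat)
  qed
  ultimately have "(\<lambda>N. Ln (of_nat N) - Ln (u + of_nat (Suc N)) + Ln u) \<longlonglongrightarrow> - 0 + Ln u"
    by (rule Lim_transform_eventually)
  then have "(\<lambda>N. K * norm (h N)) \<longlonglongrightarrow> K * norm (exp ((a - b) * (- 0 + Ln u)))"
    unfolding h_def
    by (rule tendsto_mult[OF tendsto_const tendsto_norm[OF tendsto_exp[OF tendsto_mult[OF tendsto_const]]]])
  then have "norm (Gamma (u + a) / Gamma (u + b)) \<le> K * norm (exp ((a - b) * Ln u))"
    using tendsto_le[OF _ _ lim bound] by simp
  also have "norm (exp ((a - b) * Ln u)) \<le> norm u powr Re (a - b) * exp (pi * norm (a - b))"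
  proof -
    have "Re ((a - b) * Ln u) = Re (a - b) * ln (norm u) - Im (a - b) * Im (Ln u)"
      by (simp only: times_complex.sel Re_Ln[OF u0])
    moreover have "- (Im (a - b) * Im (Ln u)) \<le> pi * norm (a - b)"
    proof -
      have "- (Im (a - b) * Im (Ln u)) \<le> \<bar>Im (a - b)\<bar> * \<bar>Im (Ln u)\<bar>"
        by (metis abs_ge_minus_self abs_mult)
      also have "\<dots> \<le> norm (a - b) * pi"
        using mpi_less_Im_Ln[OF u0] Im_Ln_le_pi[OF u0] by (intro mult_mono abs_Im_le_cmod) auto
      finally show ?thesis by (simp only: mult.commute)
    qed
    ultimately have "Re ((a - b) * Ln u) \<le> Re (a - b) * ln (norm u) + pi * norm (a - b)"
      by linarith
    then have "exp (Re ((a - b) * Ln u)) \<le> exp (Re (a - b) * ln (norm u) + pi * norm (a - b))"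
      by simp
    then show ?thesis using u0 by (simp only: norm_exp_eq_Re exp_add powr_def norm_eq_zero if_False)
  qed
  finally show ?thesis by (simp add: K_def exp_add mult_ac)
qed

text \<open>The next two bounds say that \<open>1 / sin\<close> is bounded on vertical lines, respectively horizontal
  lines, that miss the zeros of the sine.\<close>
lemma norm_sin_ge_abs_sin_Re: "norm (sin z) \<ge> \<bar>sin (Re z)\<bar>"
proof -
  have "(sin (Re z))\<^sup>2 \<le> (norm (sin z))\<^sup>2"
  proof -
    have "exp (2 * Im z) + inverse (exp (2 * Im z)) \<ge> 2"
      using zero_le_power2[of "exp (Im z) - inverse (exp (Im z))"] 
      by (simp add: power2_eq_square algebra_simps exp_double[symmetric] mult_exp_exp exp_minus[symmetric])
    then show ?thesis by (simp add: norm_sin_squared cos_double_sin)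
  qed
  then show ?thesis by (simp add: abs_le_square_iff[symmetric])
qed

lemma norm_sin_ge_abs_Im: "norm (sin z) \<ge> \<bar>Im z\<bar> / 2" for z :: complex
proof -
  have "exp \<bar>y\<bar> - exp (- \<bar>y\<bar>) \<ge> \<bar>y\<bar>" for y :: real
    using exp_ge_add_one_self[of "\<bar>y\<bar>"] exp_le_one_iff[of "- \<bar>y\<bar>"] by linarith
  then have "\<bar>Im z\<bar> \<le> \<bar>exp (- Im z) - exp (Im z)\<bar>"
    by (smt (verit))
  also have "\<dots> \<le> norm (exp (\<i> * z) - exp (- (\<i> * z)))"
    using norm_triangle_ineq3[of "exp (\<i> * z)" "exp (- (\<i> * z))"] by (simp add: norm_exp_eq_Re)
  finally show ?thesis
    by (simp add: sin_exp_eq norm_divide norm_mult)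
qed

lemma norm_sin_le_exp: "norm (sin z) \<le> exp \<bar>Im z\<bar>" for z :: complex
proof -
  have "norm (sin z) = norm (exp (\<i> * z) - exp (- (\<i> * z))) / 2"
    by (simp add: sin_exp_eq norm_divide norm_mult)
  also have "\<dots> \<le> (exp (- Im z) + exp (Im z)) / 2"
    by (intro divide_right_mono order_trans[OF norm_triangle_ineq4]) (auto simp: norm_exp_eq_Re)
  also have "\<dots> \<le> exp \<bar>Im z\<bar>"
  proof -
    have "exp (Im z) \<le> exp \<bar>Im z\<bar>" "exp (- Im z) \<le> exp \<bar>Im z\<bar>" by simp_all
    then show ?thesis by argo
  qed
  finally show ?thesis .
qed


lemma Gamma_quotient_reflection:
  fixes a b u :: complex
  assumes "1 - a - u \<notin> \<int>\<^sub>\<le>\<^sub>0" "1 - b - u \<notin> \<int>\<^sub>\<le>\<^sub>0"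
  shows "Gamma (a + u) / Gamma (b + u) =
      sin (of_real pi * (b + u)) / sin (of_real pi * (a + u)) * (Gamma (1 - b - u) / Gamma (1 - a - u))"
proof -
  have nz: "Gamma (1 - a - u) \<noteq> 0" "Gamma (1 - b - u) \<noteq> 0"
    using assms by (auto simp: Gamma_eq_zero_iff)
  have "Gamma (a + u) = of_real pi / sin (of_real pi * (a + u)) / Gamma (1 - a - u)"
    using Gamma_reflection_complex[of "a + u"] nz by (metis diff_diff_eq nonzero_mult_div_cancel_right)
  moreover have "Gamma (b + u) = of_real pi / sin (of_real pi * (b + u)) / Gamma (1 - b - u)"
    using Gamma_reflection_complex[of "b + u"] nz by (metis diff_diff_eq nonzero_mult_div_cancel_right)
  ultimately show ?thesis by simp
qed

text \<open>Near the negative axis, where the poles of the numerator accumulate, the reflection formula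
  moves the argument to the right half plane. It costs a quotient of sines, which is harmless in a
  horizontal strip at a positive distance from the poles; this is what \<open>\<eta>\<close> measures.\<close>
lemma norm_Gamma_quotient_le_left:
  fixes a b u :: complex
  assumes u: "Re u \<le> - 2 * (1 + norm (1 - a) + norm (1 - b))"
    and \<eta>: "\<eta> > 0" "norm (sin (of_real pi * (a + u))) \<ge> \<eta>"
  shows "norm (Gamma (a + u) / Gamma (b + u))
     \<le> exp (12 * pi * ((norm (1 - a))\<^sup>2 + (norm (1 - b))\<^sup>2 + norm (b - a)) + pi * norm (a - b))
         * (exp (pi * \<bar>Im (b + u)\<bar>) / \<eta>) * norm u powr Re (a - b)"
proof -
  have *: "norm (- u + of_nat k) \<ge> 2 * (1 + norm (1 - b) + norm (1 - a))" for k :: nat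
  proof -
    have "- Re u + real k \<le> norm (- u + of_nat k)"
      using complex_Re_le_cmod[of "- u + of_nat k"] by simp
    with u show ?thesis by (simp add: algebra_simps)
  qed
  have notin: "1 - c - u \<notin> \<int>\<^sub>\<le>\<^sub>0" if "norm (1 - c) < - Re u" for c
  proof
    assume "1 - c - u \<in> \<int>\<^sub>\<le>\<^sub>0"
    then obtain k :: nat where "1 - c - u = - of_nat k" by (auto elim!: nonpos_Ints_cases')
    then have "Re (1 - c - u) = - real k" by simp
    then have "Re (1 - c - u) \<le> 0" by simp
    then have "Re (1 - c) \<le> Re u" by simp
    with that show False using abs_Re_le_cmod[of "1 - c"] by linarith
  qed
  have lt: "norm (1 - a) < - Re u" "norm (1 - b) < - Re u"
    using u norm_ge_zero[of "1 - a"] norm_ge_zero[of "1 - b"] by argo+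
  have G: "norm (Gamma (- u + (1 - b)) / Gamma (- u + (1 - a)))
     \<le> exp (12 * pi * ((norm (1 - a))\<^sup>2 + (norm (1 - b))\<^sup>2 + norm ((1 - a) - (1 - b))) + pi * norm ((1 - b) - (1 - a)))
         * norm (- u) powr Re ((1 - b) - (1 - a))"
    by (rule norm_Gamma_quotient_le[OF *])
  have s: "norm (sin (of_real pi * (b + u)) / sin (of_real pi * (a + u))) \<le> exp (pi * \<bar>Im (b + u)\<bar>) / \<eta>"
    unfolding norm_divide using \<eta> norm_sin_le_exp[of "of_real pi * (b + u)"]
    by (intro frac_le) (auto simp: abs_mult)
  have "norm (Gamma (a + u) / Gamma (b + u)) = norm (sin (of_real pi * (b + u)) / sin (of_real pi * (a + u)))
         * norm (Gamma (- u + (1 - b)) / Gamma (- u + (1 - a)))"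
    using Gamma_quotient_reflection[OF notin[OF lt(1)] notin[OF lt(2)]]
    by (simp add: norm_mult[symmetric] algebra_simps)
  also have "\<dots> \<le> (exp (pi * \<bar>Im (b + u)\<bar>) / \<eta>) *
      (exp (12 * pi * ((norm (1 - a))\<^sup>2 + (norm (1 - b))\<^sup>2 + norm ((1 - a) - (1 - b))) + pi * norm ((1 - b) - (1 - a)))
         * norm (- u) powr Re ((1 - b) - (1 - a)))"
    by (intro mult_mono s G) (use \<eta> in auto)
  finally show ?thesis by (simp add: norm_minus_commute mult_ac)
qed

text \<open>The factor of the integrand that carries its growth, in the variable \<open>u = n - 1 + s\<close>.\<close>
definition Gamma_quotient :: "complex list \<Rightarrow> complex list \<Rightarrow> complex \<Rightarrow> complex" where
  "Gamma_quotient a b u = Gamma_prod (shift a u) / Gamma_prod (shift b u)"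

lemma Gamma_quotient_Cons:
  "Gamma_quotient (x # a) (y # b) u = Gamma (x + u) / Gamma (y + u) * Gamma_quotient a b u"
  by (simp add: Gamma_quotient_def Gamma_prod_def shift_def)

lemma norm_Gamma_quotient_Cons_le:
  assumes "norm (Gamma (x + u) / Gamma (y + u)) \<le> C * norm u powr Re (x - y)"
    "norm (Gamma_quotient a b u) \<le> C' * norm u powr Re (sum_list a - sum_list b)" "C \<ge> 0"
  shows "norm (Gamma_quotient (x # a) (y # b) u)
    \<le> (C * C') * norm u powr Re (sum_list (x # a) - sum_list (y # b))"
proof -
  have "norm (Gamma_quotient (x # a) (y # b) u)
      \<le> (C * norm u powr Re (x - y)) * (C' * norm u powr Re (sum_list a - sum_list b))"
    unfolding Gamma_quotient_Cons norm_mult using assms by (intro mult_mono) auto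
  also have "\<dots> = (C * C') * (norm u powr (Re (x - y) + Re (sum_list a - sum_list b)))"
    by (simp add: powr_add)
  finally show ?thesis by (simp add: algebra_simps)
qed

lemma Gamma_quotient_bound_away:
  assumes "length a = length b"
  shows "\<exists>C V. C > 0 \<and> V \<ge> 1 \<and> (\<forall>u. (\<forall>k::nat. norm (u + of_nat k) \<ge> V) \<longrightarrow>
      norm (Gamma_quotient a b u) \<le> C * norm u powr Re (sum_list a - sum_list b))"
  using assms
proof (induction a b rule: list_induct2)
  case Nil
  show ?case by (intro exI[of _ 1]) (auto simp: Gamma_quotient_def Gamma_prod_def shift_def)
next
  case (Cons x a y b)
  then obtain C V where CV: "C > 0" "V \<ge> 1"
    "\<And>u. (\<forall>k::nat. norm (u + of_nat k) \<ge> V) \<Longrightarrow>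
      norm (Gamma_quotient a b u) \<le> C * norm u powr Re (sum_list a - sum_list b)" by metis
  define K where "K = exp (12 * pi * ((norm y)\<^sup>2 + (norm x)\<^sup>2 + norm (y - x)) + pi * norm (x - y))"
  show ?case
  proof (intro exI conjI allI impI)
    show "K * C > 0" "max V (2 * (1 + norm x + norm y)) \<ge> 1" using CV by (auto simp: K_def)
    fix u :: complex assume u: "\<forall>k::nat. norm (u + of_nat k) \<ge> max V (2 * (1 + norm x + norm y))"
    have "norm (Gamma (x + u) / Gamma (y + u)) \<le> K * norm u powr Re (x - y)"
      using norm_Gamma_quotient_le[of x y u] u by (simp add: K_def add.commute)
    then show "norm (Gamma_quotient (x # a) (y # b) u)
        \<le> (K * C) * norm u powr Re (sum_list (x # a) - sum_list (y # b))"
      by (rule norm_Gamma_quotient_Cons_le) (use CV u in \<open>auto simp: K_def\<close>)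
  qed
qed

lemma Gamma_quotient_bound_left_strip:
  assumes "length a = length b" and \<eta>: "\<eta> > 0"
  shows "\<exists>C V. C > 0 \<and> V \<ge> 1 \<and> (\<forall>u. Re u \<le> - V \<longrightarrow> \<bar>Im u\<bar> \<le> H \<longrightarrow>
      (\<forall>c\<in>set a. norm (sin (of_real pi * (c + u))) \<ge> \<eta>) \<longrightarrow>
      norm (Gamma_quotient a b u) \<le> C * norm u powr Re (sum_list a - sum_list b))"
  using assms(1)
proof (induction a b rule: list_induct2)
  case Nil
  show ?case by (intro exI[of _ 1]) (auto simp: Gamma_quotient_def Gamma_prod_def shift_def)
next
  case (Cons x a y b)
  then obtain C V where CV: "C > 0" "V \<ge> 1"
    "\<And>u. Re u \<le> - V \<Longrightarrow> \<bar>Im u\<bar> \<le> H \<Longrightarrow> (\<forall>c\<in>set a. norm (sin (of_real pi * (c + u))) \<ge> \<eta>) \<Longrightarrow>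
      norm (Gamma_quotient a b u) \<le> C * norm u powr Re (sum_list a - sum_list b)" by metis
  define K where "K = exp (12 * pi * ((norm (1 - x))\<^sup>2 + (norm (1 - y))\<^sup>2 + norm (y - x)) + pi * norm (x - y))"
  define K' where "K' = exp (pi * (\<bar>Im y\<bar> + H)) / \<eta>"
  have K': "K' > 0" "K > 0" using \<eta> by (auto simp: K'_def K_def)
  show ?case
  proof (intro exI conjI allI impI)
    show "(K * K') * C > 0" "max V (2 * (1 + norm (1 - x) + norm (1 - y))) \<ge> 1" using CV K' by auto
    fix u :: complex assume u: "Re u \<le> - max V (2 * (1 + norm (1 - x) + norm (1 - y)))" "\<bar>Im u\<bar> \<le> H"
      and sn: "\<forall>c\<in>set (x # a). norm (sin (of_real pi * (c + u))) \<ge> \<eta>"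
    have "norm (Gamma (x + u) / Gamma (y + u)) \<le> K * (exp (pi * \<bar>Im (y + u)\<bar>) / \<eta>) * norm u powr Re (x - y)"
      unfolding K_def using u sn \<eta> by (intro norm_Gamma_quotient_le_left) auto
    also have "\<dots> \<le> (K * K') * norm u powr Re (x - y)"
      unfolding K'_def using u \<eta> K' by (intro mult_right_mono mult_left_mono divide_right_mono) auto
    finally show "norm (Gamma_quotient (x # a) (y # b) u)
        \<le> ((K * K') * C) * norm u powr Re (sum_list (x # a) - sum_list (y # b))"
      by (rule norm_Gamma_quotient_Cons_le) (use CV u K' sn in auto)
  qed
qed

text \<open>The two regimes together: a point with large modulus has a large imaginary part, or a large
  positive real part, or it lies in a fixed horizontal strip far to the left. Only in the last case is a
  distance from the poles required.\<close>
theorem Gamma_quotient_bound: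
  assumes len: "length a = length b" and \<eta>: "\<eta> > 0"
  obtains C V where "C > 0" "V \<ge> V0" "V \<ge> 1"
    "\<And>u. norm u \<ge> 2 * V \<Longrightarrow>
        \<bar>Im u\<bar> \<ge> V \<or> Re u \<ge> 0 \<or> (\<forall>c\<in>set a. norm (sin (of_real pi * (c + u))) \<ge> \<eta>) \<Longrightarrow>
        norm (Gamma_quotient a b u) \<le> C * norm u powr Re (sum_list a - sum_list b)"
proof -
  let ?B = "\<lambda>C u. norm (Gamma_quotient a b u) \<le> C * norm u powr Re (sum_list a - sum_list b)"
  obtain C1 V1 where 1: "C1 > 0" "V1 \<ge> 1" "\<And>u. (\<And>k::nat. norm (u + of_nat k) \<ge> V1) \<Longrightarrow> ?B C1 u"
    using Gamma_quotient_bound_away[OF len] by metis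
  obtain C2 V2 where 2: "C2 > 0" "V2 \<ge> 1" 
    "\<And>u. Re u \<le> - V2 \<Longrightarrow> \<bar>Im u\<bar> \<le> max V0 V1 \<Longrightarrow> 
      (\<forall>c\<in>set a. norm (sin (of_real pi * (c + u))) \<ge> \<eta>) \<Longrightarrow> ?B C2 u"
    using Gamma_quotient_bound_left_strip[OF len \<eta>, of "max V0 V1"] by metis
  note left = 2(3)
  define V where "V = max (max V0 V1) V2"
  have mono: "?B (max C1 C2) u" if "?B C u" "C \<le> max C1 C2" for C u
    using that mult_right_mono[OF that(2), of "norm u powr Re (sum_list a - sum_list b)"] by simp
  have im: "?B (max C1 C2) u" if "\<bar>Im u\<bar> \<ge> V1" for u
  proof (rule mono[OF 1(3)])
    fix k :: nat
    show "norm (u + of_nat k) \<ge> V1"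
      using abs_Im_le_cmod[of "u + of_nat k"] that by simp
  qed auto
  have re: "?B (max C1 C2) u" if "Re u \<ge> V1" for u
  proof (rule mono[OF 1(3)])
    fix k :: nat
    show "norm (u + of_nat k) \<ge> V1"
      using complex_Re_le_cmod[of "u + of_nat k"] that by simp
  qed auto
  show thesis
  proof (rule that[of "max C1 C2" V])
    fix u :: complex assume u: "norm u \<ge> 2 * V" 
      and c: "\<bar>Im u\<bar> \<ge> V \<or> Re u \<ge> 0 \<or> (\<forall>c\<in>set a. norm (sin (of_real pi * (c + u))) \<ge> \<eta>)"
    show "?B (max C1 C2) u"
    proof (cases "\<bar>Im u\<bar> \<ge> max V0 V1")
      case True
      then show ?thesis by (intro im) auto
    next
      case False
      then have "\<bar>Im u\<bar> < V" by (auto simp: V_def)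
      then have "\<bar>Re u\<bar> \<ge> V" using u cmod_le[of u] by linarith
      then consider "Re u \<ge> V" | "Re u \<le> - V" "Re u < 0" using 1(2) V_def by linarith
      then show ?thesis
      proof cases
        case 1
        then show ?thesis by (intro re) (auto simp: V_def)
      next
        case 2
        show ?thesis
          by (rule mono[OF left]) (use c False 2 \<open>\<bar>Im u\<bar> < V\<close> in \<open>auto simp: V_def\<close>)
      qed
    qed
  qed (use 1 2 in \<open>auto simp: V_def\<close>)
qed

section \<open>Left loops\<close>

text \<open>Comparing two closed paths by their winding numbers makes it unnecessary to know the residues
  at the poles which both paths enclose. These poles may be multiple, and infinitely many in the limit;
  only those in \<open>E\<close>, where the winding numbers differ by 1, contribute.\<close>
lemma contour_integral_diff_eq_residues:
  assumes holo: "f holomorphic_on - P" and fin: "\<And>R. finite (P \<inter> ball 0 R)"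
    and \<gamma>1: "valid_path \<gamma>1" "pathfinish \<gamma>1 = pathstart \<gamma>1" "path_image \<gamma>1 \<inter> P = {}"
    and \<gamma>2: "valid_path \<gamma>2" "pathfinish \<gamma>2 = pathstart \<gamma>2" "path_image \<gamma>2 \<inter> P = {}"
    and E: "E \<subseteq> P" "finite E" 
    and inside: "\<And>p. p \<in> E \<Longrightarrow> winding_number \<gamma>1 p = 1" "\<And>p. p \<in> E \<Longrightarrow> winding_number \<gamma>2 p = 0"
    and eq: "\<And>p. p \<in> P - E \<Longrightarrow> winding_number \<gamma>1 p = winding_number \<gamma>2 p"
  shows "contour_integral \<gamma>1 f - contour_integral \<gamma>2 f = 2 * pi * \<i> * (\<Sum>p\<in>E. residue f p)"
proof -
  have "bounded (path_image \<gamma>1 \<union> path_image \<gamma>2 \<union> E)"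
    using \<gamma>1(1) \<gamma>2(1) E(2) by (simp add: bounded_valid_path_image finite_imp_bounded)
  then obtain R where R: "path_image \<gamma>1 \<union> path_image \<gamma>2 \<union> E \<subseteq> ball 0 R"
    by (meson bounded_subset_ballD)
  define Q where "Q = P \<inter> ball 0 R"
  have Q: "finite Q" unfolding Q_def by (rule fin)
  have holo': "f holomorphic_on ball 0 R - Q"
    by (rule holomorphic_on_subset[OF holo]) (auto simp: Q_def)
  have res: "contour_integral \<gamma> f = 2 * pi * \<i> * (\<Sum>p\<in>Q. winding_number \<gamma> p * residue f p)"
    if "valid_path \<gamma>" "pathfinish \<gamma> = pathstart \<gamma>" "path_image \<gamma> \<inter> P = {}" "path_image \<gamma> \<subseteq> ball 0 R" for \<gamma>
  proof (rule Residue_theorem[OF open_ball connected_ball Q holo' that(1,2)])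
    show "path_image \<gamma> \<subseteq> ball 0 R - Q" using that by (auto simp: Q_def)
    show "\<forall>z. z \<notin> ball 0 R \<longrightarrow> winding_number \<gamma> z = 0"
      using that by (intro allI impI winding_number_zero_outside[where s = "ball 0 R"])
        (auto intro: valid_path_imp_path)
  qed
  have "contour_integral \<gamma>1 f - contour_integral \<gamma>2 f
      = 2 * pi * \<i> * (\<Sum>p\<in>Q. (winding_number \<gamma>1 p - winding_number \<gamma>2 p) * residue f p)"
    using res[OF \<gamma>1] res[OF \<gamma>2] R
    by (simp add: sum_subtractf left_diff_distrib right_diff_distrib)
  also have "(\<Sum>p\<in>Q. (winding_number \<gamma>1 p - winding_number \<gamma>2 p) * residue f p) = (\<Sum>p\<in>E. residue f p)"
    using E R Q by (intro sum.mono_neutral_cong_right) (auto simp: Q_def inside eq)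
  finally show ?thesis .
qed

lemma valid_path_loop_closure [simp]:
  assumes "valid_path g" shows "valid_path (loop_closure g X)"
  using assms by (auto simp: loop_closure_def intro!: valid_path_join)

lemma pathfinish_loop_closure [simp]: "pathfinish (loop_closure g X) = pathstart (loop_closure g X)"
  by (simp add: loop_closure_def)

lemma closed_segment_horizontal:
  assumes "A \<le> Re p"
  shows "closed_segment (Complex A (Im p)) p = {s. Im s = Im p \<and> A \<le> Re s \<and> Re s \<le> Re p}"
  using assms by (auto simp: closed_segment_same_Im closed_segment_eq_real_ivl)

lemma path_image_loop_closure_subset:
  assumes "- X \<le> Re (pathstart g)" "- X \<le> Re (pathfinish g)" "Im (pathstart g) < Im (pathfinish g)"
  shows "path_image (loop_closure g X) \<subseteq> (loop_image g \<inter> {s. Re s \<ge> - X}) \<union> path_image g \<union>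
      closed_segment (Complex (-X) (Im (pathfinish g))) (Complex (-X) (Im (pathstart g)))"
proof -
  have "closed_segment (Complex (-X) (Im (pathstart g))) (pathstart g) \<subseteq> loop_image g \<inter> {s. Re s \<ge> - X}"
    using assms closed_segment_horizontal[of "- X" "pathstart g"] closed_segment_horizontal[of "- X" "pathfinish g"]
    by (auto simp: closed_segment_commute loop_image_def)
  moreover have "closed_segment (pathfinish g) (Complex (-X) (Im (pathfinish g))) \<subseteq> loop_image g \<inter> {s. Re s \<ge> - X}"
    using assms closed_segment_horizontal[of "- X" "pathstart g"] closed_segment_horizontal[of "- X" "pathfinish g"]
    by (auto simp: closed_segment_commute loop_image_def)
  ultimately show ?thesis
    by (auto simp: loop_closure_def path_image_join)
qed

text \<open>Moving the closing segment further left is a linear homotopy, and it stays within the two rays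
  and the half plane left of the first segment.\<close>
lemma loop_closure_winding_number_eq:
  assumes "path g" and X: "X1 \<le> X2" "- X1 \<le> Re (pathstart g)" "- X1 \<le> Re (pathfinish g)"
    and z: "z \<notin> loop_image g" "Re z > - X1"
  shows "winding_number (loop_closure g X1) z = winding_number (loop_closure g X2) z"
proof (rule winding_number_loops_linear_eq[symmetric])
  show "path (loop_closure g X1)" "path (loop_closure g X2)"
    using assms(1) by (auto simp: loop_closure_def)
  fix t :: real assume t: "t \<in> {0..1}"
  let ?y1 = "Im (pathstart g)" and ?y2 = "Im (pathfinish g)"
  define R1 where "R1 = {s. Im s = ?y1 \<and> Re s \<le> Re (pathstart g)}"
  define R2 where "R2 = {s. Im s = ?y2 \<and> Re s \<le> Re (pathfinish g)}"
  define R3 where "R3 = {s. Re s \<le> - X1}"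
  have R1_alt: "R1 = {s. Im s \<le> ?y1} \<inter> {s. Im s \<ge> ?y1} \<inter> {s. Re s \<le> Re (pathstart g)}"
    and R2_alt: "R2 = {s. Im s \<le> ?y2} \<inter> {s. Im s \<ge> ?y2} \<inter> {s. Re s \<le> Re (pathfinish g)}"
    by (auto simp: R1_def R2_def)
  have conv: "convex R1" "convex R2" "convex R3"
    unfolding R1_alt R2_alt R3_def
    by (intro convex_Int convex_halfspace_Re_le convex_halfspace_Im_le convex_halfspace_Im_ge)+
  have avoid: "z \<notin> R1" "z \<notin> R2" "z \<notin> path_image g" "z \<notin> R3"
    using z by (auto simp: loop_image_def R1_def R2_def R3_def)
  have line: "linepath p q s \<in> S" if "p \<in> S" "q \<in> S" "convex S" "0 \<le> s" "s \<le> 1" for p q s and S :: "complex set"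
    using that by (meson closed_segment_subset linepath_in_path subsetD atLeastAtMost_iff)
  have "\<exists>S. convex S \<and> z \<notin> S \<and> (\<forall>X\<in>{X1, X2}. loop_closure g X t \<in> S)"
  proof -
    \<comment> \<open>the four pieces of \<open>g1 +++ (g2 +++ (g3 +++ g4))\<close> in its parametrisation\<close>
    consider "t \<le> 1/2" | "t > 1/2" "2 * t - 1 \<le> 1/2" | "t > 1/2" "2 * t - 1 > 1/2" "2 * (2 * t - 1) - 1 \<le> 1/2"
      | "t > 1/2" "2 * t - 1 > 1/2" "2 * (2 * t - 1) - 1 > 1/2" by linarith
    then show ?thesis
    proof cases
      case 1
      have "\<forall>X\<in>{X1, X2}. linepath (Complex (- X) ?y1) (pathstart g) (2 * t) \<in> R1"
        by (intro ballI line conv) (use t 1 X in \<open>auto simp: R1_def\<close>)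
      with 1 show ?thesis
        by (intro exI[of _ R1]) (simp add: conv avoid loop_closure_def joinpaths_def)
    next
      case 2
      then have "g (2 * (2 * t - 1)) \<in> path_image g" by (auto simp: path_image_def)
      then have "g (2 * (2 * t - 1)) \<noteq> z" using avoid by auto
      with 2 show ?thesis
        by (intro exI[of _ "{g (2 * (2 * t - 1))}"]) (auto simp: loop_closure_def joinpaths_def)
    next
      case 3
      have "\<forall>X\<in>{X1, X2}. linepath (pathfinish g) (Complex (- X) ?y2) (2 * (2 * (2 * t - 1) - 1)) \<in> R2"
        by (intro ballI line conv) (use t 3 X in \<open>auto simp: R2_def\<close>)
      with 3 show ?thesis
        by (intro exI[of _ R2]) (simp add: conv avoid loop_closure_def joinpaths_def)
    next
      case 4
      have "\<forall>X\<in>{X1, X2}. linepath (Complex (- X) ?y2) (Complex (- X) ?y1) (2 * (2 * (2 * t - 1) - 1) - 1) \<in> R3"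
        by (intro ballI line conv) (use t 4 X in \<open>auto simp: R3_def\<close>)
      with 4 show ?thesis
        by (intro exI[of _ R3]) (simp add: conv avoid loop_closure_def joinpaths_def)
    qed
  qed
  then show "z \<notin> closed_segment (loop_closure g X1 t) (loop_closure g X2 t)"
    by (metis closed_segment_subset subsetD insertI1 insert_commute)
qed auto

text \<open>The winding number takes its eventual value as soon as the closing segment has passed \<open>z\<close>. The
  threshold depends on the real part of \<open>z\<close> only, so one cut-off serves all poles to the right of it.\<close>
lemma loop_closure_winding_number_eventually:
  assumes "path g" and X: "- X \<le> Re (pathstart g)" "- X \<le> Re (pathfinish g)"
    and z: "z \<notin> loop_image g" "Re z > - X"
    and ev: "\<forall>\<^sub>F Y in at_top. winding_number (loop_closure g Y) z = w"
  shows "winding_number (loop_closure g X) z = w"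
proof -
  have "\<forall>\<^sub>F Y in at_top. Y \<ge> X \<and> winding_number (loop_closure g Y) z = w"
    using ev eventually_ge_at_top[of X] by eventually_elim auto
  then obtain Y where "Y \<ge> X" "winding_number (loop_closure g Y) z = w"
    by (auto dest!: eventually_happens)
  then show ?thesis
    using loop_closure_winding_number_eq[OF assms(1) _ X z] by metis
qed

lemma loop_closure_winding_number_zero:
  assumes "path g" and X: "\<And>s. s \<in> path_image g \<Longrightarrow> - X \<le> Re s" "Im (pathstart g) < Im (pathfinish g)"
    and z: "Re z < - X"
  shows "winding_number (loop_closure g X) z = 0"
proof (rule winding_number_zero_outside)
  show "path (loop_closure g X)" using assms(1) by (auto simp: loop_closure_def)
  show "convex {s. Re s \<ge> - X}" by (rule convex_halfspace_Re_ge)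
  show "path_image (loop_closure g X) \<subseteq> {s. Re s \<ge> - X}"
    using path_image_loop_closure_subset[of X g] X
    by (fastforce simp: closed_segment_same_Re)
qed (use z in auto)

lemma contour_integral_linepath_same_Im:
  assumes "A \<le> B"
  shows "contour_integral (linepath (Complex A y) (Complex B y)) f = integral {A..B} (\<lambda>x. f (Complex x y))"
proof (cases "A = B")
  case False
  have *: "linepath (Complex A y) (Complex B y) x = linepath (of_real A) (of_real B) x + \<i> * of_real y" for x
    by (simp add: linepath_def complex_eq_iff algebra_simps)
  have "contour_integral (linepath (Complex A y) (Complex B y)) f
      = contour_integral (linepath (of_real A) (of_real B)) (\<lambda>z. f (z + \<i> * of_real y))"
    by (simp add: contour_integral_integral * complex_eq_iff)
  also have "\<dots> = integral {A..B} (\<lambda>x. f (of_real x + \<i> * of_real y))"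
    using assms False by (subst contour_integral_linepath_Reals_eq) auto
  finally show ?thesis by (simp add: Complex_eq)
qed simp

lemma ray_integral_tendsto:
  assumes int: "set_integrable lborel {..B} (\<lambda>x. f (Complex x y))" and X: "filterlim X at_top F"
  shows "((\<lambda>m. contour_integral (linepath (Complex (- X m) y) (Complex B y)) f)
     \<longlongrightarrow> (LBINT x:{..B}. f (Complex x y))) F"
proof -
  have "((\<lambda>A. LBINT x:{A..B}. f (Complex x y)) \<longlongrightarrow> (LBINT x:{..B}. f (Complex x y))) at_bot"
    by (rule tendsto_set_lebesgue_integral_at_bot[OF _ int]) auto
  moreover have "filterlim (\<lambda>m. - X m) at_bot F"
    using X by (simp add: filterlim_uminus_at_top)
  ultimately have "((\<lambda>m. LBINT x:{- X m..B}. f (Complex x y)) \<longlongrightarrow> (LBINT x:{..B}. f (Complex x y))) F"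
    by (rule filterlim_compose)
  moreover have "\<forall>\<^sub>F m in F. (LBINT x:{- X m..B}. f (Complex x y))
      = contour_integral (linepath (Complex (- X m) y) (Complex B y)) f"
    using X[unfolded filterlim_at_top, rule_format, of "- B"]
  proof eventually_elim
    case (elim m)
    have "set_integrable lborel {- X m..B} (\<lambda>x. f (Complex x y))"
      by (rule set_integrable_subset[OF int]) auto
    then show ?case using elim
      by (simp add: contour_integral_linepath_same_Im set_borel_integral_eq_integral(2))
  qed
  ultimately show ?thesis by (rule Lim_transform_eventually)
qed

text \<open>The cut-off positions may be chosen along a filter that avoids the poles of \<open>f\<close>, which
  accumulate only at infinity but may lie on any particular vertical line.\<close>
lemma loop_closure_integral_tendsto:
  assumes g: "valid_path g" "Im (pathstart g) < Im (pathfinish g)"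
    and holo: "f holomorphic_on - P" and P: "closed P" "loop_image g \<inter> P = {}"
    and ray1: "set_integrable lborel {..Re (pathstart g)} (\<lambda>x. f (Complex x (Im (pathstart g))))"
    and ray2: "set_integrable lborel {..Re (pathfinish g)} (\<lambda>x. f (Complex x (Im (pathfinish g))))"
    and X: "filterlim X at_top F" and avoid: "\<And>m s. Re s = - X m \<Longrightarrow> s \<notin> P"
    and closing: "((\<lambda>m. contour_integral (linepath (Complex (- X m) (Im (pathfinish g))) 
        (Complex (- X m) (Im (pathstart g)))) f) \<longlongrightarrow> 0) F"
  shows "((\<lambda>m. contour_integral (loop_closure g (X m)) f) \<longlongrightarrow> loop_integral g f) F"
proof -
  let ?p = "pathstart g" and ?q = "pathfinish g"
  let ?r1 = "\<lambda>m. linepath (Complex (- X m) (Im ?p)) ?p"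
  let ?r2 = "\<lambda>m. linepath (Complex (- X m) (Im ?q)) ?q"
  let ?r2' = "\<lambda>m. linepath ?q (Complex (- X m) (Im ?q))"
  let ?v = "\<lambda>m. linepath (Complex (- X m) (Im ?q)) (Complex (- X m) (Im ?p))"
  have Xlarge: "\<forall>\<^sub>F m in F. X m \<ge> max (- Re ?p) (- Re ?q)"
    using X unfolding filterlim_at_top by blast
  have "\<forall>\<^sub>F m in F. contour_integral (?r1 m) f + contour_integral g f - contour_integral (?r2 m) f
         + contour_integral (?v m) f = contour_integral (loop_closure g (X m)) f"
    using Xlarge
  proof eventually_elim
    case (elim m)
    have integrable: "f contour_integrable_on \<gamma>" if "valid_path \<gamma>" "path_image \<gamma> \<inter> P = {}" for \<gamma>
      by (rule contour_integrable_holomorphic_simple[OF holo]) (use that P in auto)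
    have i: "f contour_integrable_on g"
      using P g by (intro integrable) (auto simp: loop_image_def)
    have ri: "path_image (?r1 m) \<inter> P = {}" "path_image (?r2' m) \<inter> P = {}"
      using P(2) elim closed_segment_horizontal[of "- X m" ?p] closed_segment_horizontal[of "- X m" ?q]
      by (auto simp: closed_segment_commute loop_image_def)
    have vi: "path_image (?v m) \<inter> P = {}"
      using avoid by (auto simp: closed_segment_same_Re)
    have "contour_integral (loop_closure g (X m)) f
       = contour_integral (?r1 m) f + contour_integral g f + contour_integral (?r2' m) f + contour_integral (?v m) f"
      unfolding loop_closure_def using i integrable[OF _ ri(1)] integrable[OF _ ri(2)] integrable[OF _ vi] g
      by (simp add: valid_path_join)
    moreover have "contour_integral (?r2' m) f = - contour_integral (?r2 m) f"
      using contour_integral_reversepath[OF valid_path_linepath, of ?q "Complex (- X m) (Im ?q)" f]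
      by (simp add: eq_neg_iff_add_eq_0 add.commute)
    ultimately show ?case by simp
  qed
  moreover have "((\<lambda>m. contour_integral (?r1 m) f + contour_integral g f - contour_integral (?r2 m) f
         + contour_integral (?v m) f) \<longlongrightarrow> 
     (LBINT x:{..Re ?p}. f (Complex x (Im ?p))) + contour_integral g f
      - (LBINT x:{..Re ?q}. f (Complex x (Im ?q))) + 0) F"
    using ray_integral_tendsto[OF ray1 X] ray_integral_tendsto[OF ray2 X]
    by (intro tendsto_add tendsto_diff tendsto_const closing) simp_all
  ultimately show ?thesis
    unfolding loop_integral_def by (simp add: Lim_transform_eventually)
qed

text \<open>The middle part of the left loop around a half-strip, into which an arbitrary loop is deformed.\<close>
definition half_strip :: "real \<Rightarrow> real \<Rightarrow> real \<Rightarrow> complex" where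
  "half_strip c h = linepath (Complex c (- h)) (Complex c h)"

lemma half_strip_simps [simp]:
  "pathstart (half_strip c h) = Complex c (- h)" "pathfinish (half_strip c h) = Complex c h"
  "valid_path (half_strip c h)" "path (half_strip c h)"
  by (simp_all add: half_strip_def)

lemma loop_closure_half_strip:
  "loop_closure (half_strip c h) X = rectpath (Complex (- X) (- h)) (Complex c h)"
  by (simp add: loop_closure_def rectpath_def half_strip_def Let_def)

lemma loop_image_half_strip:
  assumes "h > 0"
  shows "loop_image (half_strip c h) = {s. Re s = c \<and> \<bar>Im s\<bar> \<le> h \<or> Re s \<le> c \<and> \<bar>Im s\<bar> = h}"
  using assms by (auto simp: loop_image_def half_strip_def closed_segment_same_Re closed_segment_eq_real_ivl)

section \<open>Moments of superpositions of powers\<close>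

lemma norm_of_real_powr:
  "0 < t \<Longrightarrow> norm (of_real t powr z :: complex) = t powr Re z"
  by (simp add: norm_powr_real_powr)

lemma powr_unit_interval_moment:
  fixes z :: complex
  assumes "Re z > - 1"
  shows "(LBINT t:{0<..<1}. norm (of_real t powr z)) = 1 / (Re z + 1)" (is ?th1)
    and "set_integrable lborel {0<..<1} (\<lambda>t. of_real t powr z)" (is ?th2)
    and "(LBINT t:{0<..<1}. of_real t powr z) = 1 / (z + 1)" (is ?th3)
proof -
  have meas: "(\<lambda>t. indicator {0<..<1} t *\<^sub>R (of_real t powr z :: complex)) \<in> borel_measurable borel"
    by (intro borel_measurable_continuous_on_indicator continuous_intros) auto
  have meas_norm: "(\<lambda>t. indicator {0<..<1} t *\<^sub>R norm (of_real t powr z :: complex)) \<in> borel_measurable borel"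
    by (intro borel_measurable_continuous_on_indicator continuous_intros) auto
  have "((\<lambda>t. t powr Re z) has_integral (1 powr (Re z + 1) / (Re z + 1))) {0..1}"
    by (rule has_integral_powr_from_0) (use assms in auto)
  then have "((\<lambda>t. t powr Re z) has_integral (1 / (Re z + 1))) {0<..<1}"
    by (simp add: has_integral_Icc_iff_Ioo)
  then have "((\<lambda>t. indicator {0<..<1} t *\<^sub>R norm (of_real t powr z :: complex)) has_integral (1 / (Re z + 1))) UNIV"
    by (subst (asm) has_integral_restrict_UNIV[symmetric])
      (rule has_integral_eq[rotated], assumption, simp add: indicator_def norm_of_real_powr)
  note hi = this
  have hb: "has_bochner_integral lborel (\<lambda>t. indicator {0<..<1} t *\<^sub>R norm (of_real t powr z :: complex)) (1 / (Re z + 1))"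
  proof (rule has_bochner_integral_nn_integral)
    show "(\<integral>\<^sup>+ t. ennreal (indicator {0<..<1} t *\<^sub>R norm (of_real t powr z :: complex)) \<partial>lborel) = ennreal (1 / (Re z + 1))"
      by (rule nn_integral_has_integral_lborel[OF meas_norm _ hi]) simp
    show "(\<lambda>t. indicator {0<..<1} t *\<^sub>R norm (of_real t powr z :: complex)) \<in> borel_measurable lborel"
      using meas_norm by (simp only: measurable_lborel2)
    show "0 \<le> 1 / (Re z + 1)" using assms by simp
  qed simp
  then show ?th1 unfolding set_lebesgue_integral_def by (rule has_bochner_integral_integral_eq)
  show int: ?th2
    unfolding set_integrable_def
    by (rule Bochner_Integration.integrable_bound[OF hb[unfolded has_bochner_integral_iff, THEN conjunct1]])
       (use meas in auto)
  have z1: "z + 1 \<noteq> 0" using assms by (auto simp: complex_eq_iff)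
  have "((\<lambda>t. of_real t powr z) has_integral ((of_real 1 powr (z + 1) / (z + 1)) - (of_real 0 powr (z + 1) / (z + 1)))) {0..1}"
  proof (rule fundamental_theorem_of_calculus_interior)
    show "continuous_on {0..1} (\<lambda>t. (of_real t powr (z + 1) / (z + 1)) :: complex)"
      using assms z1 by (intro continuous_intros) auto
    fix t :: real assume t: "t \<in> {0<..<1}"
    have "((\<lambda>w. w powr (z + 1) / (z + 1)) has_field_derivative (of_real t powr z)) (at (of_real t))"
      using t z1 by (auto intro!: derivative_eq_intros simp: complex_nonpos_Reals_iff)
    then show "((\<lambda>t. of_real t powr (z + 1) / (z + 1)) has_vector_derivative (of_real t powr z)) (at t)"
      by (rule has_vector_derivative_real_field)
  qed auto
  then have "((\<lambda>t. of_real t powr z) has_integral (1 / (z + 1))) {0<..<1}"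
    by (simp add: has_integral_Icc_iff_Ioo)
  then show ?th3
    using set_borel_integral_eq_integral(2)[OF int] by (simp add: integral_unique)
qed

text \<open>Fubini's theorem. The monomial \<open>t powr (k - \<sigma>)\<close> has absolute moment \<open>1/(k + 1 - Re \<sigma>)\<close>, so the
  hypothesis is just absolute integrability of the double integral for \<open>k = 0\<close>.\<close>
lemma powr_superposition_moment:
  fixes W \<sigma> :: "real \<Rightarrow> complex"
  assumes A: "A \<in> sets borel" and W: "continuous_on A W" and \<sigma>: "continuous_on UNIV \<sigma>"
    and lt: "\<And>x. x \<in> A \<Longrightarrow> Re (\<sigma> x) < 1"
    and int: "set_integrable lborel A (\<lambda>x. norm (W x) / (1 - Re (\<sigma> x)))"
  shows "set_integrable lborel {0<..<1} (\<lambda>t. (LBINT x:A. W x * of_real t powr (- \<sigma> x)) * of_real t ^ k)" (is ?th1)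
    and "(LBINT t:{0<..<1}. (LBINT x:A. W x * of_real t powr (- \<sigma> x)) * of_real t ^ k)
           = (LBINT x:A. W x / (of_nat k + 1 - \<sigma> x))" (is ?th2)
proof -
  define w where "w x = indicator A x *\<^sub>R W x" for x
  \<comment> \<open>the power is written with a real logarithm, in which form joint measurability is immediate\<close>
  define H where "H x t = indicator {0<..<1} t *\<^sub>R (w x * exp ((of_nat k - \<sigma> x) * of_real (ln t)))" for x t :: real
  have [measurable]: "w \<in> borel_measurable borel" "\<sigma> \<in> borel_measurable borel"
    unfolding w_def by (intro borel_measurable_continuous_on_indicator A W borel_measurable_continuous_onI \<sigma>)+
  have H_eq: "H x t = w x * (indicator {0<..<1} t *\<^sub>R of_real t powr (of_nat k - \<sigma> x))" for x t
    by (auto simp: H_def indicator_def powr_def Ln_of_real)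
  have H_eq2: "H x t = indicator A x *\<^sub>R (W x * of_real t powr (- \<sigma> x)) * (indicator {0<..<1} t *\<^sub>R of_real t ^ k)" for x t
    by (auto simp: H_eq w_def indicator_def powr_diff powr_nat' powr_minus field_simps)
  have k: "Re (of_nat k - \<sigma> x) > - 1" if "x \<in> A" for x using lt[OF that] by simp
  have inner: "integrable lborel (\<lambda>t. H x t)" for x
  proof (cases "x \<in> A")
    case True
    from powr_unit_interval_moment(2)[OF k[OF True]] show ?thesis
      unfolding H_eq set_integrable_def by (rule integrable_mult_right)
  qed (simp add: H_eq w_def)
  have norm: "(\<integral>t. norm (H x t) \<partial>lborel) = norm (w x) / (of_nat k + 1 - Re (\<sigma> x))" for x
  proof (cases "x \<in> A")
    case True
    have "(\<integral>t. norm (H x t) \<partial>lborel)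
        = norm (w x) * (LBINT t:{0<..<1}. norm (of_real t powr (of_nat k - \<sigma> x)))"
      unfolding set_lebesgue_integral_def integral_mult_right_zero[symmetric]
      by (simp add: H_eq norm_mult mult.left_commute)
    then show ?thesis using powr_unit_interval_moment(1)[OF k[OF True]] by (simp add: add_ac)
  qed (simp add: H_eq w_def)
  have val: "(\<integral>t. H x t \<partial>lborel) = indicator A x *\<^sub>R (W x / (of_nat k + 1 - \<sigma> x))" for x
  proof (cases "x \<in> A")
    case True
    have "(\<integral>t. H x t \<partial>lborel) = w x * (LBINT t:{0<..<1}. of_real t powr (of_nat k - \<sigma> x))"
      unfolding set_lebesgue_integral_def integral_mult_right_zero[symmetric] H_eq ..
    then show ?thesis using True powr_unit_interval_moment(3)[OF k[OF True]]
      by (simp add: w_def algebra_simps)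
  qed (simp add: H_eq w_def)
  have joint: "integrable (lborel \<Otimes>\<^sub>M lborel) (\<lambda>(x, t). H x t)"
  proof (rule lborel_pair.Fubini_integrable)
    show "(\<lambda>(x, t). H x t) \<in> borel_measurable (lborel \<Otimes>\<^sub>M lborel)"
      unfolding H_def by measurable
    show "integrable lborel (\<lambda>x. \<integral>y. norm (case (x, y) of (x, t) \<Rightarrow> H x t) \<partial>lborel)"
      unfolding prod.case norm
    proof (rule Bochner_Integration.integrable_bound[OF int[unfolded set_integrable_def]])
      show "AE x in lborel. norm (norm (w x) / (real k + 1 - Re (\<sigma> x)))
          \<le> norm (indicator A x *\<^sub>R (norm (W x) / (1 - Re (\<sigma> x))))"
      proof (rule AE_I2)
        fix x
        show "norm (norm (w x) / (real k + 1 - Re (\<sigma> x))) \<le> norm (indicator A x *\<^sub>R (norm (W x) / (1 - Re (\<sigma> x))))"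
          using lt[of x] by (cases "x \<in> A") (auto simp: w_def intro!: frac_le)
      qed
    qed measurable
    show "AE x in lborel. integrable lborel (\<lambda>y. case (x, y) of (x, t) \<Rightarrow> H x t)"
      using inner by simp
  qed
  have outer: "indicator {0<..<1} t *\<^sub>R ((LBINT x:A. W x * of_real t powr (- \<sigma> x)) * of_real t ^ k)
      = (\<integral>x. H x t \<partial>lborel)" for t
    unfolding H_eq2 integral_mult_left_zero by (simp add: set_lebesgue_integral_def)
  show ?th1
    unfolding set_integrable_def outer by (rule lborel_pair.integrable_snd[OF joint])
  show ?th2
    unfolding set_lebesgue_integral_def[of _ "{0<..<1}"] outer
    by (subst lborel_pair.Fubini_integral[OF joint]) (simp add: val set_lebesgue_integral_def)
qed

lemma half_strip_loop_integral_eq: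
  assumes "h > 0" "continuous_on {- h..h} (\<lambda>y. f (Complex c y))"
  shows "loop_integral (half_strip c h) f = (LBINT x:{..c}. f (Complex x (- h)))
     + \<i> * (LBINT y:{- h..h}. f (Complex c y)) - (LBINT x:{..c}. f (Complex x h))"
proof -
  have "contour_integral (half_strip c h) f = \<i> * integral {- h..h} (\<lambda>y. f (Complex c y))"
    unfolding half_strip_def using assms(1) by (intro contour_integral_linepath_same_Re) auto
  also have "integral {- h..h} (\<lambda>y. f (Complex c y)) = (LBINT y:{- h..h}. f (Complex c y))"
    using borel_integrable_atLeastAtMost'[OF assms(2)] by (simp add: set_borel_integral_eq_integral(2))
  finally show ?thesis by (simp add: loop_integral_def half_strip_def)
qed

text \<open>Since the half-strip lies left of \<open>Re s = 1\<close>, integrating over \<open>t\<close> replaces \<open>t powr (- s)\<close> by the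
  Cauchy-type kernel \<open>1/(k + 1 - s)\<close>. The weight \<open>1/(1 - x)\<close>
  is essential on the rays: there \<open>F\<close> may decay with an arbitrarily small positive exponent.\<close>
lemma half_strip_loop_moment:
  assumes h: "h > 0" and c: "c < 1"
    and F: "continuous_on (loop_image (half_strip c h)) F"
    and rays: "\<And>y. \<bar>y\<bar> = h \<Longrightarrow> set_integrable lborel {..c} (\<lambda>x. norm (F (Complex x y)) / (1 - x))"
  shows "set_integrable lborel {0<..<1}
            (\<lambda>t. loop_integral (half_strip c h) (\<lambda>s. F s * of_real t powr (- s)) * of_real t ^ k)" (is ?th1)
    and "(LBINT t:{0<..<1}. loop_integral (half_strip c h) (\<lambda>s. F s * of_real t powr (- s)) * of_real t ^ k)
      = loop_integral (half_strip c h) (\<lambda>s. F s / (of_nat k + 1 - s))" (is ?th2)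
proof -
  have contF: "continuous_on A (\<lambda>x. F (\<sigma> x))" 
    if "continuous_on UNIV \<sigma>" "\<sigma> ` A \<subseteq> loop_image (half_strip c h)" for A and \<sigma> :: "real \<Rightarrow> complex"
    by (rule continuous_on_compose2[OF F]) (use that in \<open>auto intro: continuous_on_subset\<close>)
  have cont\<sigma>: "continuous_on UNIV (\<lambda>x. Complex x y)" "continuous_on UNIV (\<lambda>x. Complex y x)" for y
    by (simp_all add: Complex_eq continuous_intros)
  define R where "R y t = (LBINT x:{..c}. F (Complex x y) * of_real t powr (- Complex x y))" for y t
  define S where "S t = (LBINT y:{- h..h}. F (Complex c y) * of_real t powr (- Complex c y))" for t
  have R: "set_integrable lborel {0<..<1} (\<lambda>t. R y t * of_real t ^ k)"
    "(LBINT t:{0<..<1}. R y t * of_real t ^ k) = (LBINT x:{..c}. F (Complex x y) / (of_nat k + 1 - Complex x y))"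
    if "\<bar>y\<bar> = h" for y
    unfolding R_def
    using that c rays[OF that]
    by (intro powr_superposition_moment contF cont\<sigma>; auto simp: loop_image_half_strip[OF h])+
  have S_int: "set_integrable lborel {- h..h} (\<lambda>x. norm (F (Complex c x)) / (1 - c))"
    by (intro borel_integrable_atLeastAtMost' continuous_intros contF cont\<sigma>)
       (use c h in \<open>auto simp: loop_image_half_strip[OF h]\<close>)
  have S: "set_integrable lborel {0<..<1} (\<lambda>t. S t * of_real t ^ k)"
    "(LBINT t:{0<..<1}. S t * of_real t ^ k) = (LBINT y:{- h..h}. F (Complex c y) / (of_nat k + 1 - Complex c y))"
    unfolding S_def
    using c S_int
    by (intro powr_superposition_moment contF cont\<sigma>; auto simp: loop_image_half_strip[OF h])+
  define T where "T t = (R (- h) t * of_real t ^ k + \<i> * (S t * of_real t ^ k)) - R h t * of_real t ^ k" for t :: real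
  have cS: "continuous_on {- h..h} (\<lambda>x. F (Complex c x))"
    by (intro contF cont\<sigma>) (auto simp: loop_image_half_strip[OF h])
  have T: "loop_integral (half_strip c h) (\<lambda>s. F s * of_real t powr (- s)) * of_real t ^ k = T t"
    if "t \<in> {0<..<1}" for t
  proof -
    have "continuous_on {- h..h} (\<lambda>y. F (Complex c y) * of_real t powr (- Complex c y))"
      using that by (intro continuous_intros cS continuous_on_subset[OF cont\<sigma>(2)]) auto
    from half_strip_loop_integral_eq[of _ "\<lambda>s. F s * of_real t powr (- s)", OF h this]
    have "loop_integral (half_strip c h) (\<lambda>s. F s * of_real t powr (- s)) = R (- h) t + \<i> * S t - R h t"
      by (simp only: R_def S_def)
    then show ?thesis by (simp only: T_def ring_distribs mult.assoc)
  qed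
  have iS: "set_integrable lborel {0<..<1} (\<lambda>t. \<i> * (S t * of_real t ^ k))"
    using S(1) by (rule set_integrable_mult_right)
  have "set_integrable lborel {0<..<1} T"
    unfolding T_def using R(1)[of h] R(1)[of "- h"] iS h by (intro set_integral_diff set_integral_add) auto
  then show ?th1
    by (rule set_integrable_cong[THEN iffD1, rotated -1]) (use T in auto)
  have "(LBINT t:{0<..<1}. loop_integral (half_strip c h) (\<lambda>s. F s * of_real t powr (- s)) * of_real t ^ k)
      = (LBINT t:{0<..<1}. T t)"
    using T by (intro set_lebesgue_integral_cong) auto
  also have "\<dots> = (LBINT t:{0<..<1}. R (- h) t * of_real t ^ k) + \<i> * (LBINT t:{0<..<1}. S t * of_real t ^ k)
       - (LBINT t:{0<..<1}. R h t * of_real t ^ k)"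
    unfolding T_def using R(1)[of h] R(1)[of "- h"] iS h
    by (subst set_integral_diff(2) set_integral_add(2) | simp add: set_integral_add)+
  also have "\<dots> = loop_integral (half_strip c h) (\<lambda>s. F s / (of_nat k + 1 - s))"
  proof -
    have "of_nat k + 1 - Complex c y \<noteq> 0" for y
      using c by (auto simp: complex_eq_iff)
    then have "continuous_on {- h..h} (\<lambda>y. F (Complex c y) / (of_nat k + 1 - Complex c y))"
      by (intro continuous_intros cS continuous_on_subset[OF cont\<sigma>(2)]) auto
    from half_strip_loop_integral_eq[of _ "\<lambda>s. F s / (of_nat k + 1 - s)", OF h this] show ?thesis
      using R(2) S(2) h by simp
  qed
  finally show ?th2 .
qed

section \<open>The kernel of the loop integral\<close>

text \<open>Integrability on a ray to \<open>-\<infinity>\<close> follows from power decay near \<open>-\<infinity>\<close> and continuity on the rest.\<close>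
lemma set_integrable_ray:
  fixes f :: "real \<Rightarrow> 'a::{banach, second_countable_topology}"
  assumes cont: "continuous_on {..B} f" and p: "p > 1"
    and bound: "\<And>x. x \<le> - M \<Longrightarrow> norm (f x) \<le> K * (- x) powr (- p)"
  shows "set_integrable lborel {..B} f"
proof -
  define A where "A = min (min (- M) (- 1)) B"
  have "((\<lambda>x. x powr (- p)) has_integral (- ((- A) powr (- p + 1)) / (- p + 1))) {- A..}"
    using p by (intro has_integral_powr_to_inf) (auto simp: A_def)
  then have "((\<lambda>x. indicator {- A..} x *\<^sub>R x powr (- p)) has_integral (- ((- A) powr (- p + 1)) / (- p + 1))) UNIV"
    by (subst (asm) has_integral_restrict_UNIV[symmetric])
      (rule has_integral_eq[rotated], assumption, simp add: indicator_def)
  note hi = this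
  have meas: "(\<lambda>x. indicator {- A..} x *\<^sub>R x powr (- p)) \<in> borel_measurable borel"
    by measurable
  have "has_bochner_integral lborel (\<lambda>x. indicator {- A..} x *\<^sub>R x powr (- p)) (- ((- A) powr (- p + 1)) / (- p + 1))"
  proof (rule has_bochner_integral_nn_integral)
    show "(\<integral>\<^sup>+ x. ennreal (indicator {- A..} x *\<^sub>R x powr (- p)) \<partial>lborel) = ennreal (- ((- A) powr (- p + 1)) / (- p + 1))"
      by (rule nn_integral_has_integral_lborel[OF meas _ hi]) simp
    show "- ((- A) powr (- p + 1)) / (- p + 1) \<ge> 0" using p by (intro divide_nonpos_neg) auto
  qed (use meas in simp_all)
  then have "integrable lborel (\<lambda>x. indicator {- A..} x *\<^sub>R x powr (- p))"
    by (simp add: has_bochner_integral_iff)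
  from lborel_integrable_real_affine[OF this, of "- 1" 0]
  have "integrable lborel (\<lambda>x. K * (indicator {- A..} (- x) *\<^sub>R (- x) powr (- p)))"
    by simp
  then have "set_integrable lborel {..A} f"
    unfolding set_integrable_def
  proof (rule Bochner_Integration.integrable_bound)
    have "continuous_on {..A} f" by (rule continuous_on_subset[OF cont]) (auto simp: A_def)
    then show "(\<lambda>x. indicator {..A} x *\<^sub>R f x) \<in> borel_measurable lborel"
      by (simp add: borel_measurable_continuous_on_indicator)
    show "AE x in lborel. norm (indicator {..A} x *\<^sub>R f x) \<le> norm (K * (indicator {- A..} (- x) *\<^sub>R (- x) powr (- p)))"
    proof (rule AE_I2)
      fix x show "norm (indicator {..A} x *\<^sub>R f x) \<le> norm (K * (indicator {- A..} (- x) *\<^sub>R (- x) powr (- p)))"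
        using order_trans[OF bound[of x] mult_right_mono[OF abs_ge_self[of K] powr_ge_zero[of "- x" "- p"]]]
        by (auto simp: indicator_def A_def abs_mult)
    qed
  qed
  moreover have "set_integrable lborel {A..B} f"
    by (rule borel_integrable_atLeastAtMost', rule continuous_on_subset[OF cont]) auto
  ultimately have "set_integrable lborel ({..A} \<union> {A..B}) f"
    by (rule set_integrable_Un) auto
  moreover have "{..A} \<union> {A..B} = {..B}" by (auto simp: A_def)
  ultimately show ?thesis by simp
qed

lemma powr_minus_le_one: "1 \<le> x \<Longrightarrow> 0 \<le> d \<Longrightarrow> x powr (- d) \<le> 1" for x d :: real
  using powr_mono[of "- d" 0 x] by simp

text \<open>Reduces exponential decay to power decay, so that one integrability criterion covers all rays.\<close>
lemma exp_times_square_bound: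
  fixes L x :: real
  assumes "L > 0" "x \<le> -1"
  shows "exp (L * x) \<le> (2 / L\<^sup>2) * (- x) powr (- 2)"
proof -
  define z where "z = L * (- x)"
  have z: "z > 0" unfolding z_def using assms by (intro mult_pos_pos) auto
  have "z\<^sup>2 / 2 \<le> exp z"
    using exp_lower_Taylor_quadratic[of z] z by argo
  then have "inverse (exp z) \<le> inverse (z\<^sup>2 / 2)"
    using z by (intro le_imp_inverse_le) auto
  then have "exp (L * x) \<le> 1 / ((L * (- x))\<^sup>2 / 2)"
    by (simp only: z_def exp_minus[symmetric]) (simp add: inverse_eq_divide)
  also have "\<dots> = (2 / L\<^sup>2) * (- x) powr (- 2)"
    using assms by (simp add: powr_minus power_mult_distrib field_simps)
  finally show ?thesis .
qed

lemma contour_integral_square_bound: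
  assumes "f contour_integrable_on rectpath (Complex (- Y) (- Y)) (Complex Y Y)" "Y > 0" 
    and "\<And>s. s \<in> path_image (rectpath (Complex (- Y) (- Y)) (Complex Y Y)) \<Longrightarrow> norm (f s) \<le> B" 
  shows "norm (contour_integral (rectpath (Complex (- Y) (- Y)) (Complex Y Y)) f) \<le> 8 * Y * B"
proof -
  let ?p = "Complex (- Y) (- Y)" and ?q = "Complex Y (- Y)" and ?r = "Complex Y Y" and ?s = "Complex (- Y) Y"
  have eq: "rectpath ?p ?r = linepath ?p ?q +++ linepath ?q ?r +++ linepath ?r ?s +++ linepath ?s ?p"
    by (simp add: rectpath_def Let_def)
  have int: "f contour_integrable_on linepath ?p ?q" "f contour_integrable_on linepath ?q ?r"
     "f contour_integrable_on linepath ?r ?s" "f contour_integrable_on linepath ?s ?p"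
    using assms(1) unfolding eq by (simp_all add: valid_path_join)
  have img: "path_image (rectpath ?p ?r) = closed_segment ?p ?q \<union> closed_segment ?q ?r \<union> closed_segment ?r ?s \<union> closed_segment ?s ?p"
    unfolding eq by (auto simp: path_image_join)
  have B: "B \<ge> 0" using order_trans[OF norm_ge_zero assms(3)[of ?p]] by (simp add: img)
  have bnd: "norm (contour_integral (linepath u v) f) \<le> B * norm (v - u)"
    if "f contour_integrable_on linepath u v" "closed_segment u v \<subseteq> path_image (rectpath ?p ?r)" for u v
    using that B assms(3) by (intro contour_integral_bound_linepath) auto
  have "contour_integral (rectpath ?p ?r) f = contour_integral (linepath ?p ?q) f
      + (contour_integral (linepath ?q ?r) f + (contour_integral (linepath ?r ?s) f + contour_integral (linepath ?s ?p) f))"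
    unfolding eq using int by (simp add: valid_path_join)
  then have "norm (contour_integral (rectpath ?p ?r) f)
      \<le> B * norm (?q - ?p) + (B * norm (?r - ?q) + (B * norm (?s - ?r) + B * norm (?p - ?s)))"
    by (simp only:) (intro norm_triangle_mono bnd int; unfold img; blast)
  moreover have "norm (?q - ?p) = 2 * Y" "norm (?r - ?q) = 2 * Y" "norm (?s - ?r) = 2 * Y" "norm (?p - ?s) = 2 * Y"
    using assms(2) by (simp_all add: cmod_def real_sqrt_mult)
  ultimately show ?thesis by (simp only:) (simp add: mult.commute)
qed

lemma loop_integral_cong:
  assumes "\<And>s. s \<in> loop_image g \<Longrightarrow> f s = f' s"
  shows "loop_integral g f = loop_integral g f'"
proof -
  have "contour_integral g f = contour_integral g f'"
    by (intro contour_integral_cong) (auto intro!: assms simp: loop_image_def)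
  moreover have "(LBINT x:{..Re (pathstart g)}. f (Complex x (Im (pathstart g))))
      = (LBINT x:{..Re (pathstart g)}. f' (Complex x (Im (pathstart g))))"
    by (intro set_lebesgue_integral_cong) (auto intro!: assms simp: loop_image_def)
  moreover have "(LBINT x:{..Re (pathfinish g)}. f (Complex x (Im (pathfinish g))))
      = (LBINT x:{..Re (pathfinish g)}. f' (Complex x (Im (pathfinish g))))"
    by (intro set_lebesgue_integral_cong) (auto intro!: assms simp: loop_image_def)
  ultimately show ?thesis by (simp add: loop_integral_def)
qed

lemma Gamma_prod_holomorphic:
  assumes "\<And>c s. c \<in> set cs \<Longrightarrow> s \<in> A \<Longrightarrow> c + u s \<notin> \<int>\<^sub>\<le>\<^sub>0" "u holomorphic_on A"
  shows "(\<lambda>s. Gamma_prod (shift cs (u s))) holomorphic_on A"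
  using assms(1)
proof (induction cs)
  case Nil
  then show ?case by (simp add: Gamma_prod_def shift_def)
next
  case (Cons c cs)
  have "(\<lambda>s. Gamma (c + u s) * Gamma_prod (shift cs (u s))) holomorphic_on A"
    using Cons assms(2) by (intro holomorphic_intros) auto
  then show ?case by (simp add: Gamma_prod_def shift_def)
qed

lemma inverse_Gamma_prod_holomorphic:
  assumes "u holomorphic_on A"
  shows "(\<lambda>s. inverse (Gamma_prod (shift cs (u s)))) holomorphic_on A"
proof (induction cs)
  case Nil
  then show ?case by (simp add: Gamma_prod_def shift_def)
next
  case (Cons c cs)
  have "(\<lambda>s. rGamma (c + u s) * inverse (Gamma_prod (shift cs (u s)))) holomorphic_on A"
    by (intro holomorphic_on_mult Cons holomorphic_rGamma' holomorphic_on_add holomorphic_on_const assms)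
  then show ?case by (simp add: Gamma_prod_def shift_def rGamma_inverse_Gamma)
qed

text \<open>The parameters of the kernel. The condition on the real parts puts all left poles into the half
  plane \<open>Re s < 1\<close>.\<close>
locale Meijer_kernel =
  fixes a b :: "complex list" and n :: nat
  assumes len: "length a = length b"
    and nonpole: "\<And>c. c \<in> set a \<Longrightarrow> - c \<notin> \<nat>"
    and Re_a: "\<And>c. c \<in> set a \<Longrightarrow> Re c > - real n"
begin

text \<open>The integrand without its factor \<open>t powr (- s)\<close>. The quotient
  \<open>\<Gamma>(1 - n - s)/\<Gamma>(1 - s)\<close> is written as a reciprocal Pochhammer symbol; this removes the singularities at
  \<open>s = 1, 2, \<dots>\<close>, where the quotient of the two Gamma functions is \<open>0/0\<close>.\<close>
definition F :: "complex \<Rightarrow> complex" where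
  "F s = Gamma_quotient a b (of_nat n - 1 + s) / pochhammer (1 - of_nat n - s) n"

definition left_poles :: "complex set" where
  "left_poles = (\<Union>c\<in>set a. range (\<lambda>l::nat. 1 - c - of_nat n - of_nat l))"

text \<open>Of the points \<open>1 - n + k\<close> to the right of the loop only \<open>k < n\<close> are genuine poles.\<close>
definition right_poles :: "complex set" where
  "right_poles = (\<lambda>i. - of_nat i) ` {..<n}"

definition poles :: "complex set" where "poles = left_poles \<union> right_poles"

text \<open>The decay exponent of the kernel: \<open>F s\<close> is at most of order \<open>|s| powr (- \<delta>)\<close> away from the poles. The
  moments converge because \<open>\<delta> > 0\<close>.\<close>
definition \<delta> :: real where "\<delta> = Re (sum_list b - sum_list a) + real n"

lemma left_poleI: "c \<in> set a \<Longrightarrow> 1 - c - of_nat n - of_nat l \<in> left_poles"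
  by (auto simp: left_poles_def)

text \<open>A common point would make some \<open>- c\<close> a natural number.\<close>
lemma left_right_disjoint: "left_poles \<inter> right_poles = {}"
proof -
  have False if "c \<in> set a" "1 - c - of_nat n - of_nat l = - of_nat i" "i < n" for c and l i :: nat
  proof -
    have "- c = of_nat (n + l) - of_nat (i + 1)" using that(2) by (simp add: algebra_simps)
    also have "\<dots> = of_nat (n + l - (i + 1))" using that(3) by (subst of_nat_diff) auto
    finally show False using nonpole[OF that(1)] by (metis of_nat_in_Nats)
  qed
  then show ?thesis unfolding left_poles_def right_poles_def
    by (safe, simp only: lessThan_iff) metis
qed

lemma finite_poles_ball: "finite (poles \<inter> ball 0 R)"
proof -
  have "finite (range (\<lambda>l::nat. 1 - c - of_nat n - of_nat l) \<inter> ball 0 R)" for c :: complex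
  proof (rule finite_subset)
    show "range (\<lambda>l::nat. 1 - c - of_nat n - of_nat l) \<inter> ball 0 R
        \<subseteq> (\<lambda>l. 1 - c - of_nat n - of_nat l) ` {..nat \<lceil>R + norm (1 - c - of_nat n)\<rceil>}"
    proof
      fix z assume "z \<in> range (\<lambda>l::nat. 1 - c - of_nat n - of_nat l) \<inter> ball 0 R"
      then obtain l :: nat where l: "z = 1 - c - of_nat n - of_nat l" "norm z < R" by auto
      have "real l = norm ((1 - c - of_nat n) - z)" by (simp add: l)
      also have "\<dots> \<le> norm (1 - c - of_nat n) + norm z" by (rule norm_triangle_ineq4)
      finally have "real l \<le> R + norm (1 - c - of_nat n)" using l by simp
      then have "l \<le> nat \<lceil>R + norm (1 - c - of_nat n)\<rceil>" by linarith
      then show "z \<in> (\<lambda>l. 1 - c - of_nat n - of_nat l) ` {..nat \<lceil>R + norm (1 - c - of_nat n)\<rceil>}"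
        using l by auto
    qed
  qed auto
  then have "finite (\<Union>c\<in>set a. range (\<lambda>l::nat. 1 - c - of_nat n - of_nat l) \<inter> ball 0 R)"
    by (intro finite_UN_I) auto
  moreover have "left_poles \<inter> ball 0 R = (\<Union>c\<in>set a. range (\<lambda>l::nat. 1 - c - of_nat n - of_nat l) \<inter> ball 0 R)"
    by (auto simp: left_poles_def)
  ultimately have "finite (left_poles \<inter> ball 0 R)" by (simp only:)
  then show ?thesis by (auto simp: poles_def right_poles_def Int_Un_distrib2)
qed

lemma closed_left_poles: "closed left_poles"
proof -
  have "closed (range (\<lambda>l::nat. 1 - c - of_nat n - of_nat l :: complex))" for c :: complex
  proof (rule discrete_imp_closed[of 1])
    show "\<forall>x\<in>range (\<lambda>l::nat. 1 - c - of_nat n - of_nat l).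
      \<forall>y\<in>range (\<lambda>l::nat. 1 - c - of_nat n - of_nat l). dist y x < 1 \<longrightarrow> y = x"
    proof (intro ballI impI)
      fix x y :: complex
      assume "x \<in> range (\<lambda>l::nat. 1 - c - of_nat n - of_nat l)" "y \<in> range (\<lambda>l::nat. 1 - c - of_nat n - of_nat l)"
        and d: "dist y x < 1"
      then obtain k l :: nat where kl: "x = 1 - c - of_nat n - of_nat k" "y = 1 - c - of_nat n - of_nat l" by auto
      have "dist y x = norm (of_int (int k - int l) :: complex)" by (simp add: kl dist_norm)
      then have "\<bar>int k - int l\<bar> < 1" using d unfolding norm_of_int by simp
      then show "y = x" by (simp add: kl)
    qed
  qed auto
  then show ?thesis unfolding left_poles_def by (intro closed_UN) auto
qed

lemma closed_poles: "closed poles"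
  unfolding poles_def right_poles_def by (intro closed_Un closed_left_poles finite_imp_closed) auto

lemma Gamma_quotient_holomorphic: "(\<lambda>s. Gamma_quotient a b (of_nat n - 1 + s)) holomorphic_on - left_poles"
proof -
  let ?u = "\<lambda>s. of_nat n - 1 + s :: complex"
  have "(\<lambda>s. Gamma_prod (shift a (?u s)) * inverse (Gamma_prod (shift b (?u s)))) holomorphic_on - left_poles"
  proof (intro holomorphic_on_mult Gamma_prod_holomorphic inverse_Gamma_prod_holomorphic
      holomorphic_on_add holomorphic_on_const holomorphic_on_ident)
    fix c s assume *: "c \<in> set a" "s \<in> - left_poles"
    show "c + ?u s \<notin> \<int>\<^sub>\<le>\<^sub>0"
    proof
      assume "c + ?u s \<in> \<int>\<^sub>\<le>\<^sub>0"
      then obtain l :: nat where "c + ?u s = - of_nat l" by (auto elim!: nonpos_Ints_cases')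
      then have "s = 1 - c - of_nat n - of_nat l" by (simp add: algebra_simps eq_neg_iff_add_eq_0)
      then show False using * left_poleI by auto
    qed
  qed
  then show ?thesis by (simp add: Gamma_quotient_def divide_inverse)
qed

lemma F_holomorphic: "F holomorphic_on - poles"
  unfolding F_def
proof (intro holomorphic_on_divide holomorphic_pochhammer holomorphic_on_diff holomorphic_on_const holomorphic_on_ident)
  show "(\<lambda>s. Gamma_quotient a b (of_nat n - 1 + s)) holomorphic_on - poles"
    by (rule holomorphic_on_subset[OF Gamma_quotient_holomorphic]) (auto simp: poles_def)
  fix s :: complex assume *: "s \<in> - poles"
  show "pochhammer (1 - of_nat n - s) n \<noteq> 0"
  proof
    assume "pochhammer (1 - of_nat n - s) n = 0"
    then obtain k where k: "k < n" "1 - of_nat n - s = - of_nat k" by (auto simp: pochhammer_eq_0_iff)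
    moreover have "of_nat (n - 1 - k) = (of_nat n - 1 - of_nat k :: complex)"
      using k(1) by (simp add: of_nat_diff)
    ultimately have "s = - of_nat (n - 1 - k)" by (simp add: algebra_simps)
    moreover have "n - 1 - k < n" using k(1) by simp
    ultimately have "s \<in> right_poles" unfolding right_poles_def by blast
    with * show False by (auto simp: poles_def)
  qed
qed

lemma F_bound:
  assumes \<eta>: "\<eta> > 0"
  obtains C V where "C > 0" "V \<ge> V0" "V \<ge> 1"
    "\<And>s u. u = of_nat n - 1 + s \<Longrightarrow> norm u \<ge> 2 * V \<Longrightarrow>
        \<bar>Im u\<bar> \<ge> V \<or> Re u \<ge> 0 \<or> (\<forall>c\<in>set a. norm (sin (of_real pi * (c + u))) \<ge> \<eta>) \<Longrightarrow>
        norm (F s) \<le> C * norm u powr (- \<delta>)"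
proof -
  obtain C V where CV: "C > 0" "V \<ge> max V0 (real n)" "V \<ge> 1"
    "\<And>u. norm u \<ge> 2 * V \<Longrightarrow>
        \<bar>Im u\<bar> \<ge> V \<or> Re u \<ge> 0 \<or> (\<forall>c\<in>set a. norm (sin (of_real pi * (c + u))) \<ge> \<eta>) \<Longrightarrow>
        norm (Gamma_quotient a b u) \<le> C * norm u powr Re (sum_list a - sum_list b)"
    using Gamma_quotient_bound[OF len \<eta>, of "max V0 (real n)"] by metis
  show thesis
  proof (rule that[of "C * 2 ^ n" V])
    fix s u :: complex
    assume u: "u = of_nat n - 1 + s" "norm u \<ge> 2 * V"
      and c: "\<bar>Im u\<bar> \<ge> V \<or> Re u \<ge> 0 \<or> (\<forall>c\<in>set a. norm (sin (of_real pi * (c + u))) \<ge> \<eta>)"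
    have u0: "norm u > 0" using u(2) CV(3) by linarith
    \<comment> \<open>\<open>V \<ge> n\<close> makes each of the \<open>n\<close> factors \<open>i - u\<close> at least half as large as \<open>u\<close>\<close>
    have "(norm u / 2) ^ n \<le> norm (pochhammer (- u) n)"
    proof -
      have "(norm u / 2) ^ n = (\<Prod>i<n. norm u / 2)" by simp
      also have "\<dots> \<le> (\<Prod>i<n. norm (- u + of_nat i))"
      proof (rule prod_mono, safe)
        fix i assume "i < n"
        then have "real i \<le> norm u / 2" using u(2) CV(2) by linarith
        moreover have "norm u - real i \<le> norm (- u + of_nat i)"
          using norm_triangle_ineq2[of u "of_nat i"] by (simp add: norm_minus_commute)
        ultimately show "norm u / 2 \<le> norm (- u + of_nat i)" by linarith
      qed auto
      also have "\<dots> = norm (pochhammer (- u) n)"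
        by (simp add: pochhammer_prod prod_norm atLeast0LessThan)
      finally show ?thesis .
    qed
    moreover have "1 - of_nat n - s = - u" by (simp add: u)
    moreover have "norm (F s) = norm (Gamma_quotient a b u) / norm (pochhammer (1 - of_nat n - s) n)"
      by (simp only: F_def norm_divide u(1))
    moreover have "(norm u / 2) ^ n > 0" using u0 by simp
    ultimately have "norm (F s) \<le> (C * norm u powr Re (sum_list a - sum_list b)) / (norm u / 2) ^ n"
      using frac_le[OF _ CV(4)[OF u(2) c]] CV(1) \<open>1 - of_nat n - s = - u\<close> by (simp only:) simp
    also have "\<dots> = C * 2 ^ n * (norm u powr Re (sum_list a - sum_list b) / norm u powr real n)"
      using u0 by (simp add: powr_realpow power_divide)
    also have "norm u powr Re (sum_list a - sum_list b) / norm u powr real n = norm u powr (- \<delta>)"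
      by (simp add: powr_diff[symmetric] \<delta>_def)
    finally show "norm (F s) \<le> C * 2 ^ n * norm u powr (- \<delta>)" .
  qed (use CV in auto)
qed

text \<open>The real parts of the poles lie in finitely many classes modulo 1, so a vertical line and all its
  integer translates avoid them; by periodicity one lower bound on the sines holds on all these lines.\<close>
lemma vertical_lines_exist:
  obtains X0 \<eta> where "X0 \<ge> 0" "\<eta> > 0"
    "\<And>s (m::nat). Re s = - (X0 + real m) \<Longrightarrow> s \<notin> poles \<and>
       (\<forall>c\<in>set a. norm (sin (of_real pi * (c + (of_nat n - 1 + s)))) \<ge> \<eta>)"
proof -
  have "countable (\<Union>c\<in>insert 0 (set a). range (\<lambda>j::int. Re c - of_int j))"
    by (intro countable_UN countable_image countableI_type) (auto intro: countable_finite)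
  then have "\<not> {0..1} \<subseteq> (\<Union>c\<in>insert 0 (set a). range (\<lambda>j::int. Re c - of_int j))"
    using uncountable_closed_interval[of "0::real" 1] by (meson countable_subset zero_less_one)
  then obtain X0 where X0_in: "X0 \<in> {0..1}"
    and X0_notin: "X0 \<notin> (\<Union>c\<in>insert 0 (set a). range (\<lambda>j::int. Re c - of_int j))"
    by (meson subsetI)
  have "X0 \<noteq> Re c - of_int j" if "c \<in> insert 0 (set a)" for c and j :: int
    using X0_notin that by (metis UN_I rangeI)
  note X0 = X0_in this
  define \<eta> where "\<eta> = Min (insert 1 ((\<lambda>c. \<bar>sin (pi * (Re c - X0))\<bar>) ` set a))"
  have sin_pos: "\<bar>sin (pi * (Re c - X0))\<bar> > 0" if "c \<in> set a" for c
  proof -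
    have "sin (pi * (Re c - X0)) \<noteq> 0"
    proof
      assume "sin (pi * (Re c - X0)) = 0"
      then obtain j :: int where "pi * (Re c - X0) = of_int j * pi" by (auto simp: sin_zero_iff_int2)
      then have "X0 = Re c - of_int j" by simp
      with X0(2)[of c j] that show False by simp
    qed
    then show ?thesis by simp
  qed
  have \<eta>: "\<eta> > 0" "\<And>c. c \<in> set a \<Longrightarrow> \<eta> \<le> \<bar>sin (pi * (Re c - X0))\<bar>"
    using sin_pos by (auto simp: \<eta>_def)
  have sin_bound: "norm (sin (of_real pi * (c + (of_nat n - 1 + s)))) \<ge> \<eta>" 
    if "Re s = - (X0 + real m)" "c \<in> set a" for s c and m :: nat
  proof -
    let ?z = "of_real pi * (c + (of_nat n - 1 + s)) :: complex"
    have "\<bar>sin (Re ?z)\<bar> = \<bar>sin (pi * (Re c - X0))\<bar>"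
    proof -
      have "Re ?z = pi * (Re c - X0) + pi * of_int (int n - 1 - int m)"
        unfolding distrib_left[symmetric] by (simp add: that(1))
      then have "sin (Re ?z) = sin (pi * (Re c - X0)) * cos (pi * of_int (int n - 1 - int m))"
        by (simp only: sin_add sin_npi_int mult_zero_right add_0_right)
      then show ?thesis by (simp only: abs_mult cos_npi_int) simp
    qed
    then show ?thesis using \<eta>(2)[OF that(2)] norm_sin_ge_abs_sin_Re[of ?z] by simp
  qed
  show thesis
  proof (rule that[of X0 \<eta>])
    fix s and m :: nat assume s: "Re s = - (X0 + real m)"
    have "s \<notin> left_poles"
    proof
      assume "s \<in> left_poles"
      then obtain c and l :: nat where "c \<in> set a" "s = 1 - c - of_nat n - of_nat l" by (auto simp: left_poles_def)
      moreover have "Re s = 1 - Re c - real n - real l" using calculation by simp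
      ultimately show False using X0(2)[of c "1 + int m - int n - int l"] s by auto
    qed
    moreover have "s \<notin> right_poles"
    proof
      assume "s \<in> right_poles"
      then obtain i where "s = - of_nat i" by (auto simp: right_poles_def)
      then show False using X0(2)[of 0 "int m - int i"] s by auto
    qed
    ultimately show "s \<notin> poles \<and> (\<forall>c\<in>set a. norm (sin (of_real pi * (c + (of_nat n - 1 + s)))) \<ge> \<eta>)"
      using sin_bound[OF s] by (auto simp: poles_def)
  qed (use X0 \<eta> in auto)
qed

lemma F_bound_horizontal:
  assumes y: "\<And>c. c \<in> set a \<Longrightarrow> Im c + y \<noteq> 0" and \<delta>: "\<delta> > 0"
  obtains K M where "K > 0" "M \<ge> 1" "\<And>x. x \<le> - M \<Longrightarrow> norm (F (Complex x y)) \<le> K * (- x) powr (- \<delta>)"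
proof -
  define \<eta> where "\<eta> = Min (insert 1 ((\<lambda>c. \<bar>Im c + y\<bar>) ` set a))"
  have \<eta>: "\<eta> > 0" "\<And>c. c \<in> set a \<Longrightarrow> \<eta> \<le> \<bar>Im c + y\<bar>"
    using y by (auto simp: \<eta>_def)
  obtain C V where CV: "C > 0" "V \<ge> real n" "V \<ge> 1" "\<And>s u. u = of_nat n - 1 + s \<Longrightarrow> norm u \<ge> 2 * V \<Longrightarrow>
        \<bar>Im u\<bar> \<ge> V \<or> Re u \<ge> 0 \<or> (\<forall>c\<in>set a. norm (sin (of_real pi * (c + u))) \<ge> \<eta>) \<Longrightarrow>
        norm (F s) \<le> C * norm u powr (- \<delta>)" using F_bound[OF \<eta>(1), of "real n"] by metis
  show thesis
  proof (rule that[of "C * 2 powr \<delta>" "4 * V"])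
    fix x :: real assume x: "x \<le> - (4 * V)"
    define u where "u = of_nat n - 1 + Complex x y"
    have u: "norm u \<ge> - x / 2"
      using abs_Re_le_cmod[of u] x CV(2,3) by (simp add: u_def)
    have "norm (sin (of_real pi * (c + u))) \<ge> \<eta>" if "c \<in> set a" for c
    proof -
      have "\<eta> \<le> \<bar>Im (of_real pi * (c + u))\<bar> / 2"
      proof -
        have "\<bar>Im c + y\<bar> * 2 \<le> \<bar>Im c + y\<bar> * pi" by (intro mult_left_mono) (use pi_ge_two in auto)
        then show ?thesis using \<eta>(2)[OF that] by (simp add: u_def abs_mult mult.commute)
      qed
      then show ?thesis using norm_sin_ge_abs_Im[of "of_real pi * (c + u)"] by linarith
    qed
    then have "norm (F (Complex x y)) \<le> C * norm u powr (- \<delta>)"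
      using u x by (intro CV(4)) (auto simp: u_def)
    also have "norm u powr (- \<delta>) \<le> (- x / 2) powr (- \<delta>)"
      using u x CV(3) \<delta> by (intro powr_mono2') auto
    also have "(- x / 2) powr (- \<delta>) = 2 powr \<delta> * (- x) powr (- \<delta>)"
      using x CV(3) by (subst powr_divide) (auto simp: powr_minus field_simps)
    finally show "norm (F (Complex x y)) \<le> C * 2 powr \<delta> * (- x) powr (- \<delta>)"
      using CV(1) by (simp add: mult_left_mono mult.assoc)
  qed (use CV in auto)
qed

end

section \<open>Deformation to a half-strip\<close>

lemma vertical_segment_integral_tendsto_0:
  assumes holo: "f holomorphic_on - P" and P: "closed P" "\<And>m s. Re s = - X m \<Longrightarrow> s \<notin> P"
    and bound: "\<forall>\<^sub>F m in F. \<forall>s. Re s = - X m \<longrightarrow> s \<in> closed_segment (Complex (- X m) y2) (Complex (- X m) y1) \<longrightarrow> norm (f s) \<le> B m"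
    and B: "(B \<longlongrightarrow> 0) F"
  shows "((\<lambda>m. contour_integral (linepath (Complex (- X m) y2) (Complex (- X m) y1)) f) \<longlongrightarrow> 0) F"
proof (rule Lim_null_comparison)
  have "((\<lambda>m. B m * \<bar>y1 - y2\<bar>) \<longlongrightarrow> 0 * \<bar>y1 - y2\<bar>) F" by (intro tendsto_intros B)
  then show "((\<lambda>m. B m * \<bar>y1 - y2\<bar>) \<longlongrightarrow> 0) F" by simp
  show "\<forall>\<^sub>F m in F. norm (contour_integral (linepath (Complex (- X m) y2) (Complex (- X m) y1)) f) \<le> B m * \<bar>y1 - y2\<bar>"
    using bound
  proof eventually_elim
    case (elim m)
    let ?p = "Complex (- X m) y2" and ?q = "Complex (- X m) y1"
    have b: "norm (f s) \<le> B m" if "s \<in> closed_segment ?p ?q" for s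
    proof -
      have "Re s = - X m" using that by (auto simp: closed_segment_same_Re)
      then show ?thesis using elim that by blast
    qed
    have "f contour_integrable_on linepath ?p ?q"
      by (rule contour_integrable_holomorphic_simple[OF holo])
         (use P in \<open>auto simp: closed_segment_same_Re\<close>)
    then have "norm (contour_integral (linepath ?p ?q) f) \<le> B m * norm (?q - ?p)"
      using order_trans[OF norm_ge_zero b[of ?p]] by (intro contour_integral_bound_linepath b) auto
    moreover have "norm (?q - ?p) = \<bar>y1 - y2\<bar>" by (simp add: cmod_def)
    ultimately show ?case by (simp only:)
  qed
qed

context Meijer_kernel
begin

text \<open>This is where the condition \<open>Re c > - n\<close> enters: a half-strip around all poles, left and right, fits into
  \<open>Re s < 1\<close>.\<close>
lemma strip_exists:
  obtains c h where "0 < c" "c < 1" "h > 0" "\<And>p. p \<in> poles \<Longrightarrow> Re p < c \<and> \<bar>Im p\<bar> < h"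
proof -
  define c0 where "c0 = Max (insert 0 ((\<lambda>c. 1 - Re c - real n) ` set a))"
  define h0 where "h0 = Max (insert 0 ((\<lambda>c. \<bar>Im c\<bar>) ` set a))"
  have "1 - Re c - real n < 1" if "c \<in> set a" for c using Re_a[OF that] by linarith
  then have c0: "c0 < 1" by (auto simp: c0_def)
  have c0': "c0 \<ge> 0" "\<And>c. c \<in> set a \<Longrightarrow> 1 - Re c - real n \<le> c0"
    unfolding c0_def by (auto intro!: Max_ge)
  have h0: "h0 \<ge> 0" "\<And>c. c \<in> set a \<Longrightarrow> \<bar>Im c\<bar> \<le> h0"
    unfolding h0_def by (auto intro!: Max_ge)
  show thesis
  proof (rule that[of "(c0 + 1) / 2" "h0 + 1"])
    fix p assume "p \<in> poles"
    then consider (left) c and l :: nat where "c \<in> set a" "p = 1 - c - of_nat n - of_nat l" | (right) i where "p = - of_nat i"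
      by (auto simp: poles_def left_poles_def right_poles_def)
    then show "Re p < (c0 + 1) / 2 \<and> \<bar>Im p\<bar> < h0 + 1"
    proof cases
      case left
      have "Re p = 1 - Re c - real n - real l" "Im p = - Im c" using left by simp_all
      then show ?thesis using c0 c0'(2)[OF left(1)] h0(2)[OF left(1)] by auto
    next
      case right
      then show ?thesis using c0' h0 by auto
    qed
  qed (use c0 c0' h0 in auto)
qed

lemma left_pole_Im_strip:
  assumes "\<And>p. p \<in> poles \<Longrightarrow> Re p < c \<and> \<bar>Im p\<bar> < h" "\<bar>y\<bar> = h" "d \<in> set a"
  shows "Im d + y \<noteq> 0"
proof -
  have "1 - d - of_nat n - of_nat 0 \<in> poles" using left_poleI[OF assms(3), of 0] unfolding poles_def by blast
  then have "\<bar>Im (1 - d - of_nat n - of_nat 0)\<bar> < h" using assms(1) by blast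
  then show ?thesis using assms(2) by auto
qed

text \<open>Pole-free vertical cut-off lines at \<open>- (X0 + m)\<close>, together with the decay of \<open>F\<close> on them and in the
  regions above, below and to the right of the poles, far from the origin. Large squares whose left side is a cut-off line have
  their boundary in this set.\<close>
definition F_bounded_on_lines :: "real \<Rightarrow> real \<Rightarrow> real \<Rightarrow> bool" where
  "F_bounded_on_lines X0 C V \<longleftrightarrow> X0 \<ge> 0 \<and> C > 0 \<and> V \<ge> 1 \<and>
     (\<forall>s (m::nat). Re s = - (X0 + real m) \<longrightarrow> s \<notin> poles) \<and>
     (\<forall>s. norm (of_nat n - 1 + s) \<ge> 2 * V \<longrightarrow>
        (\<exists>m::nat. Re s = - (X0 + real m)) \<or> \<bar>Im s\<bar> \<ge> V \<or> Re s \<ge> 1 \<longrightarrow>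
        norm (F s) \<le> C * norm (of_nat n - 1 + s) powr (- \<delta>))"

lemma F_bounded_on_linesD:
  assumes "F_bounded_on_lines X0 C V"
  shows "X0 \<ge> 0" "C > 0" "V \<ge> 1" "Re s = - (X0 + real m) \<Longrightarrow> s \<notin> poles"
    "norm (of_nat n - 1 + s) \<ge> 2 * V \<Longrightarrow> (\<exists>m::nat. Re s = - (X0 + real m)) \<or> \<bar>Im s\<bar> \<ge> V \<or> Re s \<ge> 1 \<Longrightarrow>
        norm (F s) \<le> C * norm (of_nat n - 1 + s) powr (- \<delta>)"
  using assms unfolding F_bounded_on_lines_def by blast+

lemma F_bounded_on_lines_exist:
  obtains X0 C V where "F_bounded_on_lines X0 C V"
proof -
  obtain X0 \<eta> where X0: "X0 \<ge> 0" "\<eta> > 0"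
    "\<And>s (m::nat). Re s = - (X0 + real m) \<Longrightarrow> s \<notin> poles \<and>
       (\<forall>c\<in>set a. norm (sin (of_real pi * (c + (of_nat n - 1 + s)))) \<ge> \<eta>)"
    using vertical_lines_exist by blast
  obtain C V where CV: "C > 0" "V \<ge> 1"
    "\<And>s u. u = of_nat n - 1 + s \<Longrightarrow> norm u \<ge> 2 * V \<Longrightarrow>
        \<bar>Im u\<bar> \<ge> V \<or> Re u \<ge> 0 \<or> (\<forall>c\<in>set a. norm (sin (of_real pi * (c + u))) \<ge> \<eta>) \<Longrightarrow>
        norm (F s) \<le> C * norm u powr (- \<delta>)"
    using F_bound[OF X0(2)] by metis
  have "F_bounded_on_lines X0 C V"
    unfolding F_bounded_on_lines_def
  proof (intro conjI allI impI)
    fix s assume u: "norm (of_nat n - 1 + s) \<ge> 2 * V"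
      and "(\<exists>m::nat. Re s = - (X0 + real m)) \<or> \<bar>Im s\<bar> \<ge> V \<or> Re s \<ge> 1"
    then have "\<bar>Im (of_nat n - 1 + s)\<bar> \<ge> V \<or> Re (of_nat n - 1 + s) \<ge> 0
        \<or> (\<forall>c\<in>set a. norm (sin (of_real pi * (c + (of_nat n - 1 + s)))) \<ge> \<eta>)"
      using X0(3) by auto
    then show "norm (F s) \<le> C * norm (of_nat n - 1 + s) powr (- \<delta>)"
      by (rule CV(3)[OF refl u])
  qed (use X0 CV in auto)
  then show thesis by (rule that)
qed

lemma F_continuous_on: "A \<inter> poles = {} \<Longrightarrow> continuous_on A F"
  by (rule continuous_on_subset[OF holomorphic_on_imp_continuous_on[OF F_holomorphic]]) auto

lemma F_continuous_on_ray:
  assumes "\<And>x. x \<le> B \<Longrightarrow> Complex x y \<notin> poles"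
  shows "continuous_on {..B} (\<lambda>x. F (Complex x y))"
  by (rule continuous_on_compose2[OF F_continuous_on[of "(\<lambda>x. Complex x y) ` {..B}"]])
     (use assms in \<open>auto intro!: continuous_intros simp: Complex_eq\<close>)

text \<open>For fixed \<open>t < 1\<close> the factor \<open>t powr (- s)\<close> decays exponentially to the left, so boundedness of \<open>F\<close>
  suffices here; the rate of its decay matters only after integrating over \<open>t\<close>.\<close>
lemma F_powr_ray_integrable:
  assumes t: "0 < t" "t < 1" and \<delta>: "\<delta> > 0"
    and avoid: "\<And>x. x \<le> B \<Longrightarrow> Complex x y \<notin> poles"
    and y: "\<And>c. c \<in> set a \<Longrightarrow> Im c + y \<noteq> 0"
  shows "set_integrable lborel {..B} (\<lambda>x. F (Complex x y) * of_real t powr (- Complex x y))"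
proof -
  obtain K M where KM: "K > 0" "M \<ge> 1" "\<And>x. x \<le> - M \<Longrightarrow> norm (F (Complex x y)) \<le> K * (- x) powr (- \<delta>)"
    using F_bound_horizontal[OF y \<delta>] by metis
  define L where "L = - ln t"
  have L: "L > 0" using t by (simp add: L_def)
  show ?thesis
  proof (rule set_integrable_ray[where p = 2 and M = M and K = "K * (2 / L\<^sup>2)"])
    have "continuous_on {..B} (\<lambda>x. of_real t powr (- Complex x y))"
      using t by (auto intro!: continuous_intros simp: Complex_eq)
    then show "continuous_on {..B} (\<lambda>x. F (Complex x y) * of_real t powr (- Complex x y))"
      by (intro continuous_on_mult F_continuous_on_ray avoid)
    fix x assume x: "x \<le> - M"
    have "norm (F (Complex x y)) \<le> K * 1"
      using KM(1,2) x \<delta> by (intro order_trans[OF KM(3)[OF x]] mult_left_mono powr_minus_le_one) auto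
    moreover have "norm (of_real t powr (- Complex x y) :: complex) = exp (L * x)"
      using t by (simp add: norm_of_real_powr powr_def L_def)
    moreover have "exp (L * x) \<le> 2 / L\<^sup>2 * (- x) powr (- 2)"
      using L KM(2) x by (intro exp_times_square_bound) auto
    ultimately have "norm (F (Complex x y) * of_real t powr (- Complex x y)) \<le> (K * 1) * (2 / L\<^sup>2 * (- x) powr (- 2))"
      unfolding norm_mult using KM(1) by (intro mult_mono) auto
    then show "norm (F (Complex x y) * of_real t powr (- Complex x y)) \<le> K * (2 / L\<^sup>2) * (- x) powr (- 2)"
      by (simp add: mult.assoc)
  qed simp
qed

lemma half_strip_avoids_poles:
  assumes h: "h > 0" and strip: "\<And>p. p \<in> poles \<Longrightarrow> Re p < c \<and> \<bar>Im p\<bar> < h"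
  shows "loop_image (half_strip c h) \<inter> poles = {}"
  using strip by (fastforce simp: loop_image_half_strip[OF h])

lemma half_strip_winding:
  assumes h: "h > 0" and strip: "\<And>p. p \<in> poles \<Longrightarrow> Re p < c \<and> \<bar>Im p\<bar> < h" 
    and p: "p \<in> poles" and X: "- X < c"
  shows "Re p > - X \<Longrightarrow> winding_number (loop_closure (half_strip c h) X) p = 1"
    and "Re p < - X \<Longrightarrow> winding_number (loop_closure (half_strip c h) X) p = 0"
  using strip[OF p] h X unfolding loop_closure_half_strip
  by (auto intro!: winding_number_rectpath winding_number_rectpath_outside
      simp: in_box_complex_iff in_cbox_complex_iff abs_less_iff)

lemma loop_closure_avoids_poles:
  assumes "loop_image g \<inter> P = {}" "\<And>s. Re s = - X \<Longrightarrow> s \<notin> P"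
    "- X \<le> Re (pathstart g)" "- X \<le> Re (pathfinish g)" "Im (pathstart g) < Im (pathfinish g)"
  shows "path_image (loop_closure g X) \<inter> P = {}"
proof -
  have "path_image g \<subseteq> loop_image g" by (auto simp: loop_image_def)
  then show ?thesis
    using path_image_loop_closure_subset[OF assms(3-5)] assms(1,2)
    by (fastforce simp: closed_segment_same_Re)
qed

text \<open>The integrand of the function \<open>G_hat\<close>.\<close>
definition powr_kernel :: "real \<Rightarrow> complex \<Rightarrow> complex" where
  "powr_kernel t s = F s * of_real t powr (- s)"

lemma powr_kernel_holomorphic: "t > 0 \<Longrightarrow> powr_kernel t holomorphic_on - poles"
  unfolding powr_kernel_def by (intro holomorphic_intros F_holomorphic) auto

lemma powr_kernel_closing_tendsto_0:
  assumes t: "0 < t" "t < 1" and \<delta>: "\<delta> > 0" and lines: "F_bounded_on_lines X0 C V"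
  shows "(\<lambda>m. contour_integral (linepath (Complex (- (X0 + real m)) y2) (Complex (- (X0 + real m)) y1)) (powr_kernel t))
           \<longlonglongrightarrow> 0"
proof (rule vertical_segment_integral_tendsto_0[OF powr_kernel_holomorphic[OF t(1)] closed_poles F_bounded_on_linesD(4)[OF lines],
      where B = "\<lambda>m. C * t powr (X0 + real m)"])
  note X0 = F_bounded_on_linesD(1)[OF lines] and C = F_bounded_on_linesD(2,3)[OF lines]
    and bound = F_bounded_on_linesD(5)[OF lines]
  have "(\<lambda>m. C * (t powr X0 * t ^ m)) \<longlonglongrightarrow> C * (t powr X0 * 0)"
    using t by (intro tendsto_intros LIMSEQ_power_zero) auto
  then show "(\<lambda>m. C * t powr (X0 + real m)) \<longlonglongrightarrow> 0"
    using t by (simp add: powr_add powr_realpow)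
  show "\<forall>\<^sub>F m in sequentially. \<forall>s. Re s = - (X0 + real m) \<longrightarrow>
      s \<in> closed_segment (Complex (- (X0 + real m)) y2) (Complex (- (X0 + real m)) y1) \<longrightarrow>
      norm (powr_kernel t s) \<le> C * t powr (X0 + real m)"
    using eventually_ge_at_top[of "nat \<lceil>2 * V + real n\<rceil>"]
  proof eventually_elim
    case (elim m)
    show ?case
    proof (intro allI impI)
      fix s assume s: "Re s = - (X0 + real m)"
      have m: "real m \<ge> 2 * V + real n" using elim by linarith
      have "norm (of_nat n - 1 + s) \<ge> 2 * V"
        using abs_Re_le_cmod[of "of_nat n - 1 + s"] s m X0 C(2) by simp
      moreover from this have "norm (F s) \<le> C * norm (of_nat n - 1 + s) powr (- \<delta>)"
        using s by (intro bound) auto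
      ultimately have "norm (F s) \<le> C * 1"
        using C \<delta> by (elim order_trans) (intro mult_left_mono powr_minus_le_one, auto)
      moreover have "norm (of_real t powr (- s) :: complex) = t powr (X0 + real m)"
        using t by (simp only: norm_of_real_powr uminus_complex.sel s minus_minus)
      ultimately show "norm (powr_kernel t s) \<le> C * t powr (X0 + real m)"
        unfolding powr_kernel_def norm_mult by (simp only:) (intro mult_right_mono; simp)
    qed
  qed
qed

text \<open>The last fact holds because a ray of the loop at the height of a left pole would contain all the
  translates of this pole by large negative integers.\<close>
lemma separating_left_loop_facts:
  assumes L: "separating_left_loop a n L"
  shows "valid_path L" "Im (pathstart L) < Im (pathfinish L)" "loop_image L \<inter> poles = {}"
    "\<And>p. p \<in> left_poles \<Longrightarrow> \<forall>\<^sub>F X in at_top. winding_number (loop_closure L X) p = 1"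
    "\<And>p. p \<in> right_poles \<Longrightarrow> \<forall>\<^sub>F X in at_top. winding_number (loop_closure L X) p = 0"
    "\<And>y B d. \<lbrakk>\<And>x. x \<le> B \<Longrightarrow> Complex x y \<in> loop_image L; d \<in> set a\<rbrakk> \<Longrightarrow> Im d + y \<noteq> 0"
proof -
  have left: "on_left L p" if "p \<in> left_poles" for p
    using that L by (auto simp: left_poles_def separating_left_loop_def)
  have right: "on_right L p" if p: "p \<in> right_poles" for p
  proof -
    obtain i where i: "p = - of_nat i" "i < n" using p by (auto simp: right_poles_def)
    have "p = 1 - of_nat n + of_nat (n - 1 - i)"
    proof -
      have "of_nat (n - 1 - i) = (of_nat n - 1 - of_nat i :: complex)" using i by (simp add: of_nat_diff)
      then show ?thesis using i by simp
    qed
    then show ?thesis using L unfolding separating_left_loop_def by metis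
  qed
  show "valid_path L" "Im (pathstart L) < Im (pathfinish L)"
    using L by (auto simp: separating_left_loop_def left_loop_def)
  show *: "loop_image L \<inter> poles = {}"
    using left right by (auto simp: poles_def on_left_def on_right_def)
  show "\<And>p. p \<in> left_poles \<Longrightarrow> \<forall>\<^sub>F X in at_top. winding_number (loop_closure L X) p = 1"
    "\<And>p. p \<in> right_poles \<Longrightarrow> \<forall>\<^sub>F X in at_top. winding_number (loop_closure L X) p = 0"
    using left right by (auto simp: on_left_def on_right_def)
  fix y B d assume ray: "\<And>x. x \<le> B \<Longrightarrow> Complex x y \<in> loop_image L" and d: "d \<in> set a"
  show "Im d + y \<noteq> 0"
  proof
    assume y: "Im d + y = 0"
    define l where "l = nat \<lceil>1 - Re d - real n - B\<rceil>"
    let ?p = "1 - d - of_nat n - of_nat l"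
    have "Re ?p \<le> B" by (simp add: l_def) linarith
    moreover have "?p = Complex (Re ?p) y" using y by (simp add: complex_eq_iff)
    ultimately have "?p \<in> loop_image L" using ray[of "Re ?p"] by simp
    moreover have "?p \<in> poles" using d left_poleI by (auto simp: poles_def)
    ultimately show False using * by auto
  qed
qed

lemma ray_in_loop_image:
  "x \<le> Re (pathstart g) \<Longrightarrow> Complex x (Im (pathstart g)) \<in> loop_image g"
  "x \<le> Re (pathfinish g) \<Longrightarrow> Complex x (Im (pathfinish g)) \<in> loop_image g"
  by (simp_all add: loop_image_def)

lemma powr_kernel_loop_closure_tendsto:
  assumes t: "0 < t" "t < 1" and \<delta>: "\<delta> > 0" and lines: "F_bounded_on_lines X0 C V"
    and g: "valid_path g" "Im (pathstart g) < Im (pathfinish g)" "loop_image g \<inter> poles = {}"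
    and rays: "\<And>d. d \<in> set a \<Longrightarrow> Im d + Im (pathstart g) \<noteq> 0" "\<And>d. d \<in> set a \<Longrightarrow> Im d + Im (pathfinish g) \<noteq> 0"
  shows "(\<lambda>m. contour_integral (loop_closure g (X0 + real m)) (powr_kernel t)) \<longlonglongrightarrow> loop_integral g (powr_kernel t)"
proof (rule loop_closure_integral_tendsto[OF g(1,2) powr_kernel_holomorphic[OF t(1)] closed_poles g(3)])
  show "\<And>m s. Re s = - (X0 + real m) \<Longrightarrow> s \<notin> poles" by (rule F_bounded_on_linesD(4)[OF lines])
  show "set_integrable lborel {..Re (pathstart g)} (\<lambda>x. powr_kernel t (Complex x (Im (pathstart g))))"
    unfolding powr_kernel_def
    by (rule F_powr_ray_integrable[OF t \<delta>]) (metis disjoint_iff g(3) ray_in_loop_image, metis rays)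
  show "set_integrable lborel {..Re (pathfinish g)} (\<lambda>x. powr_kernel t (Complex x (Im (pathfinish g))))"
    unfolding powr_kernel_def
    by (rule F_powr_ray_integrable[OF t \<delta>]) (metis disjoint_iff g(3) ray_in_loop_image, metis rays)
  show "filterlim (\<lambda>m. X0 + real m) at_top sequentially"
    by (rule filterlim_tendsto_add_at_top[OF tendsto_const filterlim_real_sequentially])
qed (rule powr_kernel_closing_tendsto_0[OF t \<delta> lines])

text \<open>The half-strip encloses the right poles as well, and this is the only difference to the given loop:
  both wind once around each left pole beyond the cut-off. So their integrals differ by the residues at
  the right poles.\<close>
theorem loop_integral_eq_half_strip:
  assumes L: "separating_left_loop a n L" and t: "0 < t" "t < 1" and \<delta>: "\<delta> > 0"
    and c: "0 < c" and h: "h > 0" and strip: "\<And>p. p \<in> poles \<Longrightarrow> Re p < c \<and> \<bar>Im p\<bar> < h"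
  shows "loop_integral L (powr_kernel t) = loop_integral (half_strip c h) (powr_kernel t)
     - 2 * pi * \<i> * (\<Sum>p\<in>right_poles. residue (powr_kernel t) p)"
proof -
  note L = separating_left_loop_facts[OF L]
  obtain X0 C V where lines: "F_bounded_on_lines X0 C V"
    using F_bounded_on_lines_exist by blast
  note XCV = F_bounded_on_linesD[OF lines]
  note tendsto = powr_kernel_loop_closure_tendsto[OF t \<delta> lines]
  have D: "(\<lambda>m. contour_integral (loop_closure (half_strip c h) (X0 + real m)) (powr_kernel t))
      \<longlonglongrightarrow> loop_integral (half_strip c h) (powr_kernel t)"
    using h left_pole_Im_strip[OF strip, of "- h"] left_pole_Im_strip[OF strip, of h] half_strip_avoids_poles[OF h strip] by (intro tendsto) auto
  have L_lim: "(\<lambda>m. contour_integral (loop_closure L (X0 + real m)) (powr_kernel t)) \<longlonglongrightarrow> loop_integral L (powr_kernel t)"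
    by (intro tendsto L(1-3)) (erule L(6)[rotated], erule ray_in_loop_image)+
  have "bounded (path_image L)" using L(1) by (rule bounded_valid_path_image)
  then obtain R where R: "\<And>s. s \<in> path_image L \<Longrightarrow> norm s \<le> R" by (auto simp: bounded_iff)
  have "\<forall>\<^sub>F m in sequentially. contour_integral (loop_closure (half_strip c h) (X0 + real m)) (powr_kernel t)
      - contour_integral (loop_closure L (X0 + real m)) (powr_kernel t)
      = 2 * pi * \<i> * (\<Sum>p\<in>right_poles. residue (powr_kernel t) p)"
    using eventually_ge_at_top[of "nat \<lceil>\<bar>R\<bar> + real n\<rceil>"]
  proof eventually_elim
    case (elim m)
    let ?X = "X0 + real m"
    have X: "?X \<ge> \<bar>R\<bar> + real n" "?X \<ge> 0" using elim XCV(1) by linarith+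
    have Re_L: "- ?X \<le> Re s" if "s \<in> path_image L" for s
      using R[OF that] abs_Re_le_cmod[of s] X by linarith
    have ends: "- ?X \<le> Re (pathstart L)" "- ?X \<le> Re (pathfinish L)"
      by (intro Re_L pathstart_in_path_image pathfinish_in_path_image)+
    have avoid: "Re p \<noteq> - ?X" if "p \<in> poles" for p using XCV(4)[of p m] that by auto
    have wD: "winding_number (loop_closure (half_strip c h) ?X) p = (if Re p > - ?X then 1 else 0)"
      if "p \<in> poles" for p
      using half_strip_winding[OF h strip that, of ?X] avoid[OF that] X(2) c by auto
    have wL: "winding_number (loop_closure L ?X) p = (if p \<in> right_poles then 0 else if Re p > - ?X then 1 else 0)"
      if p: "p \<in> poles" for p
    proof (cases "Re p > - ?X")
      case True
      have w: "winding_number (loop_closure L ?X) p = w" 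
        if "\<forall>\<^sub>F Y in at_top. winding_number (loop_closure L Y) p = w" for w
        by (rule loop_closure_winding_number_eventually[OF valid_path_imp_path[OF L(1)] ends _ True that])
           (use p L(3) in auto)
      show ?thesis
        using w[OF L(4)] w[OF L(5)] p True by (auto simp: poles_def)
    next
      case False
      then have "Re p < - ?X" using avoid[OF p] by linarith
      then have "winding_number (loop_closure L ?X) p = 0"
        by (intro loop_closure_winding_number_zero valid_path_imp_path L(1,2) Re_L)
      then show ?thesis using False by simp
    qed
    have Re_right: "Re p > - ?X" if p: "p \<in> right_poles" for p
    proof -
      obtain i where "p = - of_nat i" "i < n" using p by (auto simp: right_poles_def)
      then show ?thesis using X by auto
    qed
    show ?case
    proof (rule contour_integral_diff_eq_residues[OF powr_kernel_holomorphic[OF t(1)] finite_poles_ball])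
      show "path_image (loop_closure (half_strip c h) ?X) \<inter> poles = {}"
        by (rule loop_closure_avoids_poles[OF half_strip_avoids_poles[OF h strip]])
           (use XCV(4) X c h in auto)
      show "path_image (loop_closure L ?X) \<inter> poles = {}"
        by (rule loop_closure_avoids_poles[OF L(3)]) (use XCV(4) ends L(2) in auto)
      show "right_poles \<subseteq> poles" by (auto simp: poles_def)
      show "finite right_poles" by (simp add: right_poles_def)
      fix p
      show "p \<in> right_poles \<Longrightarrow> winding_number (loop_closure (half_strip c h) ?X) p = 1"
        using wD[of p] Re_right by (auto simp: poles_def)
      show "p \<in> right_poles \<Longrightarrow> winding_number (loop_closure L ?X) p = 0"
        using wL[of p] by (auto simp: poles_def)
      show "p \<in> poles - right_poles \<Longrightarrow> winding_number (loop_closure (half_strip c h) ?X) p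
          = winding_number (loop_closure L ?X) p"
        using wD[of p] wL[of p] by auto
    qed (use L(1) in auto)
  qed
  then have "(\<lambda>m. contour_integral (loop_closure (half_strip c h) (X0 + real m)) (powr_kernel t)
      - contour_integral (loop_closure L (X0 + real m)) (powr_kernel t))
      \<longlonglongrightarrow> 2 * pi * \<i> * (\<Sum>p\<in>right_poles. residue (powr_kernel t) p)"
    by (rule tendsto_eventually)
  with tendsto_diff[OF D L_lim] have "loop_integral (half_strip c h) (powr_kernel t) - loop_integral L (powr_kernel t)
      = 2 * pi * \<i> * (\<Sum>p\<in>right_poles. residue (powr_kernel t) p)"
    by (rule LIMSEQ_unique)
  then show ?thesis by (simp add: algebra_simps)
qed

end

section \<open>Residues and moments of the half-strip integral\<close>

lemma prod_nat_diff_eq_fact: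
  assumes "j < n"
  shows "(\<Prod>k\<in>{..<n} - {j}. of_nat k - of_nat j :: complex) = (-1) ^ j * fact j * fact (n - 1 - j)"
proof -
  have split: "{..<n} - {j} = {..<j} \<union> {j<..<n}" using assms by auto
  have fact: "(\<Prod>k<m. of_nat (Suc k) :: complex) = fact m" for m
    by (induction m) (simp_all add: mult.commute)
  have "(\<Prod>k\<in>{..<j}. of_nat k - of_nat j :: complex) = (-1) ^ j * fact j"
  proof -
    have "(\<Prod>k\<in>{..<j}. of_nat k - of_nat j :: complex) = (\<Prod>k<j. - of_nat (Suc k))"
      by (rule prod.reindex_bij_witness[of _ "\<lambda>k. j - Suc k" "\<lambda>k. j - Suc k"]) (auto simp: of_nat_diff)
    also have "\<dots> = (-1) ^ j * (\<Prod>k<j. of_nat (Suc k))"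
      by (simp add: prod_uminus del: of_nat_Suc)
    finally show ?thesis by (simp only: fact)
  qed
  moreover have "(\<Prod>k\<in>{j<..<n}. of_nat k - of_nat j :: complex) = fact (n - 1 - j)"
  proof -
    have "(\<Prod>k\<in>{j<..<n}. of_nat k - of_nat j :: complex) = (\<Prod>k<n - 1 - j. of_nat (Suc k))"
      by (rule prod.reindex_bij_witness[of _ "\<lambda>k. k + Suc j" "\<lambda>k. k - Suc j"]) (auto simp: of_nat_diff)
    then show ?thesis by (simp only: fact)
  qed
  ultimately show ?thesis
    unfolding split by (subst prod.union_disjoint) auto
qed

lemma of_nat_power_moment:
  shows "set_integrable lborel {0<..<1} (\<lambda>t. of_real t ^ m :: complex)"
    and "(LBINT t:{0<..<1}. of_real t ^ m :: complex) = 1 / (of_nat m + 1)"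
proof -
  have *: "(of_real t powr of_nat m :: complex) = of_real t ^ m" if "t \<in> {0<..<1}" for t :: real
    using that by (simp add: powr_nat')
  have "set_integrable lborel {0<..<1} (\<lambda>t. of_real t powr of_nat m :: complex)"
    by (rule powr_unit_interval_moment) simp
  then show "set_integrable lborel {0<..<1} (\<lambda>t. of_real t ^ m :: complex)"
    by (rule set_integrable_cong[THEN iffD1, rotated -1]) (use * in auto)
  have "(LBINT t:{0<..<1}. of_real t ^ m :: complex) = (LBINT t:{0<..<1}. of_real t powr of_nat m :: complex)"
    by (rule set_lebesgue_integral_cong) (use * in auto)
  also have "\<dots> = 1 / (of_nat m + 1)"
    by (rule powr_unit_interval_moment) simp
  finally show "(LBINT t:{0<..<1}. of_real t ^ m :: complex) = 1 / (of_nat m + 1)" .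
qed

context Meijer_kernel
begin

abbreviation \<phi> :: "nat \<Rightarrow> complex" where "\<phi> j \<equiv> Gamma_quotient a b (of_nat j)"

text \<open>The pole at \<open>- (n - 1 - j)\<close> comes from the factor of index \<open>j\<close> of the Pochhammer symbol and is simple.
  As \<open>t powr (- s)\<close> becomes a power of \<open>t\<close> there, the residues form a polynomial in \<open>t\<close>.\<close>
lemma residue_powr_kernel:
  assumes t: "t > 0" and j: "j < n"
  shows "residue (powr_kernel t) (- of_nat (n - 1 - j))
     = - ((-1) ^ j * \<phi> j / (fact j * fact (n - 1 - j)) * of_real t ^ (n - 1 - j))"
proof -
  define z :: complex where "z = - of_nat (n - 1 - j)"
  have z: "z = 1 + of_nat j - of_nat n" using j by (simp add: z_def of_nat_diff)
  define g where "g s = - (Gamma_quotient a b (of_nat n - 1 + s) * of_real t powr (- s)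
      / (\<Prod>k\<in>{..<n} - {j}. 1 - of_nat n - s + of_nat k))" for s
  define S where "S = - (left_poles \<union> (right_poles - {z}))"
  have "open S" unfolding S_def right_poles_def
    by (intro open_Compl closed_Un closed_left_poles) (auto intro: finite_imp_closed)
  moreover have zS: "z \<in> S"
  proof -
    have "n - 1 - j < n" using j by simp
    then have "z \<in> right_poles" unfolding z_def right_poles_def by blast
    then show ?thesis using left_right_disjoint by (auto simp: S_def)
  qed
  moreover have "g holomorphic_on S"
    unfolding g_def
  proof (intro holomorphic_intros)
    show "(\<lambda>s. Gamma_quotient a b (of_nat n - 1 + s)) holomorphic_on S"
      by (rule holomorphic_on_subset[OF Gamma_quotient_holomorphic]) (auto simp: S_def)
    fix s assume s: "s \<in> S"
    show "(\<Prod>k\<in>{..<n} - {j}. 1 - of_nat n - s + of_nat k) \<noteq> 0"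
    proof
      assume "(\<Prod>k\<in>{..<n} - {j}. 1 - of_nat n - s + of_nat k) = 0"
      then obtain k where k: "k < n" "k \<noteq> j" "1 - of_nat n - s + of_nat k = 0" by auto
      then have "s = - of_nat (n - 1 - k)" by (simp add: of_nat_diff algebra_simps)
      moreover have "n - 1 - k < n" "n - 1 - k \<noteq> n - 1 - j" using k j by auto
      ultimately have "s \<in> right_poles - {z}" by (auto simp: right_poles_def z_def)
      then show False using s by (auto simp: S_def)
    qed
  qed
  ultimately have "residue (\<lambda>w. g w / (w - z)) z = g z"
    by (rule residue_simple)
  moreover have "(\<lambda>w. g w / (w - z)) = powr_kernel t"
  proof
    fix w :: complex
    have "pochhammer (1 - of_nat n - w) n = (\<Prod>k<n. 1 - of_nat n - w + of_nat k)"
      by (simp add: pochhammer_prod atLeast0LessThan)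
    also have "\<dots> = (1 - of_nat n - w + of_nat j) * (\<Prod>k\<in>{..<n} - {j}. 1 - of_nat n - w + of_nat k)"
      using j by (subst prod.remove[of _ j]) auto
    also have "1 - of_nat n - w + of_nat j = - (w - z)" by (simp add: z)
    finally have poch: "pochhammer (1 - of_nat n - w) n = - (w - z) * (\<Prod>k\<in>{..<n} - {j}. 1 - of_nat n - w + of_nat k)" .
    have "- (x * y / q) / d = x / (- d * q) * y" for x y q d :: complex
      by (cases "q = 0"; cases "d = 0") (auto simp: field_simps)
    then show "g w / (w - z) = powr_kernel t w"
      unfolding powr_kernel_def F_def g_def poch .
  qed
  moreover have "g z = - ((-1) ^ j * \<phi> j / (fact j * fact (n - 1 - j)) * of_real t ^ (n - 1 - j))"
  proof -
    have "(\<Prod>k\<in>{..<n} - {j}. 1 - of_nat n - z + of_nat k) = (\<Prod>k\<in>{..<n} - {j}. of_nat k - of_nat j)"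
      by (intro prod.cong) (auto simp: z)
    moreover have "of_real t powr (- z) = (of_real t ^ (n - 1 - j) :: complex)"
      using t by (simp add: z_def powr_nat')
    moreover have "of_nat n - 1 + z = of_nat j" by (simp add: z)
    ultimately show ?thesis
      using j by (simp add: g_def prod_nat_diff_eq_fact divide_simps)
  qed
  ultimately show ?thesis by (simp add: z_def)
qed

lemma sum_residues_powr_kernel:
  assumes "t > 0"
  shows "(\<Sum>p\<in>right_poles. residue (powr_kernel t) p)
     = - (\<Sum>j<n. (-1) ^ j * \<phi> j / (fact j * fact (n - 1 - j)) * of_real t ^ (n - 1 - j))"
proof -
  have "right_poles = (\<lambda>j. - of_nat (n - 1 - j)) ` {..<n}"
  proof (intro equalityI subsetI)
    fix p assume "p \<in> right_poles"
    then obtain i where i: "p = - of_nat i" "i < n" by (auto simp: right_poles_def)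
    then have "i = n - 1 - (n - 1 - i)" "n - 1 - i < n" by auto
    with i show "p \<in> (\<lambda>j. - of_nat (n - 1 - j)) ` {..<n}" by (metis imageI lessThan_iff)
  next
    fix p :: complex assume "p \<in> (\<lambda>j. - of_nat (n - 1 - j)) ` {..<n}"
    then obtain j where "p = - of_nat (n - 1 - j)" "n - 1 - j < n" by fastforce
    then show "p \<in> right_poles" unfolding right_poles_def by blast
  qed
  moreover have "inj_on (\<lambda>j. - of_nat (n - 1 - j) :: complex) {..<n}"
    by (auto simp: inj_on_def)
  ultimately have "(\<Sum>p\<in>right_poles. residue (powr_kernel t) p) = (\<Sum>j<n. residue (powr_kernel t) (- of_nat (n - 1 - j)))"
    by (simp only: sum.reindex o_def)
  also have "\<dots> = (\<Sum>j<n. - ((-1) ^ j * \<phi> j / (fact j * fact (n - 1 - j)) * of_real t ^ (n - 1 - j)))"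
    by (intro sum.cong refl residue_powr_kernel assms) simp
  finally show ?thesis by (simp only: sum_negf)
qed

text \<open>Outside the half-strip the only pole of \<open>F s / (k + 1 - s)\<close> is \<open>k + 1\<close>. The integral over a
  large square around everything vanishes in the limit, as the integrand decays like
  \<open>|s| powr (- 1 - \<delta>)\<close>; so the half-strip picks up minus the residue at \<open>k + 1\<close>. This is Mellin inversion without
  an inversion theorem.\<close>
lemma half_strip_moment_integral:
  assumes \<delta>: "\<delta> > 0" and c: "0 < c" "c < 1" and h: "h > 0" 
    and strip: "\<And>p. p \<in> poles \<Longrightarrow> Re p < c \<and> \<bar>Im p\<bar> < h"
  shows "loop_integral (half_strip c h) (\<lambda>s. F s / (of_nat k + 1 - s)) = 2 * pi * \<i> * F (of_nat k + 1)"
proof -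
  define q :: complex where "q = of_nat k + 1"
  define f where "f s = F s / (q - s)" for s
  \<comment> \<open>the pole of \<open>f\<close> at \<open>q\<close> is the only one between the half-strip and the square\<close>
  define P where "P = insert q poles"
  obtain X0 C V where lines: "F_bounded_on_lines X0 C V"
    using F_bounded_on_lines_exist by blast
  note XCV = F_bounded_on_linesD[OF lines]
  define Y where "Y m = X0 + real m" for m
  have Y: "filterlim Y at_top sequentially"
    unfolding Y_def by (rule filterlim_tendsto_add_at_top[OF tendsto_const filterlim_real_sequentially])
  have q_notin: "q \<notin> poles" using strip[of q] c by (auto simp: q_def)
  have holo: "f holomorphic_on - P"
    unfolding f_def P_def by (intro holomorphic_intros holomorphic_on_subset[OF F_holomorphic]) auto
  have closedP: "closed P" unfolding P_def by (rule closed_insert[OF closed_poles])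
  have finP: "finite (P \<inter> ball 0 R)" for R
    by (rule finite_subset[of _ "insert q (poles \<inter> ball 0 R)"]) (auto simp: P_def finite_poles_ball)
  have avoid: "s \<notin> P" if "Re s = - Y m" for s m
    using that XCV(1) XCV(4)[of s m] by (auto simp: P_def Y_def q_def)
  have D_avoid: "loop_image (half_strip c h) \<inter> P = {}"
    using half_strip_avoids_poles[OF h strip] c by (auto simp: P_def loop_image_half_strip[OF h] q_def)
  have dist_q: "norm (q - s) \<ge> - Re s" for s
    using complex_Re_le_cmod[of "q - s"] by (simp add: q_def)
  have ray: "set_integrable lborel {..c} (\<lambda>x. f (Complex x y))" if y: "\<bar>y\<bar> = h" for y
  proof -
    obtain K M where KM: "K > 0" "M \<ge> 1" "\<And>x. x \<le> - M \<Longrightarrow> norm (F (Complex x y)) \<le> K * (- x) powr (- \<delta>)"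
      using F_bound_horizontal[OF left_pole_Im_strip[OF strip y] \<delta>] by metis
    show ?thesis
    proof (rule set_integrable_ray[where p = "1 + \<delta>" and M = M and K = K])
      have "Complex x y \<notin> P" if "x \<le> c" for x
      proof -
        have "Complex x y \<in> loop_image (half_strip c h)"
          using that y by (simp add: loop_image_half_strip[OF h])
        then show ?thesis using D_avoid by blast
      qed
      then show "continuous_on {..c} (\<lambda>x. f (Complex x y))"
        by (intro continuous_on_compose2[OF holomorphic_on_imp_continuous_on[OF holo]])
           (auto intro!: continuous_intros simp: Complex_eq)
      fix x assume x: "x \<le> - M"
      have "norm (f (Complex x y)) \<le> (K * (- x) powr (- \<delta>)) / (- x)"
        unfolding f_def norm_divide using KM x dist_q[of "Complex x y"] by (intro frac_le) auto
      also have "\<dots> = K * (- x) powr (- (1 + \<delta>))"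
        using KM(2) x by (simp add: powr_diff powr_minus powr_add field_simps)
      finally show "norm (f (Complex x y)) \<le> K * (- x) powr (- (1 + \<delta>))" .
    qed (use \<delta> in auto)
  qed
  have D: "(\<lambda>m. contour_integral (loop_closure (half_strip c h) (Y m)) f) \<longlonglongrightarrow> loop_integral (half_strip c h) f"
  proof (rule loop_closure_integral_tendsto[OF _ _ holo closedP D_avoid _ _ Y avoid])
    show "(\<lambda>m. contour_integral (linepath (Complex (- Y m) (Im (pathfinish (half_strip c h))))
              (Complex (- Y m) (Im (pathstart (half_strip c h))))) f) \<longlonglongrightarrow> 0"
    proof (rule vertical_segment_integral_tendsto_0[OF holo closedP avoid, where B = "\<lambda>m. C / Y m"])
      show "(\<lambda>m. C / Y m) \<longlonglongrightarrow> 0"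
        by (rule real_tendsto_divide_at_top[OF tendsto_const Y])
      show "\<forall>\<^sub>F m in sequentially. \<forall>s. Re s = - Y m \<longrightarrow> s \<in> closed_segment (Complex (- Y m) (Im (pathfinish (half_strip c h))))
          (Complex (- Y m) (Im (pathstart (half_strip c h)))) \<longrightarrow> norm (f s) \<le> C / Y m"
        using eventually_ge_at_top[of "nat \<lceil>2 * V + real n\<rceil>"]
      proof eventually_elim
        case (elim m)
        have m: "Y m \<ge> 2 * V + real n" using elim XCV(1) unfolding Y_def by linarith
        show ?case
        proof (intro allI impI)
          fix s assume s: "Re s = - Y m"
          have u: "norm (of_nat n - 1 + s) \<ge> 2 * V"
            using abs_Re_le_cmod[of "of_nat n - 1 + s"] s m XCV(3) by simp
          have "norm (F s) \<le> C * norm (of_nat n - 1 + s) powr (- \<delta>)"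
            using s by (intro XCV(5)[OF u]) (auto simp: Y_def)
          also have "\<dots> \<le> C * 1"
            using u XCV(2,3) \<delta> by (intro mult_left_mono powr_minus_le_one) auto
          finally show "norm (f s) \<le> C / Y m"
            unfolding f_def norm_divide using dist_q[of s] s m XCV(2,3) by (intro frac_le) auto
        qed
      qed
    qed
  qed (use h ray[of h] ray[of "- h"] in auto)
  define Q where "Q m = rectpath (Complex (- Y m) (- Y m)) (Complex (Y m) (Y m))" for m
  have big: "\<forall>\<^sub>F m in sequentially. Y m \<ge> B" for B
    using Y by (simp add: filterlim_at_top)
  have Q_image: "path_image (Q m) = {s. Re s \<in> {- Y m, Y m} \<and> Im s \<in> {- Y m..Y m} \<or> Im s \<in> {- Y m, Y m} \<and> Re s \<in> {- Y m..Y m}}"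
    if "Y m \<ge> 0" for m
    using that unfolding Q_def by (subst path_image_rectpath) auto
  have Q_avoid: "path_image (Q m) \<inter> P = {}" if "Y m > max h (real k + 1)" for m
  proof -
    have "s \<notin> P" if "s \<in> path_image (Q m)" for s
      using that \<open>Y m > max h (real k + 1)\<close> avoid[of s m] strip[of s] h c
      by (auto simp: Q_image P_def q_def abs_less_iff)
    then show ?thesis by auto
  qed
  have Q_lim: "(\<lambda>m. contour_integral (Q m) f) \<longlonglongrightarrow> 0"
  proof (rule Lim_null_comparison)
    have "(\<lambda>m. 16 * C * (Y m / 2) powr (- \<delta>)) \<longlonglongrightarrow> 16 * C * 0"
      using \<delta> filterlim_at_top_mult_tendsto_pos[OF tendsto_const[of "1/2"] _ Y]
      by (intro tendsto_mult tendsto_const tendsto_neg_powr) auto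
    then show "(\<lambda>m. 16 * C * (Y m / 2) powr (- \<delta>)) \<longlonglongrightarrow> 0" by simp
    \<comment> \<open>\<open>16 = 8 \<cdot> 2\<close>: the perimeter is \<open>8 Y\<close>, and \<open>1 / |q - s| \<le> 2 / Y\<close> on the square\<close>
    show "\<forall>\<^sub>F m in sequentially. norm (contour_integral (Q m) f) \<le> 16 * C * (Y m / 2) powr (- \<delta>)"
      using big[of "2 * real n + 2 * real k + 4 + 4 * V + h + 1"]
    proof eventually_elim
      case (elim m)
      then have Ym: "Y m \<ge> 2 * real n + 2 * real k + 4" "Y m \<ge> 4 * V" "Y m > h" "Y m > 0"
        using XCV(3) h by linarith+
      have "norm (f s) \<le> (C * (Y m / 2) powr (- \<delta>)) / (Y m / 2)" if s: "s \<in> path_image (Q m)" for s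
      proof -
        have s_big: "norm s \<ge> Y m" 
          using s Ym(4) abs_Re_le_cmod[of s] abs_Im_le_cmod[of s] by (auto simp: Q_image)
        have "norm s \<le> norm (of_nat n - 1 + s) + norm (1 - of_nat n :: complex)"
          using norm_triangle_ineq[of "of_nat n - 1 + s" "1 - of_nat n"] by simp
        moreover have "norm (1 - of_nat n :: complex) \<le> 1 + real n"
          using norm_triangle_ineq4[of 1 "of_nat n :: complex"] by simp
        ultimately have u: "norm (of_nat n - 1 + s) \<ge> Y m / 2" using s_big Ym(1) by linarith
        have "norm s \<le> norm (q - s) + norm q"
          using norm_triangle_ineq4[of q "q - s"] by (simp add: add.commute)
        moreover have "norm q = real k + 1" unfolding q_def by (metis norm_of_nat of_nat_Suc add.commute)
        ultimately have qs: "norm (q - s) \<ge> Y m / 2" using s_big Ym(1) by linarith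
        have "norm (F s) \<le> C * norm (of_nat n - 1 + s) powr (- \<delta>)"
          by (rule XCV(5)) (use u s Ym XCV(3) in \<open>auto simp: Q_image Y_def\<close>)
        also have "\<dots> \<le> C * (Y m / 2) powr (- \<delta>)"
          using XCV(2) u Ym(4) \<delta> by (intro mult_left_mono powr_mono2') auto
        finally show ?thesis
          unfolding f_def norm_divide using qs Ym(4) XCV(2) by (intro frac_le) auto
      qed
      moreover have "f contour_integrable_on Q m"
        by (rule contour_integrable_holomorphic_simple[OF holo]) (use Ym Q_avoid[of m] closedP in \<open>auto simp: Q_def\<close>)
      ultimately have "norm (contour_integral (Q m) f) \<le> 8 * Y m * ((C * (Y m / 2) powr (- \<delta>)) / (Y m / 2))"
        using contour_integral_square_bound[OF _ Ym(4)] unfolding Q_def by blast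
      also have "\<dots> = 16 * C * (Y m / 2) powr (- \<delta>)" using Ym(4) by (simp add: field_simps)
      finally show ?case .
    qed
  qed
  have "\<forall>\<^sub>F m in sequentially. contour_integral (Q m) f - contour_integral (loop_closure (half_strip c h) (Y m)) f
       = 2 * pi * \<i> * (\<Sum>p\<in>{q}. residue f p)"
    using big[of "real k + h + 2"]
  proof eventually_elim
    case (elim m)
    then have Ym: "Y m > real k + 1" "Y m > h" "Y m > 1" using h by linarith+
    show ?case
    proof (rule contour_integral_diff_eq_residues[OF holo finP])
      show "path_image (Q m) \<inter> P = {}" using Q_avoid[of m] Ym by auto
      show "path_image (loop_closure (half_strip c h) (Y m)) \<inter> P = {}"
        by (rule loop_closure_avoids_poles[OF D_avoid]) (use avoid[of _ m] Ym c h in auto)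
      show "{q} \<subseteq> P" by (simp add: P_def)
      have in_box: "p \<in> box (Complex (- Y m) (- Y m)) (Complex (Y m) (Y m))" 
        if "\<bar>Re p\<bar> < Y m" "\<bar>Im p\<bar> < Y m" for p
        using that by (auto simp: in_box_complex_iff abs_less_iff)
      fix p
      show "winding_number (Q m) p = 1" if "p \<in> {q}"
        unfolding Q_def using that Ym by (intro winding_number_rectpath in_box) (auto simp: q_def)
      show "winding_number (loop_closure (half_strip c h) (Y m)) p = 0" if "p \<in> {q}"
        unfolding loop_closure_half_strip using that Ym c h
        by (intro winding_number_rectpath_outside) (auto simp: q_def in_cbox_complex_iff)
      show "winding_number (Q m) p = winding_number (loop_closure (half_strip c h) (Y m)) p" if "p \<in> P - {q}"
      proof -
        have p: "p \<in> poles" using that by (auto simp: P_def)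
        have "Re p \<noteq> - Y m" using avoid[of p m] that by auto
        then consider "Re p > - Y m" | "Re p < - Y m" by linarith
        then show ?thesis
        proof cases
          case 1
          then have "winding_number (Q m) p = 1"
            unfolding Q_def using strip[OF p] Ym c by (intro winding_number_rectpath in_box) auto
          then show ?thesis using half_strip_winding(1)[OF h strip p _ 1] Ym c by simp
        next
          case 2
          then have "winding_number (Q m) p = 0"
            unfolding Q_def using Ym by (intro winding_number_rectpath_outside) (auto simp: in_cbox_complex_iff)
          then show ?thesis using half_strip_winding(2)[OF h strip p _ 2] Ym c by simp
        qed
      qed
    qed (auto simp: Q_def)
  qed
  then have "(\<lambda>m. contour_integral (Q m) f - contour_integral (loop_closure (half_strip c h) (Y m)) f)
      \<longlonglongrightarrow> 2 * pi * \<i> * (\<Sum>p\<in>{q}. residue f p)"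
    by (rule tendsto_eventually)
  with tendsto_diff[OF Q_lim D] have "0 - loop_integral (half_strip c h) f = 2 * pi * \<i> * (\<Sum>p\<in>{q}. residue f p)"
    by (rule LIMSEQ_unique)
  moreover have "residue f q = - F q"
  proof -
    have "residue (\<lambda>w. (- F w) / (w - q)) q = - F q"
      by (rule residue_simple[of "- poles"])
         (use closed_poles q_notin F_holomorphic in \<open>auto intro: holomorphic_on_minus\<close>)
    moreover have "(\<lambda>w. (- F w) / (w - q)) = f"
      by (rule ext) (simp add: f_def minus_divide_left[symmetric] minus_divide_right minus_diff_eq)
    ultimately show ?thesis by simp
  qed
  ultimately show ?thesis by (simp add: f_def[abs_def] q_def neg_eq_iff_add_eq_0 algebra_simps)
qed

end

section \<open>Moments of G\<close>

text \<open>Moments of \<open>t ^ k * (1 - t) ^ r\<close> satisfy this recurrence because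
  \<open>t ^ k * (1 - t) = t ^ k - t ^ (k + 1)\<close>. It is invariant under exchanging the two arguments, which yields both
  alternating sums and both difference formulas of the theorem from the same lemmas.\<close>
lemma alternating_binomial_of_difference_recurrence:
  fixes M :: "nat \<Rightarrow> nat \<Rightarrow> 'a::comm_ring_1"
  assumes rec: "\<And>k r. M k (Suc r) = M k r - M (Suc k) r"
  shows "M k r = (\<Sum>i\<le>r. of_nat (r choose i) * (-1) ^ i * M (k + i) 0)"
proof (induction r arbitrary: k)
  case (Suc r)
  let ?t = "\<lambda>i. (-1) ^ i * M (k + i) 0"
  have "(\<Sum>i\<le>Suc r. of_nat (Suc r choose i) * ?t i)
      = ?t 0 + (\<Sum>i\<le>r. of_nat (Suc r choose Suc i) * ?t (Suc i))"
    by (subst sum.atMost_Suc_shift) simp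
  also have "(\<Sum>i\<le>r. of_nat (Suc r choose Suc i) * ?t (Suc i))
      = (\<Sum>i\<le>r. of_nat (r choose i) * ?t (Suc i)) + (\<Sum>i\<le>r. of_nat (r choose Suc i) * ?t (Suc i))"
    by (simp add: sum.distrib[symmetric] ring_distribs)
  also have "?t 0 + \<dots> = (?t 0 + (\<Sum>i\<le>r. of_nat (r choose Suc i) * ?t (Suc i)))
      + (\<Sum>i\<le>r. of_nat (r choose i) * ?t (Suc i))"
    by (simp add: algebra_simps)
  also have "?t 0 + (\<Sum>i\<le>r. of_nat (r choose Suc i) * ?t (Suc i)) = (\<Sum>i\<le>Suc r. of_nat (r choose i) * ?t i)"
    by (subst sum.atMost_Suc_shift) simp
  also have "\<dots> = (\<Sum>i\<le>r. of_nat (r choose i) * ?t i)" by (simp add: binomial_eq_0)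
  also have "(\<Sum>i\<le>r. of_nat (r choose i) * ?t (Suc i)) = - (\<Sum>i\<le>r. of_nat (r choose i) * (-1) ^ i * M (Suc k + i) 0)"
    by (simp add: sum_negf[symmetric] algebra_simps)
  finally show ?case
    unfolding rec Suc.IH by (simp add: mult.assoc)
qed simp

text \<open>The partial fraction expansion of the reciprocal Pochhammer symbol. Its right-hand side solves the
  difference recurrence in \<open>x\<close>, so the preceding lemma applies.\<close>
lemma alternating_binomial_sum_inverse:
  fixes x :: complex
  assumes "\<And>i::nat. x + of_nat i \<noteq> 0"
  shows "(\<Sum>i\<le>r. of_nat (r choose i) * (-1) ^ i * (1 / (x + of_nat i))) = fact r / pochhammer x (Suc r)"
proof -
  define M where "M k r = fact r / pochhammer (x + of_nat k) (Suc r)" for k r :: nat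
  have "M k (Suc r) = M k r - M (Suc k) r" for k r
  proof -
    define z where "z = x + of_nat k"
    have nz: "z + of_nat i \<noteq> 0" for i using assms[of "k + i"] by (simp add: z_def add_ac)
    define P where "P = pochhammer (z + 1) r"
    have P: "P \<noteq> 0"
    proof
      assume "P = 0"
      then obtain i where "z + 1 = - of_nat i" by (auto simp: P_def pochhammer_eq_0_iff)
      then show False using nz[of "Suc i"] by (simp add: eq_neg_iff_add_eq_0 add_ac)
    qed
    define e where "e = z + 1 + of_nat r"
    have e: "e \<noteq> 0" "z \<noteq> 0" using nz[of "Suc r"] nz[of 0] by (simp_all add: e_def add_ac)
    have "pochhammer z (Suc r) = z * P" by (simp add: P_def pochhammer_rec)
    moreover have shifted: "pochhammer (z + 1) (Suc r) = P * e" by (simp add: P_def e_def pochhammer_Suc)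
    moreover have "pochhammer z (Suc (Suc r)) = z * (P * e)"
      unfolding pochhammer_rec[of z "Suc r"] shifted ..
    moreover have "fact (Suc r) = (e - z) * fact r" by (simp add: e_def)
    moreover have "(e - z) * f / (z * (P * e)) = f / (z * P) - f / (P * e)" for f
      using P e by (simp add: field_simps)
    moreover have "x + of_nat (Suc k) = z + 1" by (simp add: z_def)
    ultimately show ?thesis
      unfolding M_def z_def[symmetric] by (simp only:)
  qed
  from alternating_binomial_of_difference_recurrence[of M, OF this, of 0 r] show ?thesis
    by (simp add: M_def)
qed

lemma pochhammer_minus_of_nat:
  assumes "j \<le> N"
  shows "pochhammer (- of_nat N) j = ((-1) ^ j * fact N / fact (N - j) :: complex)"
  using assms
proof (induction j)
  case (Suc j)
  define d :: complex where "d = of_nat (N - j)"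
  have d: "d \<noteq> 0" "- of_nat N + of_nat j = - d" using Suc.prems by (simp_all add: d_def of_nat_diff)
  have "N - j = Suc (N - Suc j)" using Suc.prems by simp
  then have "fact (N - j) = d * fact (N - Suc j)" by (simp add: d_def)
  then show ?case
    using Suc d by (simp add: pochhammer_Suc)
qed simp

lemma pochhammer_quotient_plus_one:
  fixes z :: complex
  assumes "\<And>i. i \<le> j \<Longrightarrow> z + of_nat i \<noteq> 0"
  shows "pochhammer z j / pochhammer (z + 1) j = z / (z + of_nat j)"
proof -
  have "pochhammer (z + 1) j \<noteq> 0"
  proof
    assume "pochhammer (z + 1) j = 0"
    then obtain i where "i < j" "z + 1 = - of_nat i" by (auto simp: pochhammer_eq_0_iff)
    then show False using assms[of "Suc i"] by (simp add: eq_neg_iff_add_eq_0 add_ac)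
  qed
  moreover have "z * pochhammer (z + 1) j = pochhammer z j * (z + of_nat j)"
    using pochhammer_rec[of z j] pochhammer_Suc[of z j] by simp
  ultimately show ?thesis using assms[of j] by (simp add: field_simps)
qed

context Meijer_kernel
begin

lemma Gamma_prod_mult_pochhammer_prod:
  "Gamma_prod a * pochhammer_prod a j = Gamma_prod (shift a (of_nat j))"
proof -
  have "Gamma_prod cs * pochhammer_prod cs j = Gamma_prod (shift cs (of_nat j))"
    if "\<And>c. c \<in> set cs \<Longrightarrow> - c \<notin> \<nat>" for cs
    using that
  proof (induction cs)
    case (Cons c cs)
    have c: "c \<notin> \<int>\<^sub>\<le>\<^sub>0"
    proof
      assume "c \<in> \<int>\<^sub>\<le>\<^sub>0"
      then obtain k :: nat where "c = - of_nat k" by (auto elim!: nonpos_Ints_cases')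
      then show False using Cons.prems[of c] by auto
    qed
    then have "Gamma c \<noteq> 0" by (simp add: Gamma_eq_zero_iff)
    then have "Gamma (c + of_nat j) = Gamma c * pochhammer c j"
      using pochhammer_Gamma[OF c, of j] by simp
    with Cons show ?case by (simp add: Gamma_prod_def shift_def pochhammer_prod_def)
  qed (simp add: Gamma_prod_def shift_def pochhammer_prod_def)
  then show ?thesis using nonpole by blast
qed

lemma F_at_of_nat: "F (of_nat k + 1) = (-1) ^ n * \<phi> (n + k) * fact k / fact (n + k)"
proof -
  have "of_nat n - 1 + (of_nat k + 1) = (of_nat (n + k) :: complex)" 
    "1 - of_nat n - (of_nat k + 1) = (- of_nat (n + k) :: complex)" by simp_all
  then show ?thesis
    unfolding F_def by (simp only: pochhammer_minus_of_nat[of n "n + k"] le_add1 diff_add_inverse) (simp add: field_simps)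
qed

text \<open>The value of the \<open>k\<close>-th moment. The sum is the contribution of the residues at the right poles, the
  last term is \<open>F (k + 1)\<close>.\<close>
definition \<mu> :: "nat \<Rightarrow> complex" where
  "\<mu> k = (\<Sum>j<n. (-1) ^ j * \<phi> j / (fact j * fact (n - 1 - j)) / of_nat (n + k - j))
     + (-1) ^ n * \<phi> (n + k) * fact k / fact (n + k)"

text \<open>The value of the \<open>k\<close>-th moment with respect to powers of \<open>1 - t\<close>: up to sign, the \<open>(n + k)\<close>-th
  difference of \<open>\<phi>\<close> at 0 divided by \<open>pochhammer (k + 1) n\<close>.\<close>
definition \<nu> :: "nat \<Rightarrow> complex" where
  "\<nu> k = fact k * (\<Sum>j\<le>n + k. (-1) ^ j * \<phi> j / (fact j * fact (n + k - j)))"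

text \<open>The binomial combination of the residue contributions gives the terms with \<open>j < n\<close>, by the partial
  fraction expansion, and the combination of the values \<open>F (i + 1)\<close> gives the terms with \<open>j = n + i\<close>.\<close>
lemma \<nu>_eq_alternating_sum: "(\<Sum>i\<le>k. of_nat (k choose i) * (-1) ^ i * \<mu> i) = \<nu> k"
proof -
  let ?A = "\<lambda>j. (-1) ^ j * \<phi> j / (fact j * fact (n - 1 - j))"
  have 1: "(\<Sum>i\<le>k. of_nat (k choose i) * (-1) ^ i * (?A j / of_nat (n + i - j)))
       = fact k * ((-1) ^ j * \<phi> j / (fact j * fact (n + k - j)))" if j: "j < n" for j
  proof -
    have nz: "of_nat (n - j) + of_nat i \<noteq> (0 :: complex)" for i
      using j by (metis add_is_0 not_less of_nat_add of_nat_eq_0_iff diff_is_0_eq)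
    have shift: "of_nat (n + i - j) = (of_nat (n - j) + of_nat i :: complex)" for i
    proof -
      have "n + i - j = (n - j) + i" using j by simp
      then show ?thesis by (simp only: of_nat_add)
    qed
    have "fact (n + k - j) = (fact (n - 1 - j) * pochhammer (of_nat (n - j)) (Suc k) :: complex)"
    proof -
      have "n + k - j = (n - 1 - j) + Suc k" using j by simp
      then have "fact (n + k - j) = (pochhammer 1 ((n - 1 - j) + Suc k) :: complex)"
        by (simp only: pochhammer_fact)
      also have "\<dots> = pochhammer 1 (n - 1 - j) * pochhammer (1 + of_nat (n - 1 - j)) (Suc k)"
        by (rule pochhammer_product')
      also have "1 + of_nat (n - 1 - j) = (of_nat (Suc (n - 1 - j)) :: complex)" by (simp only: of_nat_Suc)
      also have "Suc (n - 1 - j) = n - j" using j by simp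
      finally show ?thesis by (simp only: pochhammer_fact)
    qed
    moreover have "(\<Sum>i\<le>k. of_nat (k choose i) * (-1) ^ i * (?A j / of_nat (n + i - j)))
        = ?A j * (\<Sum>i\<le>k. of_nat (k choose i) * (-1) ^ i * (1 / (of_nat (n - j) + of_nat i)))"
      unfolding shift by (simp add: sum_distrib_left mult_ac)
    ultimately show ?thesis
      unfolding alternating_binomial_sum_inverse[OF nz] by (simp add: mult_ac)
  qed
  have 2: "of_nat (k choose i) * (-1) ^ i * ((-1) ^ n * \<phi> (n + i) * fact i / fact (n + i))
      = fact k * ((-1) ^ (n + i) * \<phi> (n + i) / (fact (n + i) * fact (k - i)))" if "i \<le> k" for i
    using that by (simp add: binomial_fact power_add field_simps)
  have "(\<Sum>i\<le>k. of_nat (k choose i) * (-1) ^ i * \<mu> i)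
      = (\<Sum>i\<le>k. \<Sum>j<n. of_nat (k choose i) * (-1) ^ i * (?A j / of_nat (n + i - j)))
       + (\<Sum>i\<le>k. of_nat (k choose i) * (-1) ^ i * ((-1) ^ n * \<phi> (n + i) * fact i / fact (n + i)))"
    unfolding \<mu>_def distrib_left sum.distrib sum_distrib_left ..
  also have "(\<Sum>i\<le>k. \<Sum>j<n. of_nat (k choose i) * (-1) ^ i * (?A j / of_nat (n + i - j)))
      = (\<Sum>j<n. fact k * ((-1) ^ j * \<phi> j / (fact j * fact (n + k - j))))"
    by (subst sum.swap) (intro sum.cong refl 1; simp)
  also have "(\<Sum>i\<le>k. of_nat (k choose i) * (-1) ^ i * ((-1) ^ n * \<phi> (n + i) * fact i / fact (n + i)))
      = (\<Sum>i\<le>k. fact k * ((-1) ^ (n + i) * \<phi> (n + i) / (fact (n + i) * fact (k - i))))"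
    by (intro sum.cong refl 2) simp
  also have "\<dots> = (\<Sum>j\<in>{n..n + k}. fact k * ((-1) ^ j * \<phi> j / (fact j * fact (n + k - j))))"
    by (rule sum.reindex_bij_witness[of _ "\<lambda>j. j - n" "\<lambda>i. n + i"]) auto
  also have "(\<Sum>j<n. fact k * ((-1) ^ j * \<phi> j / (fact j * fact (n + k - j)))) + \<dots>
      = (\<Sum>j\<in>{..<n} \<union> {n..n + k}. fact k * ((-1) ^ j * \<phi> j / (fact j * fact (n + k - j))))"
    by (subst sum.union_disjoint) auto
  also have "{..<n} \<union> {n..n + k} = {..n + k}" by auto
  finally show ?thesis by (simp add: \<nu>_def sum_distrib_left)
qed

lemma \<mu>_eq_hypergeometric:
  "\<mu> k = (if n = 0 then 0
         else Gamma_prod a / (of_nat (n + k) * fact (n - 1)) *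
              hyp_div_Gamma (n - 1) ([- of_nat n - of_nat k, - of_nat n + 1] @ a)
                [- of_nat n - of_nat k + 1] b 1)
        + (-1) ^ n * Gamma_prod (shift a (of_nat (n + k))) * fact k /
          (Gamma_prod (shift b (of_nat (n + k))) * fact (n + k))"
proof -
  have "Gamma_prod a / (of_nat (n + k) * fact (n - 1)) *
              hyp_div_Gamma (n - 1) ([- of_nat n - of_nat k, - of_nat n + 1] @ a)
                [- of_nat n - of_nat k + 1] b 1
      = (\<Sum>j<n. (-1) ^ j * \<phi> j / (fact j * fact (n - 1 - j)) / of_nat (n + k - j))" if n: "n \<noteq> 0"
  proof -
    define z :: complex where "z = - of_nat n - of_nat k"
    have nk: "of_nat (n + k) \<noteq> (0 :: complex)" using n by (simp del: of_nat_add)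
    have "Gamma_prod a / (of_nat (n + k) * fact (n - 1)) *
        (pochhammer_prod ([z, - of_nat n + 1] @ a) j / (pochhammer_prod [z + 1] j * Gamma_prod (shift b (of_nat j)))
             * 1 ^ j / fact j)
       = (-1) ^ j * \<phi> j / (fact j * fact (n - 1 - j)) / of_nat (n + k - j)" if j: "j \<le> n - 1" for j
    proof -
      have zi: "z + of_nat i = - of_nat (n + k - i)" if "i \<le> j" for i
        using that j n by (simp add: z_def of_nat_diff)
      have nz: "z + of_nat i \<noteq> 0" if "i \<le> j" for i
      proof -
        have "n + k - i \<noteq> 0" using that j n by simp
        then show ?thesis unfolding zi[OF that] neg_equal_0_iff_equal of_nat_eq_0_iff .
      qed
      have q: "pochhammer z j / pochhammer (z + 1) j = of_nat (n + k) / of_nat (n + k - j)"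
      proof -
        have "pochhammer z j / pochhammer (z + 1) j = z / (z + of_nat j)"
          by (intro pochhammer_quotient_plus_one nz)
        moreover have "z = - of_nat (n + k)" by (simp add: z_def)
        ultimately show ?thesis unfolding zi[OF order_refl] by (simp only: minus_divide_divide)
      qed
      have p: "pochhammer (- of_nat n + 1) j = ((-1) ^ j * fact (n - 1) / fact (n - 1 - j) :: complex)"
      proof -
        have "- of_nat n + 1 = (- of_nat (n - 1) :: complex)" using n by (simp add: of_nat_diff)
        then show ?thesis using pochhammer_minus_of_nat[OF j] by simp
      qed
      have "pochhammer_prod ([z, - of_nat n + 1] @ a) j = pochhammer z j * pochhammer (- of_nat n + 1) j * pochhammer_prod a j"
        "pochhammer_prod [z + 1] j = pochhammer (z + 1) j"
        by (simp_all add: pochhammer_prod_def)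
      then have "Gamma_prod a / (of_nat (n + k) * fact (n - 1)) *
          (pochhammer_prod ([z, - of_nat n + 1] @ a) j / (pochhammer_prod [z + 1] j * Gamma_prod (shift b (of_nat j)))
             * 1 ^ j / fact j)
         = (pochhammer z j / pochhammer (z + 1) j) / of_nat (n + k) * (pochhammer (- of_nat n + 1) j / fact (n - 1))
           * (Gamma_prod a * pochhammer_prod a j / Gamma_prod (shift b (of_nat j))) / fact j"
        by (simp add: divide_simps)
      also have "\<dots> = (-1) ^ j * \<phi> j / (fact j * fact (n - 1 - j)) / of_nat (n + k - j)"
      proof -
        have "(X / Y) / X * (s * f / f' / f) * Q / f'' = s * Q / (f'' * f') / Y"
          if "X \<noteq> 0" "f \<noteq> 0" for X Y s f f' f'' Q :: complex
          using that by simp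
        from this[OF nk fact_nonzero] show ?thesis
          unfolding q p Gamma_prod_mult_pochhammer_prod Gamma_quotient_def .
      qed
      finally show ?thesis .
    qed
    then have "Gamma_prod a / (of_nat (n + k) * fact (n - 1)) * hyp_div_Gamma (n - 1) ([z, - of_nat n + 1] @ a) [z + 1] b 1
      = (\<Sum>j\<le>n - 1. (-1) ^ j * \<phi> j / (fact j * fact (n - 1 - j)) / of_nat (n + k - j))"
      unfolding hyp_div_Gamma_def sum_distrib_left by (intro sum.cong) auto
    moreover have "{..n - 1} = {..<n}" using n by auto
    ultimately show ?thesis by (simp add: z_def)
  qed
  then show ?thesis
    by (auto simp: \<mu>_def Gamma_quotient_def)
qed

lemma \<nu>_eq_hypergeometric:
  "\<nu> k = Gamma_prod a * fact k / fact (n + k) * hyp_div_Gamma (n + k) ([- of_nat n - of_nat k] @ a) [] b 1"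
proof -
  have "Gamma_prod a * fact k / fact (n + k) *
      (pochhammer_prod ([- of_nat n - of_nat k] @ a) j / (pochhammer_prod [] j * Gamma_prod (shift b (of_nat j))) * 1 ^ j / fact j)
     = fact k * ((-1) ^ j * \<phi> j / (fact j * fact (n + k - j)))" if j: "j \<le> n + k" for j
  proof -
    have "- of_nat n - of_nat k = (- of_nat (n + k) :: complex)" by simp
    then have p: "pochhammer (- of_nat n - of_nat k) j = ((-1) ^ j * fact (n + k) / fact (n + k - j) :: complex)"
      using pochhammer_minus_of_nat[OF j] by (simp only:)
    have "pochhammer_prod ([- of_nat n - of_nat k] @ a) j = pochhammer (- of_nat n - of_nat k) j * pochhammer_prod a j"
      "pochhammer_prod [] j = 1" by (simp_all add: pochhammer_prod_def)
    then have "Gamma_prod a * fact k / fact (n + k) *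
        (pochhammer_prod ([- of_nat n - of_nat k] @ a) j / (pochhammer_prod [] j * Gamma_prod (shift b (of_nat j))) * 1 ^ j / fact j)
       = fact k / fact (n + k) * pochhammer (- of_nat n - of_nat k) j
          * (Gamma_prod a * pochhammer_prod a j / Gamma_prod (shift b (of_nat j))) / fact j"
      by (simp add: divide_simps)
    also have "\<dots> = fact k * ((-1) ^ j * \<phi> j / (fact j * fact (n + k - j)))"
      unfolding p Gamma_prod_mult_pochhammer_prod Gamma_quotient_def by (simp add: divide_simps)
    finally show ?thesis .
  qed
  then show ?thesis
    unfolding hyp_div_Gamma_def \<nu>_def sum_distrib_left by (intro sum.cong) auto
qed

text \<open>The loop avoids the points \<open>1 - n + k\<close>, so on it the quotient of Gamma functions really is the
  reciprocal Pochhammer symbol.\<close>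
lemma G_hat_eq_powr_kernel:
  assumes L: "separating_left_loop a n L"
  shows "G_hat L a b n t = 1 / (2 * of_real pi * \<i>) * loop_integral L (powr_kernel t)"
  unfolding G_hat_def
proof (rule arg_cong[where f = "\<lambda>x. 1 / (2 * of_real pi * \<i>) * x"], rule loop_integral_cong)
  fix s assume s: "s \<in> loop_image L"
  have "1 - of_nat n - s \<notin> \<int>\<^sub>\<le>\<^sub>0"
  proof
    assume "1 - of_nat n - s \<in> \<int>\<^sub>\<le>\<^sub>0"
    then obtain k :: nat where "1 - of_nat n - s = - of_nat k" by (auto elim!: nonpos_Ints_cases')
    then have "s = 1 - of_nat n + of_nat k" by (simp add: algebra_simps)
    moreover have "1 - of_nat n + of_nat k \<notin> loop_image L"
      using L by (auto simp: separating_left_loop_def on_right_def)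
    ultimately show False using s by simp
  qed
  then have "Gamma (1 - of_nat n - s) \<noteq> 0" "pochhammer (1 - of_nat n - s) n = Gamma (1 - s) / Gamma (1 - of_nat n - s)"
    using pochhammer_Gamma[of "1 - of_nat n - s" n] by (auto simp: Gamma_eq_zero_iff)
  then show "Gamma_prod (shift a (of_nat n - 1 + s)) * Gamma (1 - of_nat n - s) /
       (Gamma_prod (shift b (of_nat n - 1 + s)) * Gamma (1 - s)) * of_real t powr (- s) = powr_kernel t s"
    by (simp add: powr_kernel_def F_def Gamma_quotient_def)
qed

text \<open>Deforming the loop makes the moments accessible: the half-strip integral has the moments
  \<open>F (k + 1)\<close>, and the residues add a polynomial. Over the given loop itself Fubini's theorem may fail, since
  it may run through the half plane \<open>Re s \<ge> k + 1\<close>.\<close>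
lemma G_hat_moments:
  assumes L: "separating_left_loop a n L" and \<delta>: "\<delta> > 0"
  shows "set_integrable lborel {0<..<1} (\<lambda>t. G_hat L a b n t * of_real t ^ k)"
    and "(LBINT t:{0<..<1}. G_hat L a b n t * of_real t ^ k) = \<mu> k"
proof -
  obtain c h where c: "0 < c" "c < 1" and h: "h > 0" and strip: "\<And>p. p \<in> poles \<Longrightarrow> Re p < c \<and> \<bar>Im p\<bar> < h"
    using strip_exists by metis
  define A where "A j = (-1) ^ j * \<phi> j / (fact j * fact (n - 1 - j))" for j
  define I where "I t = loop_integral (half_strip c h) (\<lambda>s. F s * of_real t powr (- s))" for t
  define T where "T t = 1 / (2 * of_real pi * \<i>) * (I t * of_real t ^ k) + (\<Sum>j<n. A j * of_real t ^ (n - 1 - j + k))" for t :: real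
  have G_T: "G_hat L a b n t * of_real t ^ k = T t" if t: "t \<in> {0<..<1}" for t
  proof -
    have kernel: "powr_kernel t = (\<lambda>s. F s * of_real t powr (- s))" by (rule ext) (simp add: powr_kernel_def)
    have "loop_integral L (powr_kernel t) = I t + 2 * pi * \<i> * (\<Sum>j<n. A j * of_real t ^ (n - 1 - j))"
      using loop_integral_eq_half_strip[OF L _ _ \<delta> c(1) h strip, of t] sum_residues_powr_kernel[of t] t
      by (simp add: I_def A_def kernel)
    then have "G_hat L a b n t = 1 / (2 * of_real pi * \<i>) * I t + (\<Sum>j<n. A j * of_real t ^ (n - 1 - j))"
      unfolding G_hat_eq_powr_kernel[OF L] by (simp add: distrib_left)
    moreover have "(\<Sum>j<n. A j * of_real t ^ (n - 1 - j)) * of_real t ^ k = (\<Sum>j<n. A j * of_real t ^ (n - 1 - j + k))"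
      by (simp only: sum_distrib_right power_add mult.assoc)
    ultimately show ?thesis by (simp only: T_def distrib_right mult.assoc)
  qed
  have rays: "set_integrable lborel {..c} (\<lambda>x. norm (F (Complex x y)) / (1 - x))" if y: "\<bar>y\<bar> = h" for y
  proof -
    obtain K M where KM: "K > 0" "M \<ge> 1" "\<And>x. x \<le> - M \<Longrightarrow> norm (F (Complex x y)) \<le> K * (- x) powr (- \<delta>)"
      using F_bound_horizontal[OF left_pole_Im_strip[OF strip y] \<delta>] by metis
    show ?thesis
    proof (rule set_integrable_ray[where p = "1 + \<delta>" and M = M and K = K])
      have "Complex x y \<notin> poles" if "x \<le> c" for x
      proof -
        have "Complex x y \<in> loop_image (half_strip c h)" using that y by (simp add: loop_image_half_strip[OF h])
        then show ?thesis using half_strip_avoids_poles[OF h strip] by blast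
      qed
      then show "continuous_on {..c} (\<lambda>x. norm (F (Complex x y)) / (1 - x))"
        using c by (intro continuous_intros F_continuous_on_ray) auto
      fix x assume x: "x \<le> - M"
      have "norm (norm (F (Complex x y)) / (1 - x)) \<le> (K * (- x) powr (- \<delta>)) / (- x)"
        unfolding norm_divide using KM x by (intro frac_le) auto
      also have "\<dots> = K * (- x) powr (- (1 + \<delta>))"
        using KM(2) x by (simp add: powr_diff powr_minus powr_add field_simps)
      finally show "norm (norm (F (Complex x y)) / (1 - x)) \<le> K * (- x) powr (- (1 + \<delta>))" .
    qed (use \<delta> in auto)
  qed
  note I = half_strip_loop_moment[OF h c(2) F_continuous_on[OF half_strip_avoids_poles[OF h strip]] rays, of k, folded I_def]
  have int_I: "set_integrable lborel {0<..<1} (\<lambda>t. 1 / (2 * of_real pi * \<i>) * (I t * of_real t ^ k))"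
    by (rule set_integrable_mult_right[OF I(1)])
  have int_A: "set_integrable lborel {0<..<1} (\<lambda>t. A j * of_real t ^ (n - 1 - j + k))" for j
    by (rule set_integrable_mult_right[OF of_nat_power_moment(1)])
  have int_S: "set_integrable lborel {0<..<1} (\<lambda>t. \<Sum>j<n. A j * of_real t ^ (n - 1 - j + k))"
    unfolding set_integrable_def scaleR_sum_right
    by (intro Bochner_Integration.integrable_sum int_A[unfolded set_integrable_def])
  have "set_integrable lborel {0<..<1} T"
    unfolding T_def by (rule set_integral_add(1)[OF int_I int_S])
  then show "set_integrable lborel {0<..<1} (\<lambda>t. G_hat L a b n t * of_real t ^ k)"
    by (rule set_integrable_cong[THEN iffD1, rotated -1]) (use G_T in auto)
  have "(LBINT t:{0<..<1}. G_hat L a b n t * of_real t ^ k) = (LBINT t:{0<..<1}. T t)"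
    by (rule set_lebesgue_integral_cong) (use G_T in auto)
  also have "\<dots> = (LBINT t:{0<..<1}. 1 / (2 * of_real pi * \<i>) * (I t * of_real t ^ k))
      + (LBINT t:{0<..<1}. \<Sum>j<n. A j * of_real t ^ (n - 1 - j + k))"
    unfolding T_def by (rule set_integral_add(2)[OF int_I int_S])
  also have "(LBINT t:{0<..<1}. 1 / (2 * of_real pi * \<i>) * (I t * of_real t ^ k)) = F (of_nat k + 1)"
    using I(2) half_strip_moment_integral[OF \<delta> c h strip, of k] by simp
  also have "(LBINT t:{0<..<1}. \<Sum>j<n. A j * of_real t ^ (n - 1 - j + k)) = (\<Sum>j<n. A j / of_nat (n + k - j))"
  proof -
    have "(LBINT t:{0<..<1}. \<Sum>j<n. A j * of_real t ^ (n - 1 - j + k))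
        = (\<Sum>j<n. LBINT t:{0<..<1}. A j * of_real t ^ (n - 1 - j + k))"
      unfolding set_lebesgue_integral_def scaleR_sum_right
      by (intro Bochner_Integration.integral_sum int_A[unfolded set_integrable_def])
    also have "\<dots> = (\<Sum>j<n. A j / of_nat (n + k - j))"
    proof (intro sum.cong refl)
      fix j assume "j \<in> {..<n}"
      then have "n + k - j = Suc (n - 1 - j + k)" by auto
      then have "of_nat (n - 1 - j + k) + 1 = (of_nat (n + k - j) :: complex)" by simp
      then show "(LBINT t:{0<..<1}. A j * of_real t ^ (n - 1 - j + k)) = A j / of_nat (n + k - j)"
        using of_nat_power_moment(2)[of "n - 1 - j + k"] by simp
    qed
    finally show ?thesis .
  qed
  finally show "(LBINT t:{0<..<1}. G_hat L a b n t * of_real t ^ k) = \<mu> k"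
    by (simp add: F_at_of_nat \<mu>_def A_def)
qed

end

lemma mixed_moments:
  fixes g :: "real \<Rightarrow> complex"
  assumes int: "\<And>k. set_integrable lborel {0<..<1} (\<lambda>t. g t * of_real t ^ k)"
  defines "M k r \<equiv> LBINT t:{0<..<1}. g t * of_real (1 - t) ^ r * of_real t ^ k"
  shows mixed_moment_integrable: "set_integrable lborel {0<..<1} (\<lambda>t. g t * of_real (1 - t) ^ r * of_real t ^ k)"
    and mixed_moment_rec: "M k (Suc r) = M k r - M (Suc k) r"
proof -
  have eq: "g t * of_real (1 - t) ^ Suc r * of_real t ^ k
      = g t * of_real (1 - t) ^ r * of_real t ^ k - g t * of_real (1 - t) ^ r * of_real t ^ Suc k" for t k r
    by (simp add: algebra_simps)
  have int': "set_integrable lborel {0<..<1} (\<lambda>t. g t * of_real (1 - t) ^ r * of_real t ^ k)" for k r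
  proof (induction r arbitrary: k)
    case 0
    then show ?case using int[of k] by simp
  next
    case (Suc r)
    show ?case unfolding eq by (intro set_integral_diff Suc.IH)
  qed
  then show "set_integrable lborel {0<..<1} (\<lambda>t. g t * of_real (1 - t) ^ r * of_real t ^ k)" .
  show "M k (Suc r) = M k r - M (Suc k) r"
    unfolding M_def eq by (intro set_integral_diff int')
qed

lemma fdiff_power_of_recurrence:
  assumes rec: "\<And>k r. M k (Suc r) = M k r - M (Suc k) r"
  shows "(-1) ^ r * (fdiff ^^ r) (\<lambda>k. M k 0) k = M k r"
proof -
  have "(fdiff ^^ r) (\<lambda>k. M k 0) = (\<lambda>k. (-1) ^ r * M k r)"
  proof (induction r)
    case (Suc r)
    have "(fdiff ^^ Suc r) (\<lambda>k. M k 0) = fdiff (\<lambda>k. (-1) ^ r * M k r)" by (simp add: Suc.IH)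
    also have "\<dots> = (\<lambda>k. (-1) ^ Suc r * M k (Suc r))" by (simp add: fdiff_def fun_eq_iff rec algebra_simps)
    finally show ?case .
  qed simp
  then show ?thesis by (simp add: power_mult_distrib[symmetric] mult.assoc[symmetric])
qed

theorem proposition6:
  fixes p n :: nat and a b :: "complex list" and \<psi> :: complex and L :: "real \<Rightarrow> complex"
    and G :: "real \<Rightarrow> complex" and m m_hat :: "nat \<Rightarrow> complex"
  assumes "p \<ge> 1" and "length a = p" and "length b = p"
    and "\<forall>c\<in>set a. - c \<notin> \<nat>"
    and "\<psi> = (\<Sum>i<p. b ! i - a ! i)"
    and "real n > - Min (insert (Re \<psi>) (Re ` set a))"
    and "separating_left_loop a n L"
    and "G = G_hat L a b n"
    and "m = moment G"
    and "m_hat = moment1 G"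
  shows
    "(\<forall>k r. set_integrable lborel {0<..<1} (\<lambda>t. G t * of_real (1 - t) ^ r * of_real t ^ k)) \<and>
     (\<forall>k. m k =
        (if n = 0 then 0
         else Gamma_prod a / (of_nat (n + k) * fact (n - 1)) *
              hyp_div_Gamma (n - 1) ([- of_nat n - of_nat k, - of_nat n + 1] @ a)
                [- of_nat n - of_nat k + 1] b 1)
        + (-1) ^ n * Gamma_prod (shift a (of_nat (n + k))) * fact k /
          (Gamma_prod (shift b (of_nat (n + k))) * fact (n + k))) \<and>
     (\<forall>k. m_hat k =
        Gamma_prod a * fact k / fact (n + k) *
        hyp_div_Gamma (n + k) ([- of_nat n - of_nat k] @ a) [] b 1) \<and>
     (\<forall>k r.
        (-1) ^ r * (fdiff ^^ r) m k = (-1) ^ k * (fdiff ^^ k) m_hat r \<and>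
        (-1) ^ k * (fdiff ^^ k) m_hat r =
          (LBINT t:{0<..<1}. G t * of_real (1 - t) ^ r * of_real t ^ k) \<and>
        (LBINT t:{0<..<1}. G t * of_real (1 - t) ^ r * of_real t ^ k) =
          Gamma_prod a * (\<Sum>j\<le>k. of_nat (k choose j) * ((-1) ^ j * fact (r + j) / fact (n + r + j)) *
            hyp_div_Gamma (n + r + j) ([- of_nat n - of_nat r - of_nat j] @ a) [] b 1))"
proof -
  have large: "real n > - x" if "x \<in> insert (Re \<psi>) (Re ` set a)" for x
  proof -
    have "Min (insert (Re \<psi>) (Re ` set a)) \<le> x" using that by (intro Min_le) auto
    then show ?thesis using assms(6) by linarith
  qed
  interpret Meijer_kernel a b n
  proof
    show "length a = length b" using assms(2,3) by simp
    show "- c \<notin> \<nat>" if "c \<in> set a" for c using assms(4) that by blast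
    show "Re c > - real n" if "c \<in> set a" for c using large[of "Re c"] that by auto
  qed
  have "\<psi> = sum_list b - sum_list a"
    unfolding assms(5) sum_list_sum_nth assms(2,3) atLeast0LessThan by (rule sum_subtractf)
  then have \<delta>: "\<delta> > 0" using large[of "Re \<psi>"] by (simp add: \<delta>_def)
  note G_int = G_hat_moments(1)[OF assms(7) \<delta>, folded assms(8)]
  define M where "M k r = (LBINT t:{0<..<1}. G t * of_real (1 - t) ^ r * of_real t ^ k)" for k r
  have rec: "M k (Suc r) = M k r - M (Suc k) r" for k r
    unfolding M_def by (rule mixed_moment_rec[OF G_int])
  have rec': "M (Suc k) r = M k r - M k (Suc r)" for k r
    by (simp add: rec)
  have m: "m k = M k 0" for k by (simp add: assms(9) moment_def M_def)
  have m_hat: "m_hat r = M 0 r" for r by (simp add: assms(10) moment1_def M_def)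
  have m_\<mu>: "m k = \<mu> k" for k
    using G_hat_moments(2)[OF assms(7) \<delta>, of k] by (simp add: assms(8,9) moment_def)
  have m_hat_\<nu>: "m_hat r = \<nu> r" for r
  proof -
    have "m_hat r = (\<Sum>i\<le>r. of_nat (r choose i) * (-1) ^ i * M (0 + i) 0)"
      unfolding m_hat by (rule alternating_binomial_of_difference_recurrence[of M, OF rec])
    also have "\<dots> = \<nu> r" unfolding \<nu>_eq_alternating_sum[symmetric] by (simp add: m[symmetric] m_\<mu>)
    finally show ?thesis .
  qed
  have diff_m: "(-1) ^ r * (fdiff ^^ r) m k = M k r" for k r
  proof -
    have "m = (\<lambda>k. M k 0)" using m by (rule ext)
    then show ?thesis using fdiff_power_of_recurrence[of M, OF rec] by (simp only:)
  qed
  have diff_m_hat: "(-1) ^ k * (fdiff ^^ k) m_hat r = M k r" for k r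
  proof -
    have "m_hat = (\<lambda>r. M 0 r)" using m_hat by (rule ext)
    then show ?thesis using fdiff_power_of_recurrence[of "\<lambda>r k. M k r", OF rec'] by (simp only:)
  qed
  have M_sum: "M k r = Gamma_prod a * (\<Sum>j\<le>k. of_nat (k choose j) * ((-1) ^ j * fact (r + j) / fact (n + r + j)) *
            hyp_div_Gamma (n + r + j) ([- of_nat n - of_nat r - of_nat j] @ a) [] b 1)" for k r
  proof -
    have "M k r = (\<Sum>j\<le>k. of_nat (k choose j) * (-1) ^ j * M 0 (r + j))"
      by (rule alternating_binomial_of_difference_recurrence[of "\<lambda>r k. M k r", OF rec'])
    also have "\<dots> = (\<Sum>j\<le>k. of_nat (k choose j) * (-1) ^ j * \<nu> (r + j))"
      by (simp only: m_hat[symmetric] m_hat_\<nu>)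
    also have "\<dots> = Gamma_prod a * (\<Sum>j\<le>k. of_nat (k choose j) * ((-1) ^ j * fact (r + j) / fact (n + r + j)) *
            hyp_div_Gamma (n + r + j) ([- of_nat n - of_nat r - of_nat j] @ a) [] b 1)"
      unfolding sum_distrib_left \<nu>_eq_hypergeometric
      by (intro sum.cong refl) (simp add: add.assoc diff_diff_eq mult_ac)
    finally show ?thesis .
  qed
  show ?thesis
  proof (intro conjI allI)
    show "set_integrable lborel {0<..<1} (\<lambda>t. G t * of_real (1 - t) ^ r * of_real t ^ k)" for k r
      by (rule mixed_moment_integrable[OF G_int])
  qed (simp_all only: diff_m diff_m_hat M_def[symmetric] M_sum[symmetric] m_\<mu> \<mu>_eq_hypergeometric m_hat_\<nu> \<nu>_eq_hypergeometric)
qed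

end
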